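(* Let $X$ be a Banach space and let $\alpha$ be an isometric automorphism of $X$. Let $T_\alpha$ be the weak$^*$ homeomorphism of the closed unit ball $B_1(X^* )$ of the dual given by $T_\alpha(\omega)=\omega\circ\alpha$. Let $Z$ be a (weak$^*$) closed $T_\alpha$-invariant subset of $B_1(X^* )$ such that the natural linear map $X\to C(Z)$, $x\mapsto(\omega\mapsto\omega(x))$, is an isomorphism from $X$ onto a closed linear subspace of $C(Z)$. Then the following are equivalent: (1) $\mathrm{hc}(\alpha)>0$; (2) $\mathrm{h}_{\mathrm{top}}(T_\alpha)>0$; (3) $\mathrm{h}_{\mathrm{top}}(T_\alpha)=\infty$; (4) there exist an $x\in X$, constants $K\ge 1$ and $d>0$, a sequence $\{n_k\}_{k\in\mathbb{N}}$ in $\mathbb{N}$ tending to infinity, and sets $I_k\subseteq\{0,1,\dots,n_k-1\}$ of cardinality at least $dn_k$ such that $\{\alpha^i(x): i\in I_k\}$ is $K$-equivalent to the standard basis of $\ell_1^{I_k}$ for each $k\in\mathbb{N}$; (5) there exists an $x\in X$ with an $\ell_1$-isomorphism set of positive density; (6) $\mathrm{h}_{\mathrm{top}}(T_\alpha|_Z)>0$. Moreover, given any total subset $\Delta$ of $X$, the element $x$ in (4) and in (5) may be taken to lie in $\Delta$ (that is, (4) and (5) with the additional requirement $x\in\Delta$ are also equivalent to conditions (1)–(6)).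
   Context: All Banach spaces are over $\mathbb{C}$. An isomorphism of Banach spaces is a bounded linear bijection with bounded inverse. $B_1(X^* )$ carries the weak$^*$ topology. $Z$ being $T_\alpha$-invariant means $T_\alpha(Z)=Z$. A subset of $X$ is total if its linear span is dense. $\mathrm{h}_{\mathrm{top}}$ is the usual topological entropy of a homeomorphism $T$ of a compact Hausdorff space: the supremum over finite open covers $\mathcal{W}$ of $\lim_n\frac1n\log N(\mathcal{W}\vee T^{-1}\mathcal{W}\vee\cdots\vee T^{-(n-1)}\mathcal{W})$, where $N(\cdot)$ is the smallest cardinality of a subcover. CA entropy: For a bounded linear map $\gamma:X\to Y$ of Banach spaces, a finite set $\Omega\subseteq X$ and $\delta>0$, let $\mathrm{CA}(\gamma,\Omega,\delta)$ be the collection of triples $(\phi,\psi,d)$ where $d$ is a positive integer and $\phi:X\to\ell_\infty^d$, $\psi:\ell_\infty^d\to Y$ are contractive (norm $\le1$) linear maps with $\|\psi\circ\phi(x)-\gamma(x)\|<\delta$ for all $x\in\Omega$. A CA embedding of $X$ is an isometric linear map $\iota$ from $X$ into a Banach space $Y$ such that $\mathrm{CA}(\iota,\Omega,\delta)\neq\emptyset$ for all finite $\Omega\subseteq X$ and $\delta>0$; every Banach space has one (e.g. the evaluation map $X\to C(B_1(X^* ))$). Set $\mathrm{rc}(\Omega,\delta)=\inf\{d:(\phi,\psi,d)\in\mathrm{CA}(\iota,\Omega,\delta)\}$, which does not depend on the CA embedding $\iota$. For an isometric (surjective linear) automorphism $\alpha$ of $X$ put $\mathrm{hc}(\alpha,\Omega,\delta)=\limsup_{n\to\infty}\frac1n\log\mathrm{rc}(\Omega\cup\alpha\Omega\cup\cdots\cup\alpha^{n-1}\Omega,\delta)$,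 $\mathrm{hc}(\alpha,\Omega)=\sup_{\delta>0}\mathrm{hc}(\alpha,\Omega,\delta)$, and $\mathrm{hc}(\alpha)=\sup_\Omega\mathrm{hc}(\alpha,\Omega)$ over finite $\Omega\subseteq X$. Given an index set $I$, a family $\{\alpha^i(x):i\in I\}$ is equivalent to the standard basis of $\ell_1^I$ if the linear map sending the standard basis element of $\ell_1^I$ indexed by $i$ to $\alpha^i(x)$ extends to an isomorphism $\gamma:\ell_1^I\to\overline{\mathrm{span}}\{\alpha^i(x):i\in I\}$ (with distinct indices giving distinct elements); it is $K$-equivalent if moreover $\|\gamma\|\,\|\gamma^{-1}\|\le K$. A set $I\subseteq\mathbb{Z}$ is an $\ell_1$-isomorphism set for $x$ if $\{\alpha^i(x):i\in I\}$ is equivalent to the standard basis of $\ell_1^I$. The density of $I\subseteq\mathbb{Z}$ is $\lim_{n\to\infty}\frac{|I\cap\{-n,\dots,n\}|}{2n+1}$ when this limit exists; positive density means the limit exists and is positive. *)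

theory Defs
  imports "HOL-Analysis.Analysis" "HOL-Library.Function_Algebras"
begin

section \<open>Complex vector spaces and complex Banach spaces\<close>

class complex_vector = ab_group_add +
  fixes scaleC :: "complex \<Rightarrow> 'a \<Rightarrow> 'a"  (infixr "*\<^sub>C" 75)
  assumes scaleC_add_right: "a *\<^sub>C (x + y) = a *\<^sub>C x + a *\<^sub>C y"
    and scaleC_add_left: "(a + b) *\<^sub>C x = a *\<^sub>C x + b *\<^sub>C x"
    and scaleC_scaleC: "a *\<^sub>C b *\<^sub>C x = (a * b) *\<^sub>C x"
    and scaleC_one: "1 *\<^sub>C x = x"

class complex_banach = complex_vector + banach +
  assumes scaleR_scaleC: "r *\<^sub>R x = complex_of_real r *\<^sub>C x"
    and norm_scaleC: "norm (c *\<^sub>C x) = cmod c * norm x"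

instantiation complex :: complex_banach
begin
definition scaleC_complex_def: "c *\<^sub>C (z :: complex) = c * z"
instance
  by standard
    (auto simp: scaleC_complex_def algebra_simps norm_mult scaleR_conv_of_real)
end

instantiation "fun" :: (type, complex_vector) complex_vector
begin
definition scaleC_fun_def: "c *\<^sub>C f = (\<lambda>i. c *\<^sub>C f i)"
instance
  by standard
    (auto simp: scaleC_fun_def fun_eq_iff scaleC_add_right scaleC_add_left
      scaleC_scaleC scaleC_one)
end

global_interpretation cvs: vector_space "scaleC :: complex \<Rightarrow> 'a \<Rightarrow> 'a::complex_vector"
  defines cspan = cvs.span and csubspace = cvs.subspace
  by standard (rule scaleC_add_right scaleC_add_left scaleC_scaleC scaleC_one)+

definition total_set :: "'a::complex_banach set \<Rightarrow> bool" where
  "total_set \<Delta> \<longleftrightarrow> closure (cspan \<Delta>) = UNIV"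


section \<open>Linear maps between normed spaces given by a carrier and a norm\<close>

text \<open>The space \<open>X\<close> is a type of class \<^class>\<open>complex_banach\<close>.  The other spaces (\<open>C(K)\<close>,
  \<open>\<ell>\<^sub>\<infinity>\<^sup>d\<close>, \<open>\<ell>\<^sub>1\<^sup>I\<close>, closed linear spans) depend on parameters; they are linear subspaces \<open>V\<close> of
  a type of class \<^class>\<open>complex_vector\<close> together with a norm function \<open>nV\<close> that is only
  meaningful on \<open>V\<close>.\<close>

definition clinear_on :: "'v::complex_vector set \<Rightarrow> ('v \<Rightarrow> 'w::complex_vector) \<Rightarrow> bool" where
  "clinear_on V f \<longleftrightarrow>
     (\<forall>x\<in>V. \<forall>y\<in>V. f (x + y) = f x + f y) \<and> (\<forall>c. \<forall>x\<in>V. f (c *\<^sub>C x) = c *\<^sub>C f x)"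

definition contraction_on ::
  "'v set \<Rightarrow> ('v \<Rightarrow> real) \<Rightarrow> 'w set \<Rightarrow> ('w \<Rightarrow> real) \<Rightarrow>
    ('v::complex_vector \<Rightarrow> 'w::complex_vector) \<Rightarrow> bool" where
  "contraction_on V nV W nW f \<longleftrightarrow>
     clinear_on V f \<and> f ` V \<subseteq> W \<and> (\<forall>x\<in>V. nW (f x) \<le> nV x)"

definition bounded_on :: "'v set \<Rightarrow> ('v \<Rightarrow> real) \<Rightarrow> ('w \<Rightarrow> real) \<Rightarrow> ('v \<Rightarrow> 'w) \<Rightarrow> bool" where
  "bounded_on V nV nW f \<longleftrightarrow> (\<exists>C. \<forall>x\<in>V. nW (f x) \<le> C * nV x)"

definition opnorm_on :: "'v set \<Rightarrow> ('v \<Rightarrow> real) \<Rightarrow> ('w \<Rightarrow> real) \<Rightarrow> ('v \<Rightarrow> 'w) \<Rightarrow> real" where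
  "opnorm_on V nV nW f = Inf {C. 0 \<le> C \<and> (\<forall>x\<in>V. nW (f x) \<le> C * nV x)}"

definition isomorphism_on ::
  "'v set \<Rightarrow> ('v \<Rightarrow> real) \<Rightarrow> 'w set \<Rightarrow> ('w \<Rightarrow> real) \<Rightarrow>
    ('v::complex_vector \<Rightarrow> 'w::complex_vector) \<Rightarrow> bool" where
  "isomorphism_on V nV W nW f \<longleftrightarrow>
     clinear_on V f \<and> bij_betw f V W \<and>
     bounded_on V nV nW f \<and> bounded_on W nW nV (inv_into V f)"

definition norm_closed_in :: "'v::ab_group_add set \<Rightarrow> ('v \<Rightarrow> real) \<Rightarrow> 'v set \<Rightarrow> bool" where
  "norm_closed_in V nV W \<longleftrightarrow>
     (\<forall>f g. (\<forall>n::nat. f n \<in> W) \<and> g \<in> V \<and> (\<lambda>n. nV (f n - g)) \<longlonglongrightarrow> 0 \<longrightarrow> g \<in> W)"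


section \<open>The spaces involved\<close>

text \<open>Inserting \<open>0\<close> only matters for \<open>K = {}\<close>.\<close>

definition sup_norm :: "'k set \<Rightarrow> ('k \<Rightarrow> complex) \<Rightarrow> real" where
  "sup_norm K f = Sup (insert 0 ((\<lambda>k. cmod (f k)) ` K))"

text \<open>\<open>C(K)\<close> for compact \<open>K\<close>, with norm \<open>sup_norm K\<close>; functions on \<open>K\<close> are extended by \<open>0\<close>.\<close>

definition C_space :: "'k::topological_space set \<Rightarrow> ('k \<Rightarrow> complex) set" where
  "C_space K = {f. continuous_on K f \<and> (\<forall>k. k \<notin> K \<longrightarrow> f k = 0)}"

text \<open>\<open>\<ell>\<^sub>\<infinity>\<^sup>d\<close>, with norm \<open>sup_norm {..<d}\<close>.\<close>

definition ell_inf :: "nat \<Rightarrow> (nat \<Rightarrow> complex) set" where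
  "ell_inf d = {v. \<forall>i\<ge>d. v i = 0}"

definition ell1 :: "'i set \<Rightarrow> ('i \<Rightarrow> complex) set" where
  "ell1 I = {a. (\<lambda>i. cmod (a i)) summable_on I \<and> (\<forall>i. i \<notin> I \<longrightarrow> a i = 0)}"

definition ell1_norm :: "'i set \<Rightarrow> ('i \<Rightarrow> complex) \<Rightarrow> real" where
  "ell1_norm I a = (\<Sum>\<^sub>\<infinity>i\<in>I. cmod (a i))"

text \<open>The closed unit ball \<open>B\<^sub>1(X\<^sup>*)\<close>.  The topology that the library puts on the function type
  \<^typ>\<open>'a \<Rightarrow> complex\<close> is the product topology, i.e. that of pointwise convergence, so
  the weak* topology on subsets of the ball is the subspace topology.\<close>

definition dual_ball :: "('a::complex_banach \<Rightarrow> complex) set" where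
  "dual_ball = {\<omega>. clinear_on UNIV \<omega> \<and> (\<forall>x. cmod (\<omega> x) \<le> norm x)}"

text \<open>The natural map \<open>X \<rightarrow> C(Z)\<close>.\<close>

definition eval_on :: "('a \<Rightarrow> complex) set \<Rightarrow> 'a \<Rightarrow> ('a \<Rightarrow> complex) \<Rightarrow> complex" where
  "eval_on Z x = (\<lambda>\<omega>. if \<omega> \<in> Z then \<omega> x else 0)"


section \<open>Isometric automorphisms\<close>

definition isometric_automorphism :: "('a::complex_banach \<Rightarrow> 'a) \<Rightarrow> bool" where
  "isometric_automorphism \<alpha> \<longleftrightarrow> clinear_on UNIV \<alpha> \<and> surj \<alpha> \<and> (\<forall>x. norm (\<alpha> x) = norm x)"

definition int_iterate :: "('a \<Rightarrow> 'a) \<Rightarrow> int \<Rightarrow> 'a \<Rightarrow> 'a" where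
  "int_iterate \<alpha> i = (if 0 \<le> i then \<alpha> ^^ nat i else inv \<alpha> ^^ nat (- i))"

definition dual_map :: "('a \<Rightarrow> 'a) \<Rightarrow> ('a \<Rightarrow> complex) \<Rightarrow> 'a \<Rightarrow> complex" where
  "dual_map \<alpha> \<omega> = \<omega> \<circ> \<alpha>"


section \<open>CA entropy\<close>

text \<open>\<open>(V, nV)\<close> is the target space of \<open>\<gamma>\<close>.\<close>

definition CA ::
  "'w set \<Rightarrow> ('w \<Rightarrow> real) \<Rightarrow> ('a::complex_banach \<Rightarrow> 'w::complex_vector) \<Rightarrow> 'a set \<Rightarrow> real \<Rightarrow>
    (('a \<Rightarrow> nat \<Rightarrow> complex) \<times> ((nat \<Rightarrow> complex) \<Rightarrow> 'w) \<times> nat) set" where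
  "CA V nV \<gamma> \<Omega> \<delta> =
     {(\<phi>, \<psi>, d). 0 < d \<and>
        contraction_on UNIV norm (ell_inf d) (sup_norm {..<d}) \<phi> \<and>
        contraction_on (ell_inf d) (sup_norm {..<d}) V nV \<psi> \<and>
        (\<forall>x\<in>\<Omega>. nV (\<psi> (\<phi> x) - \<gamma> x) < \<delta>)}"

text \<open>The contractive rank is independent of the CA embedding; it is computed here in the evaluation
  map \<open>X \<rightarrow> C(B\<^sub>1(X\<^sup>*))\<close>, which is a CA embedding of every Banach space.\<close>

definition rc :: "'a::complex_banach set \<Rightarrow> real \<Rightarrow> nat" where
  "rc \<Omega> \<delta> =
     Inf {d. \<exists>\<phi> \<psi>. (\<phi>, \<psi>, d) \<in> CA (C_space dual_ball) (sup_norm dual_ball) (eval_on dual_ball) \<Omega> \<delta>}"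

definition hc_at :: "('a::complex_banach \<Rightarrow> 'a) \<Rightarrow> 'a set \<Rightarrow> real \<Rightarrow> ereal" where
  "hc_at \<alpha> \<Omega> \<delta> = limsup (\<lambda>n. ereal (1 / real n * ln (real (rc (\<Union>i<n. (\<alpha> ^^ i) ` \<Omega>) \<delta>))))"

definition hc_set :: "('a::complex_banach \<Rightarrow> 'a) \<Rightarrow> 'a set \<Rightarrow> ereal" where
  "hc_set \<alpha> \<Omega> = (SUP \<delta>\<in>{0<..}. hc_at \<alpha> \<Omega> \<delta>)"

definition hc :: "('a::complex_banach \<Rightarrow> 'a) \<Rightarrow> ereal" where
  "hc \<alpha> = (SUP \<Omega>\<in>{\<Omega>. finite \<Omega>}. hc_set \<alpha> \<Omega>)"


section \<open>Topological entropy\<close>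

definition finite_open_cover :: "'k topology \<Rightarrow> 'k set set \<Rightarrow> bool" where
  "finite_open_cover K \<W> \<longleftrightarrow> finite \<W> \<and> (\<forall>U\<in>\<W>. openin K U) \<and> \<Union>\<W> = topspace K"

definition cover_join :: "'k set set \<Rightarrow> 'k set set \<Rightarrow> 'k set set"  (infixl "\<squnion>\<^sub>c" 65) where
  "\<V> \<squnion>\<^sub>c \<W> = {A \<inter> B |A B. A \<in> \<V> \<and> B \<in> \<W>}"

definition cover_preimage :: "'k topology \<Rightarrow> ('k \<Rightarrow> 'k) \<Rightarrow> 'k set set \<Rightarrow> 'k set set" where
  "cover_preimage K T \<W> = (\<lambda>U. T -` U \<inter> topspace K) ` \<W>"

text \<open>The join of \<open>\<W>, T\<^sup>-\<^sup>1\<W>, \<dots>, T\<^sup>-\<^sup>(\<^sup>n\<^sup>-\<^sup>1\<^sup>)\<W>\<close>.\<close>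

primrec iterated_join :: "'k topology \<Rightarrow> ('k \<Rightarrow> 'k) \<Rightarrow> 'k set set \<Rightarrow> nat \<Rightarrow> 'k set set" where
  "iterated_join K T \<W> 0 = {topspace K}"
| "iterated_join K T \<W> (Suc n) = iterated_join K T \<W> n \<squnion>\<^sub>c cover_preimage K (T ^^ n) \<W>"

definition min_subcover :: "'k topology \<Rightarrow> 'k set set \<Rightarrow> nat" where
  "min_subcover K \<W> = Inf {card \<V> |\<V>. \<V> \<subseteq> \<W> \<and> finite \<V> \<and> \<Union>\<V> = topspace K}"

definition cover_entropy :: "'k topology \<Rightarrow> ('k \<Rightarrow> 'k) \<Rightarrow> 'k set set \<Rightarrow> real" where
  "cover_entropy K T \<W> =
     lim (\<lambda>n. 1 / real n * ln (real (min_subcover K (iterated_join K T \<W> n))))"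

definition htop :: "'k topology \<Rightarrow> ('k \<Rightarrow> 'k) \<Rightarrow> ereal" where
  "htop K T = (SUP \<W>\<in>{\<W>. finite_open_cover K \<W>}. ereal (cover_entropy K T \<W>))"


section \<open>Equivalence with the standard basis of \<open>\<ell>\<^sub>1\<close>\<close>

text \<open>A witnessing isomorphism is injective, so distinct indices give distinct \<open>v i\<close>.\<close>

definition ell1_basis_isomorphism ::
  "'i set \<Rightarrow> ('i \<Rightarrow> 'a::complex_banach) \<Rightarrow> (('i \<Rightarrow> complex) \<Rightarrow> 'a) \<Rightarrow> bool" where
  "ell1_basis_isomorphism I v \<gamma> \<longleftrightarrow>
     (\<forall>i\<in>I. \<gamma> (\<lambda>j. if j = i then 1 else 0) = v i) \<and>
     isomorphism_on (ell1 I) (ell1_norm I) (closure (cspan (v ` I))) norm \<gamma>"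

definition equivalent_ell1_basis :: "'i set \<Rightarrow> ('i \<Rightarrow> 'a::complex_banach) \<Rightarrow> bool" where
  "equivalent_ell1_basis I v \<longleftrightarrow> (\<exists>\<gamma>. ell1_basis_isomorphism I v \<gamma>)"

definition K_equivalent_ell1_basis :: "real \<Rightarrow> 'i set \<Rightarrow> ('i \<Rightarrow> 'a::complex_banach) \<Rightarrow> bool" where
  "K_equivalent_ell1_basis K I v \<longleftrightarrow>
     (\<exists>\<gamma>. ell1_basis_isomorphism I v \<gamma> \<and>
        opnorm_on (ell1 I) (ell1_norm I) norm \<gamma> *
        opnorm_on (closure (cspan (v ` I))) norm (ell1_norm I) (inv_into (ell1 I) \<gamma>) \<le> K)"

definition ell1_isomorphism_set :: "('a::complex_banach \<Rightarrow> 'a) \<Rightarrow> 'a \<Rightarrow> int set \<Rightarrow> bool" where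
  "ell1_isomorphism_set \<alpha> x I \<longleftrightarrow> equivalent_ell1_basis I (\<lambda>i. int_iterate \<alpha> i x)"

definition positive_density :: "int set \<Rightarrow> bool" where
  "positive_density I \<longleftrightarrow>
     (\<exists>D>0. (\<lambda>n. real (card (I \<inter> {- int n..int n})) / (2 * real n + 1)) \<longlonglongrightarrow> D)"

end

theory Submission
  imports Defs
begin

text \<open>
  All six conditions are compared with one condition on a vector \<open>x\<close>, called \<open>many_ell1 \<alpha> x\<close>:
  for fixed \<open>\<rho>, d > 0\<close> there are arbitrarily large \<open>n\<close> and sets \<open>I \<subseteq> {0, \<dots>, n - 1}\<close> of at least \<open>d n\<close>
  times such that \<open>\<parallel>\<Sum>\<^sub>i a\<^sub>i \<alpha>\<^sup>i x\<parallel> \<ge> \<rho> \<Sum>\<^sub>i \<bar>a\<^sub>i\<bar>\<close> for all scalars \<open>a\<^sub>i\<close>, \<open>i \<in> I\<close>.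

  \<^emph>\<open>From entropy to \<open>\<ell>\<^sub>1\<close>\<close> (\<open>positive_entropy_imp_many_ell1\<close>).  Let \<open>K\<close> be a weak* compact invariant subset of
  the dual ball, such as the ball itself or \<open>Z\<close>, on which the dual map has positive entropy.  Since the
  weak* topology of \<open>K\<close> is generated by a total set, the entropy is already visible through the values
  at finitely many \<open>x \<in> \<Delta>\<close>.  Replacing functionals by nearby members of a finite set \<open>P\<close>, orbits become
  words over the alphabet \<open>P\<close>.  Positive entropy gives exponentially many words of length \<open>n\<close> any two of
  which have letters with clearly different values in a fixed proportion of the positions.  Splitting such a
  family again and again at a position where two such letters are both frequent produces
  exponentially many shattered sets of positions (\<open>many_shattered_sets\<close>); as there are too few sets with
  fewer than \<open>c n\<close> elements, one of them is large.  By the pigeonhole principle a proportional part uses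
  only two letters and one vector \<open>x\<close>.  The orbit of \<open>x\<close> then realises every pattern of two fixed values,
  and differences of opposite patterns bound \<open>\<parallel>\<Sum>\<^sub>i a\<^sub>i \<alpha>\<^sup>i x\<parallel>\<close> from below (\<open>two_values_imp_ell1_lower\<close>).

  \<^emph>\<open>From \<open>\<ell>\<^sub>1\<close> to entropy.\<close>  The assumption on \<open>Z\<close> says that the norm of \<open>X\<close> is, up to a constant, a
  supremum over \<open>Z\<close> and hence over the dual ball (\<open>norming\<close>); this replaces the Hahn-Banach theorem throughout.
  By an exponential moment estimate, a family of bounded vectors must have
  exponentially many members if each of the \<open>2\<^sup>m\<close> sign patterns of length \<open>m\<close> has a large signed sum on one of them
  (\<open>signs_need_many_functionals\<close>).  Applied to the names of a cover of
  \<open>Z\<close> this gives positive entropy on \<open>Z\<close>, and applied to the coordinates of \<open>\<ell>\<^sub>\<infinity>\<^sup>d\<close> it makes the contractive rank grow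
  exponentially, so that \<open>hc \<alpha> > 0\<close>.  On the whole ball, which is convex and balanced, all
  sufficiently small values can be prescribed at the times in \<open>I\<close> (\<open>ell1_interpolation\<close>); with \<open>m\<close> values
  per time the entropy is at least \<open>d log m\<close>, hence infinite.  Conversely, partitions of unity bound the
  contractive rank by covering numbers, so \<open>hc \<alpha> > 0\<close> forces positive entropy on the ball.

  \<^emph>\<open>Positive density.\<close>  For fixed \<open>x\<close> and \<open>\<rho>\<close>, the sets of times that satisfy the lower estimate form a
  hereditary, shift-invariant family of finite character.  The largest density that its finite members
  have in long intervals is attained, as a limit, by an infinite member (\<open>positive_density_member\<close>), and an
  infinite \<open>\<ell>\<^sub>1\<close> lower estimate extends to an isomorphism of \<open>\<ell>\<^sub>1\<close> onto the closed span.
\<close>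


section \<open>Subadditive sequences, small sets and sign patterns\<close>

lemma fekete_lower:
  fixes u :: "nat \<Rightarrow> real"
  assumes nn: "\<And>n. 0 \<le> u n" and "1 \<le> n"
  shows "(INF n\<in>{1..}. u n / real n) \<le> u n / real n"
proof (rule cINF_lower)
  show "bdd_below ((\<lambda>n. u n / real n) ` {1..})"
    by (rule bdd_belowI2[of _ 0]) (simp add: nn)
qed (use assms in simp)

text \<open>Fekete's argument: blocks of a near-optimal length \<open>m\<close> fill \<open>n\<close> up to a remainder below \<open>m\<close>, whose
  cost \<open>C\<close> does not depend on \<open>n\<close>.\<close>

lemma fekete_limit:
  fixes u :: "nat \<Rightarrow> real"
  assumes sub: "\<And>m n. u (m + n) \<le> u m + u n" and nn: "\<And>n. 0 \<le> u n"
  shows "(\<lambda>n. u n / real n) \<longlonglongrightarrow> (INF n\<in>{1..}. u n / real n)" (is "_ \<longlonglongrightarrow> ?L")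
proof (rule LIMSEQ_I)
  fix r :: real assume r: "0 < r"
  have "(INF n\<in>{1..}. u n / real n) < ?L + r / 2"
    using r by simp
  then obtain m where m: "1 \<le> m" "u m / real m < ?L + r / 2"
    by (subst (asm) cINF_less_iff) (auto intro!: bdd_belowI2[of _ 0] simp: nn)
  have mult: "u (q * m + k) \<le> real q * u m + u k" for q k
  proof (induction q)
    case (Suc q)
    have "u (Suc q * m + k) \<le> u m + u (q * m + k)"
      using sub[of m "q * m + k"] by (simp add: algebra_simps)
    then show ?case using Suc by (simp add: algebra_simps)
  qed simp
  define C where "C = (\<Sum>k<m. u k)"
  obtain N where N: "real N > 2 * C / r" using reals_Archimedean2 by blast
  show "\<exists>no. \<forall>n\<ge>no. norm (u n / real n - ?L) < r"
  proof (intro exI allI impI)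
    fix n assume n: "max 1 N \<le> n"
    have "u (n mod m) \<le> C"
      unfolding C_def using m by (intro member_le_sum) (auto simp: nn)
    moreover have "u n \<le> real (n div m) * u m + u (n mod m)"
      using mult[of "n div m" "n mod m"] by simp
    moreover have "real (n div m) * u m \<le> real n * (u m / real m)"
    proof -
      have "real (n div m) * real m \<le> real n"
        by (metis div_times_less_eq_dividend of_nat_le_iff of_nat_mult)
      then have "real (n div m) * real m * (u m / real m) \<le> real n * (u m / real m)"
        by (rule mult_right_mono) (simp add: nn)
      then show ?thesis using m by simp
    qed
    ultimately have "u n \<le> real n * (u m / real m) + C" by linarith
    then have "u n / real n \<le> u m / real m + C / real n"
      using n by (simp add: field_simps)
    moreover have "C / real n < r / 2"
    proof -
      have "2 * C / r < real n" using N n by linarith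
      then show ?thesis using r n by (simp add: field_simps)
    qed
    moreover have "?L \<le> u n / real n"
      using n by (intro fekete_lower nn) auto
    ultimately show "norm (u n / real n - ?L) < r" using m(2) unfolding real_norm_def by linarith
  qed
qed

lemma sum_power_card_Pow:
  fixes t :: real
  assumes "finite U"
  shows "(\<Sum>E\<in>Pow U. t ^ card E) = (1 + t) ^ card U"
  using assms
proof (induction U)
  case (insert x U)
  have "(\<Sum>E\<in>Pow (insert x U). t ^ card E)
      = (\<Sum>E\<in>Pow U. t ^ card E) + (\<Sum>E\<in>insert x ` Pow U. t ^ card E)"
    unfolding Pow_insert using insert by (intro sum.union_disjoint) auto
  also have "(\<Sum>E\<in>insert x ` Pow U. t ^ card E) = (\<Sum>E\<in>Pow U. t ^ card (insert x E))"
    using insert(2) by (subst sum.reindex) (auto intro!: inj_onI)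
  also have "\<dots> = (\<Sum>E\<in>Pow U. t * t ^ card E)"
  proof (rule sum.cong)
    fix E assume "E \<in> Pow U"
    then have "finite E" "x \<notin> E" using insert finite_subset by auto
    then show "t ^ card (insert x E) = t * t ^ card E" by simp
  qed simp
  finally show ?case using insert by (simp add: sum_distrib_left[symmetric] algebra_simps)
qed simp

text \<open>Give a set \<open>E \<subseteq> U\<close> the weight \<open>t ^ card E\<close>.  For small \<open>t\<close> the total weight \<open>(1 + t) ^ card U\<close> is at most
  \<open>exp (\<eta> n / 2)\<close>, while each set with at most \<open>c n\<close> elements has weight at least \<open>exp (- \<eta> n / 2)\<close>.\<close>

lemma card_small_subsets:
  fixes \<eta> :: real and k :: nat
  assumes "0 < \<eta>"
  obtains c where "0 < c"
    and "\<And>n U. finite U \<Longrightarrow> card U \<le> k * n \<Longrightarrow>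
           real (card {E. E \<subseteq> U \<and> real (card E) \<le> c * real n}) \<le> exp (\<eta> * real n)"
proof -
  define t where "t = min (1/2) (\<eta> / (2 * (real k + 1)))"
  have t: "0 < t" "t < 1" using assms by (auto simp: t_def)
  have tk: "t * real k \<le> \<eta> / 2"
  proof -
    have "t * (real k + 1) \<le> \<eta> / (2 * (real k + 1)) * (real k + 1)"
      by (rule mult_right_mono) (auto simp: t_def)
    also have "\<dots> = \<eta> / 2" by (simp add: field_simps add_nonneg_eq_0_iff)
    finally show ?thesis using t by (simp add: algebra_simps)
  qed
  define l where "l = - ln t"
  have l: "0 < l" using t by (simp add: l_def)
  define c where "c = \<eta> / (2 * l)"
  have c: "0 < c" "c * l = \<eta> / 2" using l assms by (auto simp: c_def)
  have "real (card {E. E \<subseteq> U \<and> real (card E) \<le> c * real n}) \<le> exp (\<eta> * real n)"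
    if U: "finite U" "card U \<le> k * n" for n and U :: "'b set"
  proof -
    let ?S = "{E. E \<subseteq> U \<and> real (card E) \<le> c * real n}"
    have fin: "finite ?S" using U(1) by (auto intro: finite_subset[of _ "Pow U"])
    have "real (card ?S) = (\<Sum>E\<in>?S. 1)" by simp
    also have "\<dots> \<le> (\<Sum>E\<in>?S. exp (l * (c * real n)) * t ^ card E)"
    proof (rule sum_mono)
      fix E assume "E \<in> ?S"
      then have "l * real (card E) \<le> l * (c * real n)" using l by simp
      then have "1 \<le> exp (l * (c * real n) - l * real (card E))" by simp
      also have "\<dots> = exp (l * (c * real n)) * t ^ card E"
        using t by (simp add: exp_diff l_def exp_minus powr_realpow[symmetric] powr_def field_simps)
      finally show "1 \<le> exp (l * (c * real n)) * t ^ card E" .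
    qed
    also have "\<dots> \<le> (\<Sum>E\<in>Pow U. exp (l * (c * real n)) * t ^ card E)"
      using U(1) t by (intro sum_mono2) auto
    also have "\<dots> = exp (l * (c * real n)) * (1 + t) ^ card U"
      using sum_power_card_Pow[OF U(1), of t] by (simp add: sum_distrib_left[symmetric])
    also have "\<dots> \<le> exp (l * (c * real n)) * exp (t * real (k * n))"
    proof -
      have "(1 + t) ^ card U \<le> (1 + t) ^ (k * n)"
        using U t by (intro power_increasing) auto
      also have "\<dots> \<le> exp t ^ (k * n)"
        using t by (intro power_mono) (auto simp: exp_ge_add_one_self)
      also have "\<dots> = exp (t * real (k * n))"
        by (simp add: exp_of_nat_mult[symmetric] mult.commute)
      finally show ?thesis by simp
    qed
    also have "\<dots> \<le> exp (\<eta> * real n)"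
    proof -
      have "l * (c * real n) = \<eta> / 2 * real n" using c by (simp add: mult.commute mult.left_commute)
      moreover have "t * real (k * n) \<le> \<eta> / 2 * real n"
        using mult_right_mono[OF tk, of "real n"] by (simp add: mult.assoc)
      ultimately have "l * (c * real n) + t * real (k * n) \<le> \<eta> * real n" by linarith
      then show ?thesis by (simp add: exp_add[symmetric])
    qed
    finally show ?thesis .
  qed
  then show ?thesis using that c by blast
qed

lemma exp_add_exp_minus_le: "exp u + exp (- u) \<le> 2 * exp (u\<^sup>2)" for u :: real
proof -
  have *: "exp u + exp (- u) \<le> 2 * exp (u\<^sup>2)" if u: "0 \<le> u" for u :: real
  proof (cases "u \<le> 1")
    case True
    have "exp (- u) \<le> 1 / (1 + u)"
      using exp_ge_add_one_self[of u] u by (simp add: exp_minus field_simps)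
    also have "\<dots> \<le> 1 - u + u\<^sup>2"
    proof -
      have "1 \<le> (1 - u + u\<^sup>2) * (1 + u)"
        using u by (simp add: algebra_simps power2_eq_square)
      then show ?thesis using u by (simp add: field_simps)
    qed
    finally show ?thesis using exp_bound[OF u True] exp_ge_add_one_self[of "u\<^sup>2"] by linarith
  next
    case False
    then have "u \<le> u\<^sup>2" using u by (simp add: power2_eq_square)
    moreover from this have "- u \<le> u\<^sup>2" using u by linarith
    ultimately have "exp u \<le> exp (u\<^sup>2)" "exp (-u) \<le> exp (u\<^sup>2)" by auto
    then show ?thesis by linarith
  qed
  show ?thesis using *[of u] *[of "-u"] by (cases "0 \<le> u") auto
qed

lemma sum_exp_signs_le:
  fixes v :: "'i \<Rightarrow> real"
  assumes I: "finite I" and v: "\<And>i. i \<in> I \<Longrightarrow> \<bar>v i\<bar> \<le> R"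
  shows "(\<Sum>s\<in>PiE I (\<lambda>_. {-1, 1}). exp (\<Sum>i\<in>I. s i * v i)) \<le> 2 ^ card I * exp (real (card I) * R\<^sup>2)"
proof -
  have "(\<Sum>s\<in>PiE I (\<lambda>_. {-1, 1}). exp (\<Sum>i\<in>I. s i * v i))
      = (\<Sum>s\<in>PiE I (\<lambda>_. {-1, 1}). \<Prod>i\<in>I. exp (s i * v i))"
    using I by (simp add: exp_sum)
  also have "\<dots> = (\<Prod>i\<in>I. \<Sum>b\<in>{-1, 1}. exp (b * v i))"
    using I by (subst prod_sum_PiE) auto
  also have "\<dots> \<le> (\<Prod>i\<in>I. 2 * exp (R\<^sup>2))"
  proof (rule prod_mono, intro conjI)
    fix i assume i: "i \<in> I"
    have "(v i)\<^sup>2 \<le> R\<^sup>2" using v[OF i] by (simp add: abs_le_square_iff[symmetric])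
    then have "2 * exp ((v i)\<^sup>2) \<le> 2 * exp (R\<^sup>2)" by simp
    then show "(\<Sum>b\<in>{-1, 1}. exp (b * v i)) \<le> 2 * exp (R\<^sup>2)"
      using exp_add_exp_minus_le[of "v i"] by (simp del: exp_le_cancel_iff)
  qed (auto intro!: sum_nonneg)
  also have "\<dots> = 2 ^ card I * exp (real (card I) * R\<^sup>2)"
    by (simp add: power_mult_distrib exp_of_nat_mult)
  finally show ?thesis .
qed

text \<open>Under uniformly random signs a vector bounded by \<open>R\<close> gives a sum of modulus at least \<open>\<rho> m\<close> only with
  exponentially small probability (Hoeffding's inequality).  If every sign pattern is served by
  some \<open>j \<in> J\<close>, the union bound makes \<open>J\<close> exponentially large.\<close>

lemma signs_need_many_functionals:
  fixes y :: "'j \<Rightarrow> 'i \<Rightarrow> complex"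
  assumes I: "finite I" and J: "finite J" and R: "0 < R" and \<rho>: "0 < \<rho>"
    and y: "\<And>j i. j \<in> J \<Longrightarrow> i \<in> I \<Longrightarrow> cmod (y j i) \<le> R"
    and norming: "\<And>s. s \<in> PiE I (\<lambda>_. {-1, 1}) \<Longrightarrow>
      \<exists>j\<in>J. \<rho> * real (card I) \<le> cmod (\<Sum>i\<in>I. complex_of_real (s i) * y j i)"
  shows "exp (\<rho>\<^sup>2 / (16 * R\<^sup>2) * real (card I)) \<le> 4 * real (card J)"
proof -
  let ?S = "PiE I (\<lambda>_. {-1, 1::real})"
  define m where "m = real (card I)"
  \<comment> \<open>This choice maximises \<open>t \<rho> / 2 - (t R)\<^sup>2\<close>, the exponential rate of the resulting bound.\<close>
  define t where "t = \<rho> / (4 * R\<^sup>2)"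
  have t: "0 < t" using R \<rho> by (simp add: t_def)
  define G where "G = (\<lambda>u s. exp (\<Sum>i\<in>I. s i * (t * u i :: real)))"
  \<comment> \<open>A complex number of modulus \<open>\<rho> m\<close> has \<open>Re\<close>, \<open>- Re\<close>, \<open>Im\<close> or \<open>- Im\<close> at least \<open>\<rho> m / 2\<close>.\<close>
  define H where "H = (\<lambda>j s. G (\<lambda>i. Re (y j i)) s + G (\<lambda>i. - Re (y j i)) s
      + (G (\<lambda>i. Im (y j i)) s + G (\<lambda>i. - Im (y j i)) s))"
  have finS: "finite ?S" using I by (intro finite_PiE) auto
  have cardS: "card ?S = 2 ^ card I" using I by (simp add: card_PiE numeral_2_eq_2)
  have G_sum: "(\<Sum>s\<in>?S. G u s) \<le> 2 ^ card I * exp (m * (t * R)\<^sup>2)"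
    if "\<And>i. i \<in> I \<Longrightarrow> \<bar>u i\<bar> \<le> R" for u
    unfolding G_def m_def using I
  proof (rule sum_exp_signs_le)
    fix i assume "i \<in> I"
    then show "\<bar>t * u i\<bar> \<le> t * R" using that t by (simp add: abs_mult)
  qed
  have H_sum: "(\<Sum>s\<in>?S. H j s) \<le> 4 * (2 ^ card I * exp (m * (t * R)\<^sup>2))" if j: "j \<in> J" for j
  proof -
    have b: "\<bar>Re (y j i)\<bar> \<le> R" "\<bar>Im (y j i)\<bar> \<le> R" if "i \<in> I" for i
      using y[OF j that] abs_Re_le_cmod[of "y j i"] abs_Im_le_cmod[of "y j i"] by linarith+
    show ?thesis unfolding H_def sum.distrib
      using G_sum[of "\<lambda>i. Re (y j i)"] G_sum[of "\<lambda>i. - Re (y j i)"]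
        G_sum[of "\<lambda>i. Im (y j i)"] G_sum[of "\<lambda>i. - Im (y j i)"] b by force
  qed
  have H_big: "exp (t * (\<rho> * m / 2)) \<le> (\<Sum>j\<in>J. H j s)" if s: "s \<in> ?S" for s
  proof -
    obtain j where j: "j \<in> J" "\<rho> * m \<le> cmod (\<Sum>i\<in>I. complex_of_real (s i) * y j i)"
      using norming[OF s] by (auto simp: m_def)
    let ?z = "\<Sum>i\<in>I. complex_of_real (s i) * y j i"
    have rm: "0 \<le> \<rho> * m" using \<rho> by (simp add: m_def)
    have "\<rho> * m \<le> \<bar>Re ?z\<bar> + \<bar>Im ?z\<bar>" using j(2) cmod_le[of ?z] by linarith
    then have alt: "\<rho> * m / 2 \<le> Re ?z \<or> \<rho> * m / 2 \<le> - Re ?z \<or> \<rho> * m / 2 \<le> Im ?z \<or> \<rho> * m / 2 \<le> - Im ?z"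
      by (auto simp: abs_if split: if_splits)
    have g: "G (\<lambda>i. Re (y j i)) s = exp (t * Re ?z)" "G (\<lambda>i. - Re (y j i)) s = exp (t * (- Re ?z))"
       "G (\<lambda>i. Im (y j i)) s = exp (t * Im ?z)" "G (\<lambda>i. - Im (y j i)) s = exp (t * (- Im ?z))"
      unfolding G_def by (simp_all add: sum_distrib_left sum_negf[symmetric] algebra_simps)
    have pos: "0 < G u s" for u by (simp add: G_def)
    have "exp (t * (\<rho> * m / 2)) \<le> H j s"
    proof -
      have "exp (t * (\<rho> * m / 2)) \<le> exp (t * w)" if "\<rho> * m / 2 \<le> w" for w
        using that t by (simp del: times_divide_eq_right)
      then have "exp (t * (\<rho> * m / 2)) \<le> G (\<lambda>i. Re (y j i)) s \<or> exp (t * (\<rho> * m / 2)) \<le> G (\<lambda>i. - Re (y j i)) s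
         \<or> exp (t * (\<rho> * m / 2)) \<le> G (\<lambda>i. Im (y j i)) s \<or> exp (t * (\<rho> * m / 2)) \<le> G (\<lambda>i. - Im (y j i)) s"
        unfolding g using alt by blast
      moreover have "0 < G (\<lambda>i. Re (y j i)) s" "0 < G (\<lambda>i. - Re (y j i)) s"
        "0 < G (\<lambda>i. Im (y j i)) s" "0 < G (\<lambda>i. - Im (y j i)) s" by (rule pos)+
      ultimately show ?thesis unfolding H_def by linarith
    qed
    also have "\<dots> \<le> (\<Sum>j\<in>J. H j s)"
      using j J by (intro member_le_sum) (auto simp: H_def G_def intro!: add_nonneg_nonneg)
    finally show ?thesis .
  qed
  have "2 ^ card I * exp (t * (\<rho> * m / 2)) = (\<Sum>s\<in>?S. exp (t * (\<rho> * m / 2)))"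
    using cardS by simp
  also have "\<dots> \<le> (\<Sum>s\<in>?S. \<Sum>j\<in>J. H j s)" by (intro sum_mono H_big)
  also have "\<dots> = (\<Sum>j\<in>J. \<Sum>s\<in>?S. H j s)" by (rule sum.swap)
  also have "\<dots> \<le> (\<Sum>j\<in>J. 4 * (2 ^ card I * exp (m * (t * R)\<^sup>2)))" by (intro sum_mono H_sum)
  also have "\<dots> = 2 ^ card I * (4 * real (card J) * exp (m * (t * R)\<^sup>2))" by simp
  finally have "exp (t * (\<rho> * m / 2)) \<le> 4 * real (card J) * exp (m * (t * R)\<^sup>2)" by simp
  then have "exp (t * (\<rho> * m / 2)) / exp (m * (t * R)\<^sup>2) \<le> 4 * real (card J)"
    by (simp add: divide_le_eq)
  moreover have "t * (\<rho> * m / 2) - m * (t * R)\<^sup>2 = \<rho>\<^sup>2 / (16 * R\<^sup>2) * m"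
    using R by (simp add: t_def field_simps power2_eq_square)
  ultimately show ?thesis by (simp add: exp_diff[symmetric] m_def)
qed

section \<open>Shattered sets of separated words\<close>

text \<open>A triple \<open>(i, p, q) \<in> E\<close> offers the two letters \<open>p\<close> and \<open>q\<close> at position \<open>i\<close>, and every choice of letters has
  to be realised by a word in \<open>S\<close>.  Carrying the letters in \<open>E\<close> lets them vary with the position.  That a position
  occurs in only one triple follows when \<open>far\<close> is irreflexive (\<open>shattered_inj_on_fst\<close>).\<close>

definition shattered :: "('c \<Rightarrow> 'c \<Rightarrow> bool) \<Rightarrow> (nat \<Rightarrow> 'c) set \<Rightarrow> (nat \<times> 'c \<times> 'c) set \<Rightarrow> bool" where
  "shattered far S E \<longleftrightarrow> (\<forall>i p q. (i, p, q) \<in> E \<longrightarrow> far p q) \<and>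
     (\<forall>A\<subseteq>E. \<exists>s\<in>S. \<forall>i p q. ((i, p, q) \<in> A \<longrightarrow> s i = p) \<and> ((i, p, q) \<in> E - A \<longrightarrow> s i = q))"

lemma shatteredD:
  assumes "shattered far S E" "A \<subseteq> E"
  obtains s where "s \<in> S" "\<And>i p q. (i, p, q) \<in> A \<Longrightarrow> s i = p"
    "\<And>i p q. (i, p, q) \<in> E \<Longrightarrow> (i, p, q) \<notin> A \<Longrightarrow> s i = q"
proof -
  have "\<exists>s\<in>S. \<forall>i p q. ((i, p, q) \<in> A \<longrightarrow> s i = p) \<and> ((i, p, q) \<in> E - A \<longrightarrow> s i = q)"
    using assms unfolding shattered_def by simp
  then show ?thesis using that by (metis DiffI)
qed

lemma shattered_mono: "shattered far S E \<Longrightarrow> S \<subseteq> S' \<Longrightarrow> shattered far S' E"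
  unfolding shattered_def by (meson subsetD)

lemma shattered_inj_on_fst:
  assumes "shattered far S E" and irrefl: "\<And>p. \<not> far p p"
  shows "inj_on fst E"
proof (rule inj_onI)
  fix x y assume xy: "x \<in> E" "y \<in> E" "fst x = fst y"
  obtain i p q where x: "x = (i, p, q)" by (cases x)
  obtain p' q' where y: "y = (i, p', q')" using xy(3) x by (cases y) auto
  have E: "(i, p, q) \<in> E" "(i, p', q') \<in> E" using xy x y by auto
  have neq: "p \<noteq> q" "p' \<noteq> q'"
    using assms E unfolding shattered_def by fastforce+
  obtain s where s: "\<And>i p q. (i, p, q) \<in> E \<Longrightarrow> s i = p"
    using shatteredD[OF assms(1) subset_refl] by metis
  have "p = p'" using s[OF E(1)] s[OF E(2)] by simp
  moreover obtain t where t: "\<And>i p q. (i, p, q) \<in> E \<Longrightarrow> t i = q"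
    using shatteredD[OF assms(1) empty_subsetI] by (metis empty_iff)
  have "q = q'" using t[OF E(1)] t[OF E(2)] by simp
  ultimately show "x = y" by (simp add: x y)
qed

lemma shattered_insert:
  assumes p: "shattered far {s \<in> S. s i = p} E" and q: "shattered far {s \<in> S. s i = q} E" and "far p q"
  shows "shattered far S (insert (i, p, q) E)"
  unfolding shattered_def
proof (intro conjI allI impI)
  fix j p' q' assume "(j, p', q') \<in> insert (i, p, q) E"
  then show "far p' q'"
    using assms unfolding shattered_def by auto
next
  fix A assume A: "A \<subseteq> insert (i, p, q) E"
  have sub: "A - {(i, p, q)} \<subseteq> E" using A by auto
  show "\<exists>s\<in>S. \<forall>j p' q'. ((j, p', q') \<in> A \<longrightarrow> s j = p') \<and> ((j, p', q') \<in> insert (i, p, q) E - A \<longrightarrow> s j = q')"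
  proof (cases "(i, p, q) \<in> A")
    case True
    obtain s where s: "s \<in> {s \<in> S. s i = p}" "\<And>j p' q'. (j, p', q') \<in> A - {(i, p, q)} \<Longrightarrow> s j = p'"
        "\<And>j p' q'. (j, p', q') \<in> E \<Longrightarrow> (j, p', q') \<notin> A - {(i, p, q)} \<Longrightarrow> s j = q'"
      by (rule shatteredD[OF p sub]) blast
    have "s j = p'" if "(j, p', q') \<in> A" for j p' q'
      using s(1) s(2)[of j p' q'] that by (cases "(j, p', q') = (i, p, q)") auto
    moreover have "s j = q'" if "(j, p', q') \<in> insert (i, p, q) E" "(j, p', q') \<notin> A" for j p' q'
      using s(3)[of j p' q'] True that by auto
    ultimately show ?thesis using s(1) by blast
  next
    case False
    obtain s where s: "s \<in> {s \<in> S. s i = q}" "\<And>j p' q'. (j, p', q') \<in> A - {(i, p, q)} \<Longrightarrow> s j = p'"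
        "\<And>j p' q'. (j, p', q') \<in> E \<Longrightarrow> (j, p', q') \<notin> A - {(i, p, q)} \<Longrightarrow> s j = q'"
      by (rule shatteredD[OF q sub]) blast
    have "s j = p'" if "(j, p', q') \<in> A" for j p' q'
      using s(2)[of j p' q'] that False by auto
    moreover have "s j = q'" if "(j, p', q') \<in> insert (i, p, q) E" "(j, p', q') \<notin> A" for j p' q'
      using s(1) s(3)[of j p' q'] that by (cases "(j, p', q') = (i, p, q)") auto
    ultimately show ?thesis using s(1) by blast
  qed
qed

definition shattered_sets :: "('c \<Rightarrow> 'c \<Rightarrow> bool) \<Rightarrow> nat \<Rightarrow> 'c set \<Rightarrow> (nat \<Rightarrow> 'c) set \<Rightarrow> (nat \<times> 'c \<times> 'c) set set" where
  "shattered_sets far n C S = {E. E \<subseteq> {..<n} \<times> C \<times> C \<and> shattered far S E}"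

text \<open>Words with constant letter at \<open>i\<close> shatter no set that uses \<open>i\<close>.  A set shattered by both halves is counted
  twice on the left; on the right it reappears with \<open>(i, p, q)\<close> inserted.\<close>

lemma shattered_sets_split:
  assumes fin: "finite C" and i: "i < n" and pq: "p \<in> C" "q \<in> C" "far p q"
    and irrefl: "\<And>p. \<not> far p p"
  shows "card (shattered_sets far n C {s \<in> S. s i = p}) + card (shattered_sets far n C {s \<in> S. s i = q})
       \<le> card (shattered_sets far n C S)"
proof -
  let ?P = "shattered_sets far n C {s \<in> S. s i = p}" and ?Q = "shattered_sets far n C {s \<in> S. s i = q}"
  let ?ins = "insert (i, p, q)"
  have finS: "finite (shattered_sets far n C T)" for T
    by (rule finite_subset[of _ "Pow ({..<n} \<times> C \<times> C)"]) (auto simp: shattered_sets_def fin)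
  have const: "(i, r, r') \<notin> E" if sh: "shattered far {s \<in> S. s i = c} E" for E r r' c
  proof
    assume E: "(i, r, r') \<in> E"
    then have "far r r'" using sh unfolding shattered_def by auto
    obtain s where "s \<in> {s \<in> S. s i = c}" "s i = r"
      using shatteredD[OF sh subset_refl] E by metis
    moreover obtain t where "t \<in> {s \<in> S. s i = c}" "t i = r'"
      using shatteredD[OF sh empty_subsetI] E by (metis empty_iff)
    ultimately show False using irrefl \<open>far r r'\<close> by auto
  qed
  have new: "(i, p, q) \<notin> E" if "E \<in> ?P \<union> ?Q" for E
    using that const by (auto simp: shattered_sets_def)
  have inj: "inj_on ?ins (?P \<inter> ?Q)"
  proof (rule inj_onI)
    fix E E' assume "E \<in> ?P \<inter> ?Q" "E' \<in> ?P \<inter> ?Q" "?ins E = ?ins E'"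
    moreover from this have "(i, p, q) \<notin> E" "(i, p, q) \<notin> E'" using new by blast+
    ultimately show "E = E'" by (metis Diff_insert_absorb)
  qed
  have "card ?P + card ?Q = card (?P \<union> ?Q) + card (?P \<inter> ?Q)"
    by (intro card_Un_Int finS)
  also have "card (?P \<inter> ?Q) = card (?ins ` (?P \<inter> ?Q))"
    by (rule card_image[OF inj, symmetric])
  also have "card (?P \<union> ?Q) + card (?ins ` (?P \<inter> ?Q)) = card ((?P \<union> ?Q) \<union> ?ins ` (?P \<inter> ?Q))"
    using new by (intro card_Un_disjoint[symmetric]) (auto simp: finS)
  also have "\<dots> \<le> card (shattered_sets far n C S)"
  proof (intro card_mono finS)
    have "E \<in> shattered_sets far n C S" if "E \<in> ?P \<union> ?Q" for E
      using that by (auto simp: shattered_sets_def intro: shattered_mono[where S' = S])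
    moreover have "?ins E \<in> shattered_sets far n C S" if "E \<in> ?P \<inter> ?Q" for E
      using that shattered_insert[of far S i p E q] i pq by (auto simp: shattered_sets_def)
    ultimately show "(?P \<union> ?Q) \<union> ?ins ` (?P \<inter> ?Q) \<subseteq> shattered_sets far n C S" by blast
  qed
  finally show ?thesis .
qed

text \<open>The exponent satisfies \<open>2 a\<^sup>\<gamma> \<ge> 1\<close>, so that two halves of relative size at least \<open>a\<close> contribute together at least
  \<open>2 (a \<bar>S\<bar>)\<^sup>\<gamma> \<ge> \<bar>S\<bar>\<^sup>\<gamma>\<close>.\<close>

lemma many_shattered_sets:
  fixes a \<gamma> :: real
  assumes fin: "finite C" and irrefl: "\<And>p. \<not> far p p" and a: "0 < a" "1 \<le> 2 * a powr \<gamma>" and \<gamma>: "0 < \<gamma>"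
    and split: "\<And>S'. S' \<subseteq> S \<Longrightarrow> 2 \<le> card S' \<Longrightarrow> \<exists>i<n. \<exists>p\<in>C. \<exists>q\<in>C. far p q \<and>
        a * real (card S') \<le> real (card {s \<in> S'. s i = p}) \<and> a * real (card S') \<le> real (card {s \<in> S'. s i = q})"
    and S: "finite S" "S \<noteq> {}"
  shows "real (card S) powr \<gamma> \<le> real (card (shattered_sets far n C S))"
  using S split
proof (induction "card S" arbitrary: S rule: less_induct)
  case less
  have finS: "finite (shattered_sets far n C T)" for T
    by (rule finite_subset[of _ "Pow ({..<n} \<times> C \<times> C)"]) (auto simp: shattered_sets_def fin)
  show ?case
  proof (cases "2 \<le> card S")
    case False
    then have "card S = 1" using less.prems by (metis One_nat_def Suc_1 card_gt_0_iff less_2_cases not_le not_less0)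
    moreover have "{} \<in> shattered_sets far n C S"
      using less.prems by (auto simp: shattered_sets_def shattered_def)
    then have "1 \<le> card (shattered_sets far n C S)"
      using finS[of S] by (metis One_nat_def Suc_leI card_gt_0_iff empty_iff)
    ultimately show ?thesis by simp
  next
    case True
    obtain i p q where ipq: "i < n" "p \<in> C" "q \<in> C" "far p q"
      and big: "a * real (card S) \<le> real (card {s \<in> S. s i = p})" "a * real (card S) \<le> real (card {s \<in> S. s i = q})"
      using less.prems(3)[OF subset_refl True] by auto
    let ?P = "{s \<in> S. s i = p}" and ?Q = "{s \<in> S. s i = q}"
    have pos: "0 < a * real (card S)" using a True by simp
    then have ne: "?P \<noteq> {}" "?Q \<noteq> {}" using big by (force simp: card_gt_0_iff)+
    have "p \<noteq> q" using irrefl ipq by auto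
    moreover obtain s t where "s \<in> ?P" "t \<in> ?Q" using ne by blast
    ultimately have "t \<in> S - ?P" "s \<in> S - ?Q" by auto
    then have "?P \<subset> S" "?Q \<subset> S" by blast+
    then have lt: "card ?P < card S" "card ?Q < card S" using less.prems(1) by (simp_all add: psubset_card_mono)
    have half: "real (card S) powr \<gamma> / 2 \<le> real (card T) powr \<gamma>" if "a * real (card S) \<le> real (card T)" for T
    proof -
      have "real (card S) powr \<gamma> / 2 \<le> a powr \<gamma> * real (card S) powr \<gamma>"
        using mult_right_mono[OF a(2), of "real (card S) powr \<gamma>"] by simp
      also have "\<dots> = (a * real (card S)) powr \<gamma>" using a by (simp add: powr_mult)
      also have "\<dots> \<le> real (card T) powr \<gamma>" using that pos \<gamma> by (intro powr_mono2) auto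
      finally show ?thesis .
    qed
    have "real (card ?P) powr \<gamma> \<le> real (card (shattered_sets far n C ?P))"
      using less.prems ne by (intro less.hyps lt) auto
    moreover have "real (card ?Q) powr \<gamma> \<le> real (card (shattered_sets far n C ?Q))"
      using less.prems ne by (intro less.hyps lt) auto
    moreover have "real (card (shattered_sets far n C ?P)) + real (card (shattered_sets far n C ?Q))
        \<le> real (card (shattered_sets far n C S))"
      using shattered_sets_split[OF fin ipq irrefl, of S] by linarith
    ultimately show ?thesis using half[OF big(1)] half[OF big(2)] by linarith
  qed
qed

definition disagreements :: "('c \<Rightarrow> 'c \<Rightarrow> bool) \<Rightarrow> nat \<Rightarrow> (nat \<Rightarrow> 'c) \<Rightarrow> (nat \<Rightarrow> 'c) \<Rightarrow> nat set" where
  "disagreements far n s t = {i. i < n \<and> far (s i) (t i)}"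

text \<open>Averaging over pairs of words yields a position at which a proportion of at least \<open>\<theta> / 2\<close> of all pairs
  have far letters, and hence two far letters \<open>p\<close>, \<open>q\<close> carried by so many pairs that both are frequent.\<close>

lemma separated_split:
  fixes \<theta> :: real
  assumes fin: "finite C" and \<theta>: "0 < \<theta>" and S: "finite S" "2 \<le> card S"
    and words: "\<And>s i. s \<in> S \<Longrightarrow> i < n \<Longrightarrow> s i \<in> C"
    and sep: "\<And>s t. s \<in> S \<Longrightarrow> t \<in> S \<Longrightarrow> s \<noteq> t \<Longrightarrow> \<theta> * real n \<le> real (card (disagreements far n s t))"
    and n: "0 < n"
  shows "\<exists>i<n. \<exists>p\<in>C. \<exists>q\<in>C. far p q \<and>
    \<theta> / (2 * (real (card C))\<^sup>2) * real (card S) \<le> real (card {s \<in> S. s i = p}) \<and>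
    \<theta> / (2 * (real (card C))\<^sup>2) * real (card S) \<le> real (card {s \<in> S. s i = q})"
proof (rule ccontr)
  assume contr: "\<not> ?thesis"
  define N where "N = real (card S)"
  define k where "k = real (card C)"
  define f where "f = (\<lambda>i p. real (card {s \<in> S. s i = p}))"
  define a where "a = \<theta> / (2 * k\<^sup>2)"
  have N: "2 \<le> N" using S by (simp add: N_def)
  have "S \<noteq> {}" using S by auto
  then have "C \<noteq> {}" using words n by blast
  then have k: "0 < k" using fin by (simp add: k_def card_gt_0_iff)
  have a: "0 < a" using \<theta> k by (simp add: a_def)
  have fN: "f i p \<le> N" for i p
    unfolding f_def N_def by (intro of_nat_mono card_mono S) auto
  have small: "f i p * f i q < a * N * N" if "i < n" "p \<in> C" "q \<in> C" "far p q" for i p q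
  proof -
    have "f i p < a * N \<or> f i q < a * N"
      using contr that unfolding a_def k_def N_def f_def by (meson not_le)
    then show ?thesis
    proof
      assume h: "f i p < a * N"
      have "f i p * f i q \<le> f i p * N" using fN by (intro mult_left_mono) (auto simp: f_def)
      also have "\<dots> < a * N * N" using h N by (intro mult_strict_right_mono) auto
      finally show ?thesis .
    next
      assume h: "f i q < a * N"
      have "f i p * f i q \<le> N * f i q" using fN by (intro mult_right_mono) (auto simp: f_def)
      also have "\<dots> < N * (a * N)" using h N by (intro mult_strict_left_mono) auto
      finally show ?thesis by (simp add: mult_ac)
    qed
  qed
  define D where "D = {(s, t). s \<in> S \<and> t \<in> S \<and> s \<noteq> t}"
  have D: "D = S \<times> S - (\<lambda>s. (s, s)) ` S" by (auto simp: D_def)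
  have "real (card D) = N * N - N"
  proof -
    have "card ((\<lambda>s. (s, s)) ` S) = card S" by (intro card_image inj_onI) auto
    moreover have "card D = card (S \<times> S) - card ((\<lambda>s. (s, s)) ` S)"
      unfolding D by (rule card_Diff_subset) (use S in auto)
    moreover have "card S \<le> card S * card S" by (cases "card S") auto
    ultimately show ?thesis by (simp add: card_cartesian_product N_def of_nat_diff)
  qed
  have finD: "finite D" unfolding D using S by auto
  have "(N * N - N) * (\<theta> * real n) = (\<Sum>x\<in>D. \<theta> * real n)"
    using \<open>real (card D) = _\<close> by simp
  also have "\<dots> \<le> (\<Sum>x\<in>D. real (card (disagreements far n (fst x) (snd x))))"
    using sep by (intro sum_mono) (auto simp: D_def)
  also have "\<dots> \<le> (\<Sum>x\<in>S \<times> S. real (card (disagreements far n (fst x) (snd x))))"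
    using S by (intro sum_mono2) (auto simp: D_def)
  also have "\<dots> = (\<Sum>x\<in>S \<times> S. \<Sum>i<n. if far (fst x i) (snd x i) then 1 else 0)"
  proof (rule sum.cong)
    fix x assume "x \<in> S \<times> S"
    have "disagreements far n (fst x) (snd x) = {..<n} \<inter> {i. far (fst x i) (snd x i)}"
      by (auto simp: disagreements_def)
    then show "real (card (disagreements far n (fst x) (snd x)))
       = (\<Sum>i<n. if far (fst x i) (snd x i) then 1 else 0)"
      by (simp add: sum.If_cases)
  qed simp
  also have "\<dots> = (\<Sum>i<n. \<Sum>x\<in>S \<times> S. if far (fst x i) (snd x i) then 1 else 0)"
    by (rule sum.swap)
  also have "\<dots> = (\<Sum>i<n. \<Sum>(p, q)\<in>C \<times> C. if far p q then f i p * f i q else 0)"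
  proof (rule sum.cong)
    fix i assume i: "i \<in> {..<n}"
    have eq: "{x \<in> S \<times> S. (fst x i, snd x i) = (p, q)} = {s \<in> S. s i = p} \<times> {s \<in> S. s i = q}" for p q
      by auto
    have "(\<Sum>x\<in>S \<times> S. if far (fst x i) (snd x i) then 1 else 0 :: real)
        = (\<Sum>y\<in>C \<times> C. \<Sum>x\<in>{x \<in> S \<times> S. (fst x i, snd x i) = y}. if far (fst x i) (snd x i) then 1 else 0)"
      using S fin i words by (intro sum.group[symmetric]) auto
    also have "\<dots> = (\<Sum>(p, q)\<in>C \<times> C. if far p q then f i p * f i q else 0)"
    proof (rule sum.cong, simp, clarify)
      fix p q
      have "(\<Sum>x\<in>{x \<in> S \<times> S. (fst x i, snd x i) = (p, q)}. if far (fst x i) (snd x i) then 1 else 0 :: real)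
          = (\<Sum>x\<in>{x \<in> S \<times> S. (fst x i, snd x i) = (p, q)}. if far p q then 1 else 0)"
        by (rule sum.cong) auto
      also have "\<dots> = (if far p q then f i p * f i q else 0)"
        by (simp add: eq card_cartesian_product f_def del: prod.inject)
      finally show "(\<Sum>x\<in>{x \<in> S \<times> S. (fst x i, snd x i) = (p, q)}. if far (fst x i) (snd x i) then 1 else 0 :: real)
          = (if far p q then f i p * f i q else 0)" .
    qed
    finally show "(\<Sum>x\<in>S \<times> S. if far (fst x i) (snd x i) then 1 else 0 :: real)
      = (\<Sum>(p, q)\<in>C \<times> C. if far p q then f i p * f i q else 0)" .
  qed simp
  also have "\<dots> < (\<Sum>i<n. real (card (C \<times> C)) * (a * N * N))"
  proof (rule sum_strict_mono)
    fix i assume i: "i \<in> {..<n}"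
    have pos: "0 < a * N * N" using a N by simp
    have "(\<Sum>(p, q)\<in>C \<times> C. if far p q then f i p * f i q else 0) < (\<Sum>x\<in>C \<times> C. a * N * N)"
    proof (rule sum_strict_mono)
      fix y assume "y \<in> C \<times> C"
      then show "(case y of (p, q) \<Rightarrow> if far p q then f i p * f i q else 0) < a * N * N"
        using small[of i] i pos by (cases y) simp
    qed (use fin \<open>C \<noteq> {}\<close> in auto)
    then show "(\<Sum>(p, q)\<in>C \<times> C. if far p q then f i p * f i q else 0) < real (card (C \<times> C)) * (a * N * N)"
      by simp
  qed (use n in auto)
  also have "\<dots> = real n * (\<theta> / 2 * N * N)"
    using k by (simp add: card_cartesian_product a_def k_def power2_eq_square)
  finally have "\<theta> * real n * (N * N - N) < \<theta> * real n * (N * N / 2)" by (simp add: mult_ac)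
  then have "N * N - N < N * N / 2" using \<theta> n by simp
  moreover have "2 * N \<le> N * N" using N by simp
  ultimately show False by linarith
qed

definition separated_words :: "('c \<Rightarrow> 'c \<Rightarrow> bool) \<Rightarrow> real \<Rightarrow> nat \<Rightarrow> 'c set \<Rightarrow> (nat \<Rightarrow> 'c) set \<Rightarrow> bool" where
  "separated_words far \<theta> n C S \<longleftrightarrow> finite S \<and> (\<forall>s\<in>S. \<forall>i<n. s i \<in> C) \<and>
     (\<forall>s\<in>S. \<forall>t\<in>S. s \<noteq> t \<longrightarrow> \<theta> * real n \<le> real (card (disagreements far n s t)))"

text \<open>There are at least \<open>exp (b \<gamma> n)\<close> shattered sets, but at most \<open>exp (b \<gamma> n / 2)\<close> sets of triples with at most
  \<open>c n\<close> elements.  Separation in a proportion of the positions, and not only in one, is what makes the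
  size of the shattered set linear in \<open>n\<close>.\<close>

lemma separated_words_shatter:
  fixes b \<theta> :: real and C :: "'c set"
  assumes fin: "finite C" and irrefl: "\<And>p. \<not> far p p" and b: "0 < b" and \<theta>: "0 < \<theta>"
  shows "\<exists>c>0. \<forall>n S. 0 < n \<longrightarrow> separated_words far \<theta> n C S \<longrightarrow> exp (b * real n) \<le> real (card S) \<longrightarrow>
      (\<exists>E. E \<subseteq> {..<n} \<times> C \<times> C \<and> shattered far S E \<and> c * real n \<le> real (card E))"
proof -
  define a where "a = min (1/2) (\<theta> / (2 * (real (card C))\<^sup>2))"
  \<comment> \<open>So that \<open>a powr \<gamma> = 1 / 2\<close>.\<close>
  define \<gamma> where "\<gamma> = ln 2 / - ln a"
  show ?thesis
  proof (cases "C = {}")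
    case True
    show ?thesis
    proof (intro exI[of _ 1] conjI allI impI)
      fix n and S :: "(nat \<Rightarrow> 'c) set"
      assume h: "0 < n" "separated_words far \<theta> n C S" "exp (b * real n) \<le> real (card S)"
      then have "S = {}" using True by (auto simp: separated_words_def)
      moreover have "0 < exp (b * real n)" by simp
      ultimately have False using h(3) by simp
      then show "\<exists>E. E \<subseteq> {..<n} \<times> C \<times> C \<and> shattered far S E \<and> 1 * real n \<le> real (card E)" ..
    qed simp
  next
    case False
    then have k: "0 < real (card C)" using fin by (simp add: card_gt_0_iff)
    then have a: "0 < a" "a < 1" using \<theta> by (auto simp: a_def)
    have \<gamma>: "0 < \<gamma>" using a by (simp add: \<gamma>_def divide_pos_neg)
    have half: "a powr \<gamma> = 1 / 2"
    proof -
      have "\<gamma> * ln a = - ln 2" using a by (simp add: \<gamma>_def)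
      then show ?thesis using a by (simp add: powr_def exp_minus field_simps)
    qed
    have pos: "0 < b * \<gamma> / 2" using b \<gamma> by simp
    obtain c where c: "0 < c" "\<And>n (U :: (nat \<times> 'c \<times> 'c) set). finite U \<Longrightarrow> card U \<le> (card C)\<^sup>2 * n \<Longrightarrow>
           real (card {E. E \<subseteq> U \<and> real (card E) \<le> c * real n}) \<le> exp (b * \<gamma> / 2 * real n)"
      by (rule card_small_subsets[OF pos, where k = "(card C)\<^sup>2"]) blast
    show ?thesis
    proof (intro exI[of _ c] conjI allI impI)
      fix n and S :: "(nat \<Rightarrow> 'c) set"
      assume n: "0 < n" and sepS: "separated_words far \<theta> n C S" and big: "exp (b * real n) \<le> real (card S)"
      have S: "finite S" "\<And>s i. s \<in> S \<Longrightarrow> i < n \<Longrightarrow> s i \<in> C"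
        and sep: "\<And>s t. s \<in> S \<Longrightarrow> t \<in> S \<Longrightarrow> s \<noteq> t \<Longrightarrow> \<theta> * real n \<le> real (card (disagreements far n s t))"
        using sepS by (auto simp: separated_words_def)
      have "0 < exp (b * real n)" by simp
      then have ne: "S \<noteq> {}" using big by (metis card.empty of_nat_0 not_le)
      have lower: "real (card S) powr \<gamma> \<le> real (card (shattered_sets far n C S))"
      proof (rule many_shattered_sets[OF fin irrefl a(1) _ \<gamma> _ S(1) ne])
        fix S' assume S': "S' \<subseteq> S" "2 \<le> card S'"
        have "a * real (card S') \<le> \<theta> / (2 * (real (card C))\<^sup>2) * real (card S')"
          by (rule mult_right_mono) (auto simp: a_def)
        then show "\<exists>i<n. \<exists>p\<in>C. \<exists>q\<in>C. far p q \<and> a * real (card S') \<le> real (card {s \<in> S'. s i = p})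
            \<and> a * real (card S') \<le> real (card {s \<in> S'. s i = q})"
          using separated_split[OF fin \<theta> finite_subset[OF S'(1) S(1)] S'(2), of n far] S S' sep n
          by (smt (verit, del_insts) subsetD)
      qed (simp add: half)
      have "exp (b * \<gamma> / 2 * real n) < exp (b * \<gamma> * real n)" using n b \<gamma> by simp
      also have "\<dots> = exp (b * real n) powr \<gamma>" by (simp add: powr_def mult_ac)
      also have "\<dots> \<le> real (card S) powr \<gamma>" using big \<gamma> by (intro powr_mono2) auto
      finally have gt: "exp (b * \<gamma> / 2 * real n) < real (card (shattered_sets far n C S))" using lower by linarith
      show "\<exists>E. E \<subseteq> {..<n} \<times> C \<times> C \<and> shattered far S E \<and> c * real n \<le> real (card E)"
      proof (rule ccontr)
        assume no: "\<not> ?thesis"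
        let ?U = "{..<n} \<times> C \<times> C"
        have "shattered_sets far n C S \<subseteq> {E. E \<subseteq> ?U \<and> real (card E) \<le> c * real n}"
          using no by (force simp: shattered_sets_def)
        then have "card (shattered_sets far n C S) \<le> card {E. E \<subseteq> ?U \<and> real (card E) \<le> c * real n}"
          by (rule card_mono[rotated]) (rule finite_subset[of _ "Pow ?U"], auto simp: fin)
        moreover have "real (card {E. E \<subseteq> ?U \<and> real (card E) \<le> c * real n}) \<le> exp (b * \<gamma> / 2 * real n)"
          by (rule c(2)) (auto simp: fin card_cartesian_product power2_eq_square)
        ultimately show False using gt by linarith
      qed
    qed (rule c(1))
  qed
qed

section \<open>Covering numbers of iterated joins\<close>

definition cylinder :: "'k topology \<Rightarrow> ('k \<Rightarrow> 'k) \<Rightarrow> nat \<Rightarrow> (nat \<Rightarrow> 'k set) \<Rightarrow> 'k set" where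
  "cylinder K T n s = {z \<in> topspace K. \<forall>i<n. (T ^^ i) z \<in> s i}"

lemma cylinder_Suc: "cylinder K T (Suc n) s = cylinder K T n s \<inter> ((T ^^ n) -` s n \<inter> topspace K)"
  unfolding cylinder_def by (auto simp: less_Suc_eq)

lemma cylinder_cong: "(\<And>i. i < n \<Longrightarrow> s i = t i) \<Longrightarrow> cylinder K T n s = cylinder K T n t"
  unfolding cylinder_def by auto

lemma iterated_join_eq:
  "iterated_join K T \<W> n = cylinder K T n ` {s. \<forall>i<n. s i \<in> \<W>}"
proof (induction n)
  case (Suc n)
  show ?case
  proof (intro equalityI subsetI)
    fix A assume "A \<in> iterated_join K T \<W> (Suc n)"
    then obtain s U where s: "\<forall>i<n. s i \<in> \<W>" "U \<in> \<W>"
      and A: "A = cylinder K T n s \<inter> ((T ^^ n) -` U \<inter> topspace K)"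
      unfolding iterated_join.simps Suc cover_join_def cover_preimage_def by blast
    have "A = cylinder K T (Suc n) (s(n := U))"
      unfolding A cylinder_Suc using cylinder_cong[of n s "s(n := U)" K T] by simp
    moreover have "s(n := U) \<in> {s. \<forall>i<Suc n. s i \<in> \<W>}" using s by (simp add: less_Suc_eq)
    ultimately show "A \<in> cylinder K T (Suc n) ` {s. \<forall>i<Suc n. s i \<in> \<W>}" by (rule image_eqI)
  next
    fix A assume "A \<in> cylinder K T (Suc n) ` {s. \<forall>i<Suc n. s i \<in> \<W>}"
    then obtain s where s: "\<forall>i<Suc n. s i \<in> \<W>" and A: "A = cylinder K T (Suc n) s"
      by blast
    have "cylinder K T n s \<in> iterated_join K T \<W> n" unfolding Suc using s by simp
    moreover have "(T ^^ n) -` s n \<inter> topspace K \<in> cover_preimage K (T ^^ n) \<W>"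
      unfolding cover_preimage_def using s by simp
    ultimately show "A \<in> iterated_join K T \<W> (Suc n)"
      unfolding iterated_join.simps cover_join_def A cylinder_Suc by blast
  qed
qed (simp add: cylinder_def)

abbreviation cover_number :: "'k topology \<Rightarrow> ('k \<Rightarrow> 'k) \<Rightarrow> 'k set set \<Rightarrow> nat \<Rightarrow> nat" where
  "cover_number K T \<W> n \<equiv> min_subcover K (iterated_join K T \<W> n)"

lemma cover_number_le:
  assumes "finite A" and "\<And>a i. a \<in> A \<Longrightarrow> i < n \<Longrightarrow> s a i \<in> \<W>"
    and "\<And>z. z \<in> topspace K \<Longrightarrow> \<exists>a\<in>A. \<forall>i<n. (T ^^ i) z \<in> s a i"
  shows "cover_number K T \<W> n \<le> card A"
proof -
  let ?V = "(\<lambda>a. cylinder K T n (s a)) ` A"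
  have "cover_number K T \<W> n \<le> card ?V"
    unfolding min_subcover_def
  proof (rule cInf_lower)
    have "?V \<subseteq> iterated_join K T \<W> n"
      unfolding iterated_join_eq using assms(2) by (intro image_subsetI imageI) simp
    moreover have "\<Union>?V = topspace K"
    proof (intro equalityI subsetI)
      fix z assume z: "z \<in> topspace K"
      obtain a where "a \<in> A" "\<forall>i<n. (T ^^ i) z \<in> s a i" using assms(3)[OF z] by (elim bexE)
      then show "z \<in> \<Union>?V" using z by (intro UN_I[of a]) (simp_all add: cylinder_def)
    qed (auto simp: cylinder_def)
    ultimately show "card ?V \<in> {card \<V> |\<V>. \<V> \<subseteq> iterated_join K T \<W> n \<and> finite \<V> \<and> \<Union>\<V> = topspace K}"
      using assms(1) by (intro CollectI exI[of _ ?V]) simp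
  qed simp
  also have "\<dots> \<le> card A" by (rule card_image_le[OF assms(1)])
  finally show ?thesis .
qed

lemma funpow_in_invariant: "T ` X \<subseteq> X \<Longrightarrow> z \<in> X \<Longrightarrow> (T ^^ i) z \<in> X"
  by (induction i) auto

text \<open>A minimal subcover is turned into a set of names \<open>s\<close>, one open set \<open>s i\<close> for each time \<open>i < n\<close>, which
  the later counting arguments handle more easily than the intersections themselves.\<close>

lemma cover_number_witness:
  assumes \<W>: "finite_open_cover K \<W>" and T: "T ` topspace K \<subseteq> topspace K"
  obtains A where "finite A" "card A \<le> cover_number K T \<W> n" "\<And>s i. s \<in> A \<Longrightarrow> i < n \<Longrightarrow> s i \<in> \<W>"
    and "\<And>z. z \<in> topspace K \<Longrightarrow> \<exists>s\<in>A. \<forall>i<n. (T ^^ i) z \<in> s i"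
proof -
  let ?cyl = "cylinder K T n"
  let ?S = "{card \<V> |\<V>. \<V> \<subseteq> iterated_join K T \<W> n \<and> finite \<V> \<and> \<Union>\<V> = topspace K}"
  have "?S \<noteq> {}"
  proof -
    let ?V = "?cyl ` PiE {..<n} (\<lambda>_. \<W>)"
    have "finite ?V" using \<W> by (intro finite_imageI finite_PiE) (auto simp: finite_open_cover_def)
    moreover have "?V \<subseteq> iterated_join K T \<W> n"
      unfolding iterated_join_eq by (rule image_mono) (auto simp: PiE_iff)
    moreover have "\<Union>?V = topspace K"
    proof (intro equalityI subsetI)
      fix z assume z: "z \<in> topspace K"
      have "\<exists>U\<in>\<W>. (T ^^ i) z \<in> U" for i
        using funpow_in_invariant[OF T z, of i] \<W> unfolding finite_open_cover_def by blast
      then obtain s where s: "\<And>i. s i \<in> \<W> \<and> (T ^^ i) z \<in> s i" by metis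
      then have "z \<in> ?cyl (restrict s {..<n})" using z by (simp add: cylinder_def)
      moreover have "restrict s {..<n} \<in> PiE {..<n} (\<lambda>_. \<W>)" using s by simp
      ultimately show "z \<in> \<Union>?V" by blast
    qed (auto simp: cylinder_def)
    ultimately show ?thesis by blast
  qed
  then have "cover_number K T \<W> n \<in> ?S"
    unfolding min_subcover_def by (rule Inf_nat_def1)
  then obtain \<V> where V: "\<V> \<subseteq> iterated_join K T \<W> n" "finite \<V>" "\<Union>\<V> = topspace K"
      "card \<V> = cover_number K T \<W> n" by auto
  have "\<exists>s. A = ?cyl s \<and> (\<forall>i<n. s i \<in> \<W>)" if "A \<in> \<V>" for A
    using subsetD[OF V(1) that] unfolding iterated_join_eq by blast
  then obtain s where s: "\<And>A. A \<in> \<V> \<Longrightarrow> A = ?cyl (s A)" "\<And>A. A \<in> \<V> \<Longrightarrow> \<forall>i<n. s A i \<in> \<W>" by metis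
  show ?thesis
  proof (rule that)
    show "finite (s ` \<V>)" using V by simp
    show "card (s ` \<V>) \<le> cover_number K T \<W> n" using V card_image_le by metis
    show "t i \<in> \<W>" if "t \<in> s ` \<V>" "i < n" for t i using s(2) that by auto
    fix z assume "z \<in> topspace K"
    then obtain A where A: "A \<in> \<V>" "z \<in> A" using V by blast
    then have "\<forall>i<n. (T ^^ i) z \<in> s A i" using s(1)[OF A(1)] by (simp add: cylinder_def set_eq_iff)
    then show "\<exists>t\<in>s ` \<V>. \<forall>i<n. (T ^^ i) z \<in> t i" using A by blast
  qed
qed

lemma cover_number_submult:
  assumes \<W>: "finite_open_cover K \<W>" and T: "T ` topspace K \<subseteq> topspace K"
  shows "cover_number K T \<W> (m + n) \<le> cover_number K T \<W> m * cover_number K T \<W> n"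
proof -
  obtain A where A: "finite A" "card A \<le> cover_number K T \<W> m" "\<And>s i. s \<in> A \<Longrightarrow> i < m \<Longrightarrow> s i \<in> \<W>"
     "\<And>z. z \<in> topspace K \<Longrightarrow> \<exists>s\<in>A. \<forall>i<m. (T ^^ i) z \<in> s i"
    using cover_number_witness[OF assms] by metis
  obtain B where B: "finite B" "card B \<le> cover_number K T \<W> n" "\<And>s i. s \<in> B \<Longrightarrow> i < n \<Longrightarrow> s i \<in> \<W>"
     "\<And>z. z \<in> topspace K \<Longrightarrow> \<exists>s\<in>B. \<forall>i<n. (T ^^ i) z \<in> s i"
    using cover_number_witness[OF assms] by metis
  have "cover_number K T \<W> (m + n) \<le> card (A \<times> B)"
  proof (rule cover_number_le[where s = "\<lambda>(s, t) i. if i < m then s i else t (i - m)"])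
    fix z assume z: "z \<in> topspace K"
    obtain s where s: "s \<in> A" "\<forall>i<m. (T ^^ i) z \<in> s i" using A(4)[OF z] by blast
    obtain t where t: "t \<in> B" "\<forall>i<n. (T ^^ i) ((T ^^ m) z) \<in> t i"
      using B(4)[OF funpow_in_invariant[OF T z]] by blast
    have "(T ^^ i) z \<in> (if i < m then s i else t (i - m))" if "i < m + n" for i
    proof (cases "i < m")
      case False
      then have "(T ^^ i) z = (T ^^ (i - m)) ((T ^^ m) z)"
        using funpow_add[of "i - m" m T] by (simp add: fun_eq_iff)
      moreover have "i - m < n" using False that by auto
      ultimately show ?thesis using t False by simp
    qed (use s in simp)
    then show "\<exists>a\<in>A \<times> B. \<forall>i<m + n. (T ^^ i) z \<in> (case a of (s, t) \<Rightarrow> \<lambda>i. if i < m then s i else t (i - m)) i"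
      using s t by (intro bexI[of _ "(s, t)"]) auto
  qed (use A B in auto)
  also have "\<dots> \<le> cover_number K T \<W> m * cover_number K T \<W> n"
    using A(2) B(2) by (simp add: card_cartesian_product mult_mono)
  finally show ?thesis .
qed

text \<open>The definition of \<open>cover_entropy\<close> uses \<open>lim\<close>, which carries information only once convergence is known;
  convergence comes from submultiplicativity of the covering numbers.\<close>

lemma cover_entropy_limit:
  assumes \<W>: "finite_open_cover K \<W>" and T: "T ` topspace K \<subseteq> topspace K"
  shows "(\<lambda>n. 1 / real n * ln (real (cover_number K T \<W> n))) \<longlonglongrightarrow> cover_entropy K T \<W>"
proof -
  define u where "u = (\<lambda>n. ln (real (cover_number K T \<W> n)))"
  have nn: "0 \<le> ln (real k)" for k :: nat by (cases k) auto
  have "u (m + n) \<le> u m + u n" for m n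
  proof (cases "cover_number K T \<W> (m + n) = 0")
    case True
    then show ?thesis using nn by (auto simp: u_def intro!: add_nonneg_nonneg)
  next
    case False
    then have "0 < cover_number K T \<W> m * cover_number K T \<W> n"
      using cover_number_submult[OF assms, of m n] by linarith
    then have pos: "0 < cover_number K T \<W> m" "0 < cover_number K T \<W> n" by auto
    have "real (cover_number K T \<W> (m + n)) \<le> real (cover_number K T \<W> m) * real (cover_number K T \<W> n)"
      using of_nat_mono[OF cover_number_submult[OF assms, of m n], where 'a = real] by simp
    then have "u (m + n) \<le> ln (real (cover_number K T \<W> m) * real (cover_number K T \<W> n))"
      unfolding u_def using False pos by (subst ln_le_cancel_iff) simp_all
    also have "\<dots> = u m + u n" using pos by (simp add: u_def ln_mult)
    finally show ?thesis .
  qed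
  then have "(\<lambda>n. u n / real n) \<longlonglongrightarrow> (INF n\<in>{1..}. u n / real n)"
    by (rule fekete_limit) (simp add: u_def nn)
  then have "convergent (\<lambda>n. 1 / real n * ln (real (cover_number K T \<W> n)))"
    unfolding u_def convergent_def by auto
  then show ?thesis unfolding cover_entropy_def by (rule convergent_LIMSEQ_iff[THEN iffD1])
qed

lemma htop_posD:
  assumes "0 < htop K T" and T: "T ` topspace K \<subseteq> topspace K"
  obtains \<W> b where "finite_open_cover K \<W>" "0 < b"
    "eventually (\<lambda>n. exp (b * real n) \<le> real (cover_number K T \<W> n)) sequentially"
proof -
  obtain \<W> where \<W>: "finite_open_cover K \<W>" "0 < cover_entropy K T \<W>"
    using assms(1) unfolding htop_def less_SUP_iff by auto
  define b where "b = cover_entropy K T \<W> / 2"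
  have b: "0 < b" "b < cover_entropy K T \<W>" using \<W>(2) by (auto simp: b_def)
  have "eventually (\<lambda>n. b < 1 / real n * ln (real (cover_number K T \<W> n))) sequentially"
    by (rule order_tendstoD(1)[OF cover_entropy_limit[OF \<W>(1) T] b(2)])
  then have "eventually (\<lambda>n. exp (b * real n) \<le> real (cover_number K T \<W> n)) sequentially"
    using eventually_gt_at_top[of 0]
  proof eventually_elim
    case (elim n)
    then have ln: "b * real n < ln (real (cover_number K T \<W> n))" by (simp add: field_simps)
    have "cover_number K T \<W> n \<noteq> 0"
    proof
      assume "cover_number K T \<W> n = 0"
      then have "b * real n < 0" using ln by simp
      moreover have "0 \<le> b * real n" using b(1) by (intro mult_nonneg_nonneg) auto
      ultimately show False by linarith
    qed
    then have "ln (exp (b * real n)) < ln (real (cover_number K T \<W> n)) \<longleftrightarrow>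
      exp (b * real n) < real (cover_number K T \<W> n)" by (intro ln_less_cancel_iff) auto
    then show ?case using ln by simp
  qed
  then show ?thesis using that \<W> b by blast
qed

lemma htop_ge:
  assumes \<W>: "finite_open_cover K \<W>" and T: "T ` topspace K \<subseteq> topspace K"
    and freq: "frequently (\<lambda>n. exp (b * real n) \<le> C * real (cover_number K T \<W> n)) sequentially" and C: "0 < C"
  shows "ereal b \<le> htop K T"
proof -
  have "b \<le> cover_entropy K T \<W>"
  proof (rule ccontr)
    assume "\<not> ?thesis"
    define e where "e = (b - cover_entropy K T \<W>) / 2"
    have e: "0 < e" "cover_entropy K T \<W> < b - e" using \<open>\<not> _\<close> by (auto simp: e_def field_simps)
    have 1: "eventually (\<lambda>n. 1 / real n * ln (real (cover_number K T \<W> n)) < b - e) sequentially"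
      by (rule order_tendstoD(2)[OF cover_entropy_limit[OF \<W> T] e(2)])
    obtain M :: nat where M: "real M > \<bar>ln C\<bar> / e" using reals_Archimedean2 by blast
    have "frequently (\<lambda>n. False) sequentially"
      using frequently_eventually_conj[OF freq eventually_conj[OF 1 eventually_ge_at_top[of "max 1 M"]]]
    proof (rule frequently_elim1)
      fix n assume h: "(1 / real n * ln (real (cover_number K T \<W> n)) < b - e \<and> max 1 M \<le> n) \<and>
        exp (b * real n) \<le> C * real (cover_number K T \<W> n)"
      have "0 < exp (b * real n)" by simp
      then have "0 < C * real (cover_number K T \<W> n)" using h by linarith
      then have pos: "0 < real (cover_number K T \<W> n)" using C by (simp add: zero_less_mult_iff)
      have "b * real n = ln (exp (b * real n))" by simp
      also have "\<dots> \<le> ln (C * real (cover_number K T \<W> n))" using h C pos by (subst ln_le_cancel_iff) auto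
      also have "\<dots> = ln C + ln (real (cover_number K T \<W> n))" using C pos by (simp add: ln_mult)
      also have "ln (real (cover_number K T \<W> n)) < (b - e) * real n"
      proof -
        have "0 < real n" "ln (real (cover_number K T \<W> n)) / real n < b - e" using h by auto
        then show ?thesis by (simp add: pos_divide_less_eq)
      qed
      finally have "e * real n < ln C" by (simp add: algebra_simps)
      moreover have "\<bar>ln C\<bar> / e < real n" using M h by linarith
      then have "\<bar>ln C\<bar> < e * real n" using e by (simp add: field_simps)
      ultimately show False by linarith
    qed
    then show False by simp
  qed
  also have "ereal (cover_entropy K T \<W>) \<le> htop K T"
    unfolding htop_def by (rule SUP_upper) (use \<W> in simp)
  finally show ?thesis by simp
qed

section \<open>Weak* neighbourhoods in the dual ball\<close>

lemma clinear_on_zero: "clinear_on UNIV f \<Longrightarrow> f 0 = 0"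
  unfolding clinear_on_def by (metis UNIV_I cvs.scale_zero_left)

lemma clinear_on_subspace_sum:
  assumes V: "csubspace V" and lin: "clinear_on V \<psi>" and I: "finite I" and v: "\<And>i. i \<in> I \<Longrightarrow> v i \<in> V"
  shows "(\<Sum>i\<in>I. a i *\<^sub>C v i) \<in> V" "\<psi> (\<Sum>i\<in>I. a i *\<^sub>C v i) = (\<Sum>i\<in>I. a i *\<^sub>C \<psi> (v i))"
proof -
  have "(\<Sum>i\<in>I. a i *\<^sub>C v i) \<in> V \<and> \<psi> (\<Sum>i\<in>I. a i *\<^sub>C v i) = (\<Sum>i\<in>I. a i *\<^sub>C \<psi> (v i))"
    using I v
  proof (induction I)
    case empty
    have V0: "0 \<in> V" by (rule cvs.subspace_0[OF V])
    have "\<psi> (0 *\<^sub>C 0) = 0 *\<^sub>C \<psi> 0" using lin V0 unfolding clinear_on_def by blast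
    then have "\<psi> 0 = 0" by (simp only: cvs.scale_zero_left)
    then show ?case using V0 by (simp only: sum.empty simp_thms)
  next
    case (insert i I)
    let ?s = "\<Sum>i\<in>I. a i *\<^sub>C v i"
    have vi: "v i \<in> V" "a i *\<^sub>C v i \<in> V" and s: "?s \<in> V" "\<psi> ?s = (\<Sum>i\<in>I. a i *\<^sub>C \<psi> (v i))"
      using insert cvs.subspace_scale[OF V] by auto
    have "\<psi> (a i *\<^sub>C v i + ?s) = \<psi> (a i *\<^sub>C v i) + \<psi> ?s"
      using lin s(1) vi(2) unfolding clinear_on_def by blast
    also have "\<psi> (a i *\<^sub>C v i) = a i *\<^sub>C \<psi> (v i)" using lin vi(1) unfolding clinear_on_def by blast
    finally show ?case
      using cvs.subspace_add[OF V vi(2) s(1)] insert(1,2) s(2)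
      by (simp only: sum.insert simp_thms)
  qed
  then show "(\<Sum>i\<in>I. a i *\<^sub>C v i) \<in> V" "\<psi> (\<Sum>i\<in>I. a i *\<^sub>C v i) = (\<Sum>i\<in>I. a i *\<^sub>C \<psi> (v i))" by auto
qed

lemma clinear_on_sum:
  assumes "clinear_on UNIV f"
  shows "f (\<Sum>i\<in>I. a i *\<^sub>C v i) = (\<Sum>i\<in>I. a i *\<^sub>C f (v i))"
  by (cases "finite I")
    (simp_all add: clinear_on_subspace_sum(2)[OF cvs.subspace_UNIV assms] clinear_on_zero[OF assms])

lemma clinear_on_diff: "clinear_on UNIV f \<Longrightarrow> f (x - y) = f x - f y"
  unfolding clinear_on_def by (metis UNIV_I add_diff_cancel diff_add_cancel)

lemma dual_ball_clinear: "\<omega> \<in> dual_ball \<Longrightarrow> clinear_on UNIV \<omega>"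
  by (simp add: dual_ball_def)

lemma dual_ball_norm: "\<omega> \<in> dual_ball \<Longrightarrow> cmod (\<omega> x) \<le> norm x"
  by (simp add: dual_ball_def)

lemma dual_ball_sum: "\<omega> \<in> dual_ball \<Longrightarrow> \<omega> (\<Sum>i\<in>I. a i *\<^sub>C v i) = (\<Sum>i\<in>I. a i * \<omega> (v i))"
  using clinear_on_sum[OF dual_ball_clinear] by (simp add: scaleC_complex_def)

lemma dual_ball_diff: "\<omega> \<in> dual_ball \<Longrightarrow> \<omega> (x - y) = \<omega> x - \<omega> y"
  by (rule clinear_on_diff[OF dual_ball_clinear])

lemma zero_in_dual_ball: "(\<lambda>x. 0) \<in> dual_ball"
  by (simp add: dual_ball_def clinear_on_def scaleC_complex_def)

lemma continuous_on_coordinate [continuous_intros]: "continuous_on S (\<lambda>\<omega>. \<omega> x)"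
  by (rule continuous_on_subset[OF continuous_on_product_coordinates subset_UNIV])

text \<open>The Banach-Alaoglu theorem: the ball is cut out of a product of compact discs by closed conditions.\<close>

lemma compact_dual_ball: "compact (dual_ball :: ('a::complex_banach \<Rightarrow> complex) set)"
proof -
  let ?P = "PiE UNIV (\<lambda>x::'a. cball (0::complex) (norm x))"
  have "compactin (product_topology (\<lambda>_. euclidean) UNIV) ?P"
    by (subst compactin_PiE) auto
  then have P: "compact ?P" by (simp add: euclidean_product_topology)
  have "closed (\<Inter>x y. {\<omega> :: 'a \<Rightarrow> complex. \<omega> (x + y) = \<omega> x + \<omega> y})"
    by (intro closed_INT ballI closed_Collect_eq continuous_intros)
  moreover have "closed (\<Inter>c x. {\<omega> :: 'a \<Rightarrow> complex. \<omega> (c *\<^sub>C x) = c * \<omega> x})"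
    by (intro closed_INT ballI closed_Collect_eq continuous_intros)
  ultimately have "compact (?P \<inter> ((\<Inter>x y. {\<omega>. \<omega> (x + y) = \<omega> x + \<omega> y}) \<inter> (\<Inter>c x. {\<omega>. \<omega> (c *\<^sub>C x) = c * \<omega> x})))"
    by (intro compact_Int_closed P closed_Int)
  also have "?P \<inter> ((\<Inter>x y. {\<omega>. \<omega> (x + y) = \<omega> x + \<omega> y}) \<inter> (\<Inter>c x. {\<omega>. \<omega> (c *\<^sub>C x) = c * \<omega> x})) = dual_ball"
    unfolding dual_ball_def clinear_on_def scaleC_complex_def by (auto simp: PiE_iff)
  finally show ?thesis .
qed

definition nbhd :: "('a \<Rightarrow> complex) set \<Rightarrow> 'a set \<Rightarrow> real \<Rightarrow> ('a \<Rightarrow> complex) \<Rightarrow> ('a \<Rightarrow> complex) set" where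
  "nbhd K F \<epsilon> p = {z \<in> K. \<forall>y\<in>F. cmod (z y - p y) < \<epsilon>}"

lemma openin_nbhd:
  assumes "finite F"
  shows "openin (top_of_set K) (nbhd K F \<epsilon> p)"
proof -
  have "open (\<Inter>y\<in>F. {z :: 'a \<Rightarrow> complex. cmod (z y - p y) < \<epsilon>})"
    using assms by (intro open_INT ballI open_Collect_less continuous_intros) auto
  moreover have "nbhd K F \<epsilon> p = K \<inter> (\<Inter>y\<in>F. {z. cmod (z y - p y) < \<epsilon>})" by (auto simp: nbhd_def)
  ultimately show ?thesis by (simp only: openin_open_Int)
qed

lemma finite_nbhd_cover:
  assumes "compact K" "finite F" "0 < \<epsilon>"
  obtains P where "finite P" "P \<subseteq> K" "\<forall>z\<in>K. \<exists>p\<in>P. z \<in> nbhd K F \<epsilon> p"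
    and "finite_open_cover (top_of_set K) (nbhd K F \<epsilon> ` P)"
proof -
  let ?V = "\<lambda>p. (\<Inter>y\<in>F. {z :: 'a \<Rightarrow> complex. cmod (z y - p y) < \<epsilon>})"
  have op: "open (?V p)" for p
    using assms by (intro open_INT ballI open_Collect_less continuous_intros) auto
  have "K \<subseteq> (\<Union>p\<in>K. ?V p)" using assms(3) by auto
  from compactE_image[of K K ?V, OF assms(1) op this]
  obtain P where P: "P \<subseteq> K" "finite P" "K \<subseteq> (\<Union>p\<in>P. ?V p)" .
  have nb: "nbhd K F \<epsilon> p = K \<inter> ?V p" for p by (auto simp: nbhd_def)
  have cov: "\<exists>p\<in>P. z \<in> nbhd K F \<epsilon> p" if zK: "z \<in> K" for z
  proof -
    obtain p where "p \<in> P" "z \<in> ?V p" using subsetD[OF P(3) zK] by (elim UN_E)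
    then show ?thesis using zK unfolding nb by (intro bexI[of _ p]) simp_all
  qed
  have "finite_open_cover (top_of_set K) (nbhd K F \<epsilon> ` P)"
    unfolding finite_open_cover_def
  proof (intro conjI ballI)
    show "\<Union> (nbhd K F \<epsilon> ` P) = topspace (top_of_set K)"
      using cov by (auto simp: nbhd_def)
  qed (use P openin_nbhd[OF assms(2)] in auto)
  then show ?thesis by (intro that[OF P(2,1)]) (use cov in auto)
qed

lemma finite_positive_lower_bound:
  fixes e :: "'b \<Rightarrow> real"
  assumes "finite F" "\<And>y. y \<in> F \<Longrightarrow> 0 < e y"
  obtains \<epsilon> where "0 < \<epsilon>" "\<And>y. y \<in> F \<Longrightarrow> \<epsilon> \<le> e y"
proof
  show "0 < Min (insert 1 (e ` F))" using assms by (subst Min_gr_iff) auto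
  show "Min (insert 1 (e ` F)) \<le> e y" if "y \<in> F" for y using assms that by (intro Min_le) auto
qed

text \<open>Functionals in the ball are 1-Lipschitz, so \<open>y\<close> may be replaced by a nearby linear combination of members
  of \<open>\<Delta>\<close>.\<close>

lemma total_set_controls:
  assumes "total_set \<Delta>" "0 < \<epsilon>"
  shows "\<exists>F \<delta>. finite F \<and> F \<subseteq> \<Delta> \<and> 0 < \<delta> \<and> (\<forall>z\<in>dual_ball. \<forall>z'\<in>dual_ball.
      (\<forall>x\<in>F. cmod (z x - z' x) < \<delta>) \<longrightarrow> cmod (z y - z' y) < \<epsilon>)"
proof -
  have "y \<in> closure (cspan \<Delta>)" using assms(1) by (simp add: total_set_def)
  then obtain y' where y': "y' \<in> cspan \<Delta>" "dist y' y < \<epsilon> / 3"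
    using assms(2) by (meson closure_approachable divide_pos_pos zero_less_numeral)
  then obtain F r where F: "finite F" "F \<subseteq> \<Delta>" "y' = (\<Sum>x\<in>F. r x *\<^sub>C x)"
    unfolding cvs.span_explicit by auto
  define R where "R = (\<Sum>x\<in>F. cmod (r x))"
  have R: "0 \<le> R" by (auto simp: R_def intro!: sum_nonneg)
  define \<delta> where "\<delta> = \<epsilon> / 3 / (1 + R)"
  have \<delta>: "0 < \<delta>" using R assms(2) by (simp add: \<delta>_def)
  show ?thesis
  proof (intro exI conjI ballI impI)
    fix z z' :: "'a \<Rightarrow> complex"
    assume z: "z \<in> dual_ball" "z' \<in> dual_ball" and "\<forall>x\<in>F. cmod (z x - z' x) < \<delta>"
    then have c: "cmod (z x - z' x) < \<delta>" if "x \<in> F" for x using that by simp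
    have "z y' - z' y' = (\<Sum>x\<in>F. r x * (z x - z' x))"
      unfolding F(3) dual_ball_sum[OF z(1)] dual_ball_sum[OF z(2)]
      by (simp add: sum_subtractf[symmetric] algebra_simps)
    also have "cmod \<dots> \<le> (\<Sum>x\<in>F. cmod (r x) * \<delta>)"
    proof (rule sum_norm_le)
      fix x assume "x \<in> F"
      then show "cmod (r x * (z x - z' x)) \<le> cmod (r x) * \<delta>"
        unfolding norm_mult by (intro mult_left_mono less_imp_le[OF c]) auto
    qed
    also have "\<dots> = R * \<delta>" by (simp add: R_def sum_distrib_right)
    also have "\<dots> \<le> \<epsilon> / 3"
      using R assms(2) by (simp add: \<delta>_def field_simps add_nonneg_pos)
    finally have 1: "cmod (z y' - z' y') \<le> \<epsilon> / 3" .
    have 2: "cmod (z (y - y')) < \<epsilon> / 3" "cmod (z' (y - y')) < \<epsilon> / 3"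
      using dual_ball_norm[OF z(1), of "y - y'"] dual_ball_norm[OF z(2), of "y - y'"] y'(2)
      by (simp_all add: dist_norm norm_minus_commute)
    have "z y - z' y = (z y' - z' y') + (z (y - y') - z' (y - y'))"
      using z by (simp add: dual_ball_diff)
    then have "cmod (z y - z' y) \<le> cmod (z y' - z' y') + (cmod (z (y - y')) + cmod (z' (y - y')))"
      using norm_triangle_ineq[of "z y' - z' y'" "z (y - y') - z' (y - y')"]
        norm_triangle_ineq4[of "z (y - y')" "z' (y - y')"] by simp
    then show "cmod (z y - z' y) < \<epsilon>" using 1 2 by linarith
  qed (use F(1,2) \<delta> in auto)
qed

lemma nbhd_basis_total:
  assumes \<Delta>: "total_set \<Delta>" and K: "K \<subseteq> dual_ball" and U: "openin (top_of_set K) U" and z: "z \<in> U"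
  obtains F \<delta> where "finite F" "F \<subseteq> \<Delta>" "0 < \<delta>" "nbhd K F \<delta> z \<subseteq> U"
proof -
  obtain V where V: "open V" "U = K \<inter> V" using U by (auto simp: openin_open)
  have "openin (product_topology (\<lambda>_. euclidean) UNIV) V" using V(1) by (simp add: open_fun_def)
  then obtain X where X: "z \<in> PiE UNIV X" "\<And>i. open (X i)" "finite {i. X i \<noteq> UNIV}" "PiE UNIV X \<subseteq> V"
    using product_topology_open_contains_basis[of "\<lambda>_. euclidean" UNIV V z] z V(2) by auto
  define F0 where "F0 = {i. X i \<noteq> UNIV}"
  have "\<forall>y. \<exists>e>0. ball (z y) e \<subseteq> X y"
    using X(1,2) by (meson PiE_mem UNIV_I open_contains_ball)
  from choice[OF this] obtain e where e0: "\<forall>y. 0 < e y \<and> ball (z y) (e y) \<subseteq> X y" ..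
  have e: "0 < e y" "ball (z y) (e y) \<subseteq> X y" for y using spec[OF e0, of y] by auto
  let ?Q = "\<lambda>y F \<delta>. finite F \<and> F \<subseteq> \<Delta> \<and> 0 < \<delta> \<and> (\<forall>w\<in>dual_ball. \<forall>z'\<in>dual_ball.
      (\<forall>x\<in>F. cmod (w x - z' x) < \<delta>) \<longrightarrow> cmod (w y - z' y) < e y)"
  have "\<forall>y. \<exists>F \<delta>. ?Q y F \<delta>"
  proof
    show "\<exists>F \<delta>. ?Q y F \<delta>" for y
      by (rule total_set_controls[OF \<Delta> e(1)])
  qed
  from choice[OF this] obtain F where "\<forall>y. \<exists>\<delta>. ?Q y (F y) \<delta>" ..
  from choice[OF this] obtain d where Q: "\<forall>y. ?Q y (F y) (d y)" ..
  have F: "finite (F y)" "F y \<subseteq> \<Delta>" "0 < d y" for y using spec[OF Q, of y] by auto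
  have F4: "cmod (w y - z' y) < e y"
    if "w \<in> dual_ball" "z' \<in> dual_ball" "\<forall>x\<in>F y. cmod (w x - z' x) < d y" for y w z'
    using spec[OF Q, of y] that by simp
  have fin: "finite F0" using X(3) by (simp add: F0_def)
  obtain \<delta> where \<delta>: "0 < \<delta>" "\<And>y. y \<in> F0 \<Longrightarrow> \<delta> \<le> d y"
    by (rule finite_positive_lower_bound[OF fin, of d]) (use F(3) in auto)
  show ?thesis
  proof (rule that)
    show "finite (\<Union>y\<in>F0. F y)" using fin F(1) by simp
    show "(\<Union>y\<in>F0. F y) \<subseteq> \<Delta>" using F(2) by blast
    show "0 < \<delta>" by (rule \<delta>(1))
    show "nbhd K (\<Union>y\<in>F0. F y) \<delta> z \<subseteq> U"
    proof
      fix w assume "w \<in> nbhd K (\<Union>y\<in>F0. F y) \<delta> z"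
      then have w: "w \<in> K" "\<And>y x. y \<in> F0 \<Longrightarrow> x \<in> F y \<Longrightarrow> cmod (w x - z x) < \<delta>"
        by (auto simp: nbhd_def)
      have zK: "z \<in> K" using z V(2) by simp
      have "w y \<in> X y" for y
      proof (cases "y \<in> F0")
        case True
        have "\<forall>x\<in>F y. cmod (w x - z x) < d y" using w(2)[OF True] \<delta>(2)[OF True] by force
        then have "cmod (w y - z y) < e y" using K w(1) zK by (intro F4) auto
        then show ?thesis using e(2)[of y] by (auto simp: subset_iff dist_norm norm_minus_commute)
      qed (simp add: F0_def)
      then have "w \<in> PiE UNIV X" by (simp add: PiE_iff)
      then show "w \<in> U" using X(4) V(2) w(1) by blast
    qed
  qed
qed

text \<open>A Lebesgue number for the cover, with respect to finitely many members of the total set.  This is where \<open>x\<close> becomes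
  confined to \<open>\<Delta>\<close>.\<close>

lemma Lebesgue_number_total:
  assumes \<Delta>: "total_set \<Delta>" and K: "K \<subseteq> dual_ball" "compact K" and \<W>: "finite_open_cover (top_of_set K) \<W>"
  obtains F \<delta> where "finite F" "F \<subseteq> \<Delta>" "0 < \<delta>" "\<forall>z\<in>K. \<exists>U\<in>\<W>. nbhd K F \<delta> z \<subseteq> U"
proof -
  let ?Q = "\<lambda>z F \<delta>. finite F \<and> F \<subseteq> \<Delta> \<and> 0 < \<delta> \<and> (\<exists>U\<in>\<W>. nbhd K F (2 * \<delta>) z \<subseteq> U)"
  have "\<forall>z\<in>K. \<exists>F \<delta>. ?Q z F \<delta>"
  proof
    fix z assume z: "z \<in> K"
    obtain U where U: "U \<in> \<W>" "z \<in> U" "openin (top_of_set K) U"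
      using \<W> z unfolding finite_open_cover_def by auto
    obtain F \<delta> where "finite F" "F \<subseteq> \<Delta>" "0 < \<delta>" "nbhd K F \<delta> z \<subseteq> U"
      by (rule nbhd_basis_total[OF \<Delta> K(1) U(3,2)])
    then show "\<exists>F \<delta>. ?Q z F \<delta>" using U(1) by (intro exI[of _ F] exI[of _ "\<delta> / 2"]) auto
  qed
  from bchoice[OF this] obtain F where "\<forall>z\<in>K. \<exists>\<delta>. ?Q z (F z) \<delta>" ..
  from bchoice[OF this] obtain d where Q: "\<forall>z\<in>K. ?Q z (F z) (d z)" ..
  have F: "finite (F z)" "F z \<subseteq> \<Delta>" "0 < d z" "\<exists>U\<in>\<W>. nbhd K (F z) (2 * d z) z \<subseteq> U"
    if "z \<in> K" for z using bspec[OF Q that] by auto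
  let ?V = "\<lambda>p. (\<Inter>y\<in>F p. {z :: 'a \<Rightarrow> complex. cmod (z y - p y) < d p})"
  have op: "open (?V p)" if "p \<in> K" for p
    using F(1)[OF that] by (intro open_INT ballI open_Collect_less continuous_intros) auto
  have "K \<subseteq> (\<Union>p\<in>K. ?V p)" using F(3) by auto
  from compactE_image[of K K ?V, OF K(2) op this]
  obtain P where P: "P \<subseteq> K" "finite P" "K \<subseteq> (\<Union>p\<in>P. ?V p)" .
  obtain \<delta> where \<delta>: "0 < \<delta>" "\<And>p. p \<in> P \<Longrightarrow> \<delta> \<le> d p"
    by (rule finite_positive_lower_bound[OF P(2), of d]) (use F(3) P(1) in auto)
  show ?thesis
  proof (rule that)
    show "finite (\<Union>p\<in>P. F p)" using P F(1) by auto
    show "(\<Union>p\<in>P. F p) \<subseteq> \<Delta>" using P F(2) by blast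
    show "0 < \<delta>" by (rule \<delta>(1))
    show "\<forall>z\<in>K. \<exists>U\<in>\<W>. nbhd K (\<Union>p\<in>P. F p) \<delta> z \<subseteq> U"
    proof
      fix z assume z: "z \<in> K"
      then obtain p where p: "p \<in> P" "z \<in> ?V p" using P(3) by blast
      then have pK: "p \<in> K" using P(1) by blast
      have "nbhd K (\<Union>p\<in>P. F p) \<delta> z \<subseteq> nbhd K (F p) (2 * d p) p"
      proof
        fix w assume w: "w \<in> nbhd K (\<Union>p\<in>P. F p) \<delta> z"
        have "cmod (w y - p y) < 2 * d p" if y: "y \<in> F p" for y
        proof -
          have "cmod (w y - z y) < \<delta>" using w y p(1) by (auto simp: nbhd_def)
          moreover have "cmod (z y - p y) < d p" using p(2) y by auto
          ultimately show ?thesis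
            using norm_triangle_ineq[of "w y - z y" "z y - p y"] \<delta>(2)[OF p(1)] by simp
        qed
        then show "w \<in> nbhd K (F p) (2 * d p) p" using w by (auto simp: nbhd_def)
      qed
      then show "\<exists>U\<in>\<W>. nbhd K (\<Union>p\<in>P. F p) \<delta> z \<subseteq> U" using F(4)[OF pK] by blast
    qed
  qed
qed

locale isometric_system =
  fixes \<alpha> :: "'a::complex_banach \<Rightarrow> 'a"
  assumes iso: "isometric_automorphism \<alpha>"
begin

lemma bij: "bij \<alpha>"
proof (rule bijI)
  have lin: "clinear_on UNIV \<alpha>" and nrm: "\<And>x. norm (\<alpha> x) = norm x"
    using iso by (auto simp: isometric_automorphism_def)
  show "inj \<alpha>"
  proof (rule injI)
    fix x y assume "\<alpha> x = \<alpha> y"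
    then have "norm (\<alpha> (x - y)) = 0" using clinear_on_diff[OF lin, of x y] by simp
    then show "x = y" using nrm[of "x - y"] by simp
  qed
qed (use iso in \<open>simp add: isometric_automorphism_def\<close>)

lemma funpow_isometry: "clinear_on UNIV (\<alpha> ^^ n)" "norm ((\<alpha> ^^ n) x) = norm x"
proof -
  show "clinear_on UNIV (\<alpha> ^^ n)"
    using iso by (induction n) (auto simp: isometric_automorphism_def clinear_on_def)
  show "norm ((\<alpha> ^^ n) x) = norm x"
    using iso by (induction n) (auto simp: isometric_automorphism_def)
qed

end

text \<open>Covers both systems to which the entropy arguments are applied: the dual ball and \<open>Z\<close>.\<close>

locale dual_system = isometric_system \<alpha>
  for \<alpha> :: "'a::complex_banach \<Rightarrow> 'a" +
  fixes K :: "('a \<Rightarrow> complex) set"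
  assumes K_ball: "K \<subseteq> dual_ball"
    and K_compact: "compact K" and K_inv: "dual_map \<alpha> ` K \<subseteq> K"
begin

lemma dual_map_funpow: "(dual_map \<alpha> ^^ i) z y = z ((\<alpha> ^^ i) y)"
  by (induction i arbitrary: z) (simp_all add: dual_map_def funpow_swap1)

lemma K_inv_top: "dual_map \<alpha> ` topspace (top_of_set K) \<subseteq> topspace (top_of_set K)"
  using K_inv by simp

lemma funpow_K: "z \<in> K \<Longrightarrow> (dual_map \<alpha> ^^ i) z \<in> K"
  by (rule funpow_in_invariant[OF K_inv])

end

lemma dual_system_dual_ball:
  assumes "isometric_automorphism \<alpha>"
  shows "dual_system \<alpha> dual_ball"
proof
  show "dual_map \<alpha> ` dual_ball \<subseteq> dual_ball"
    using assms by (auto simp: dual_map_def dual_ball_def clinear_on_def isometric_automorphism_def) metis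
qed (use assms compact_dual_ball in auto)

section \<open>Positive entropy yields copies of finite-dimensional \<open>\<ell>\<^sub>1\<close> of proportional dimension\<close>

text \<open>The lower half of equivalence with the \<open>\<ell>\<^sub>1\<close> basis.  Stated on finite subsets it makes sense for infinite \<open>I\<close> and
  is visibly hereditary and of finite character.\<close>

definition ell1_lower :: "real \<Rightarrow> 'i set \<Rightarrow> ('i \<Rightarrow> 'a::complex_banach) \<Rightarrow> bool" where
  "ell1_lower \<rho> I v \<longleftrightarrow> (\<forall>F\<subseteq>I. finite F \<longrightarrow>
     (\<forall>a. \<rho> * (\<Sum>i\<in>F. cmod (a i)) \<le> norm (\<Sum>i\<in>F. a i *\<^sub>C v i)))"

lemma ell1_lowerD:
  "ell1_lower \<rho> I v \<Longrightarrow> F \<subseteq> I \<Longrightarrow> finite F \<Longrightarrow> \<rho> * (\<Sum>i\<in>F. cmod (a i)) \<le> norm (\<Sum>i\<in>F. a i *\<^sub>C v i)"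
  by (simp add: ell1_lower_def)

lemma ell1_lower_subset: "ell1_lower \<rho> I v \<Longrightarrow> J \<subseteq> I \<Longrightarrow> ell1_lower \<rho> J v"
  unfolding ell1_lower_def by (meson order_trans)

text \<open>For a set \<open>A\<close> of times take a functional \<open>z\<close> with values near \<open>P\<close> on \<open>A\<close> and near \<open>Q\<close> off \<open>A\<close>, and \<open>w\<close> with the
  opposite pattern.  Then \<open>z - w\<close> takes values near \<open>\<plusminus>(P - Q)\<close>.  Choosing \<open>A\<close> by the signs of the real parts of the
  coefficients, and then of the imaginary parts, controls the \<open>\<ell>\<^sub>1\<close> norm of the coefficients.  The two values must be far apart
  compared with \<open>\<epsilon>\<close>: for complex coefficients the error of the values enters with the full \<open>\<ell>\<^sub>1\<close> norm.\<close>

lemma two_values_imp_ell1_lower: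
  fixes v :: "'i \<Rightarrow> 'a::complex_banach"
  assumes far: "8 * \<epsilon> \<le> cmod (P - Q)"
    and pattern: "\<And>A. A \<subseteq> I \<Longrightarrow> \<exists>z\<in>dual_ball. (\<forall>i\<in>A. cmod (z (v i) - P) < \<epsilon>) \<and> (\<forall>i\<in>I - A. cmod (z (v i) - Q) < \<epsilon>)"
  shows "ell1_lower \<epsilon> I v"
  unfolding ell1_lower_def
proof (intro allI impI)
  fix F a assume F: "F \<subseteq> I" "finite F"
  define y where "y = (\<Sum>i\<in>F. a i *\<^sub>C v i)"
  define S where "S = (\<Sum>i\<in>F. cmod (a i))"
  have key: "8 * \<epsilon> * cmod (\<Sum>i\<in>F. a i * (if i \<in> A then 1 else - 1)) \<le> 2 * norm y + 2 * \<epsilon> * S" if A: "A \<subseteq> F" for A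
  proof -
    let ?s = "\<lambda>i. if i \<in> A then 1 else - 1 :: complex"
    obtain z where z: "z \<in> dual_ball" "\<And>i. i \<in> A \<Longrightarrow> cmod (z (v i) - P) < \<epsilon>"
        "\<And>i. i \<in> I - A \<Longrightarrow> cmod (z (v i) - Q) < \<epsilon>"
      using pattern[of A] A F(1) by (meson order_trans)
    obtain w where w: "w \<in> dual_ball" "\<And>i. i \<in> F - A \<Longrightarrow> cmod (w (v i) - P) < \<epsilon>"
        "\<And>i. i \<in> I - (F - A) \<Longrightarrow> cmod (w (v i) - Q) < \<epsilon>"
      using pattern[of "F - A"] F(1) by (meson Diff_subset order_trans)
    define e where "e = (\<lambda>i. z (v i) - w (v i) - ?s i * (P - Q))"
    have e: "cmod (e i) \<le> 2 * \<epsilon>" if i: "i \<in> F" for i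
    proof (cases "i \<in> A")
      case True
      then have "cmod (z (v i) - P) < \<epsilon>" "cmod (w (v i) - Q) < \<epsilon>" using z(2) w(3) i F(1) by auto
      moreover have "e i = (z (v i) - P) - (w (v i) - Q)" using True by (simp add: e_def)
      ultimately show ?thesis using norm_triangle_ineq4[of "z (v i) - P" "w (v i) - Q"] by simp
    next
      case False
      then have "cmod (z (v i) - Q) < \<epsilon>" "cmod (w (v i) - P) < \<epsilon>" using z(3) w(2) i F(1) by auto
      moreover have "e i = (z (v i) - Q) - (w (v i) - P)" using False by (simp add: e_def)
      ultimately show ?thesis using norm_triangle_ineq4[of "z (v i) - Q" "w (v i) - P"] by simp
    qed
    have "z y - w y = (\<Sum>i\<in>F. a i * (z (v i) - w (v i)))"
      unfolding y_def dual_ball_sum[OF z(1)] dual_ball_sum[OF w(1)]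
      by (simp add: sum_subtractf[symmetric] algebra_simps)
    also have "\<dots> = (\<Sum>i\<in>F. a i * ?s i) * (P - Q) + (\<Sum>i\<in>F. a i * e i)"
      unfolding sum_distrib_right sum.distrib[symmetric] e_def by (rule sum.cong) (auto simp: algebra_simps)
    finally have eq: "(\<Sum>i\<in>F. a i * ?s i) * (P - Q) = z y - w y - (\<Sum>i\<in>F. a i * e i)" by simp
    have "cmod (\<Sum>i\<in>F. a i * e i) \<le> (\<Sum>i\<in>F. cmod (a i) * (2 * \<epsilon>))"
    proof (rule sum_norm_le)
      fix i assume "i \<in> F"
      then show "cmod (a i * e i) \<le> cmod (a i) * (2 * \<epsilon>)"
        unfolding norm_mult by (intro mult_left_mono e) auto
    qed
    then have err: "cmod (\<Sum>i\<in>F. a i * e i) \<le> 2 * \<epsilon> * S"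
      by (simp add: S_def sum_distrib_right[symmetric] mult.commute)
    have "cmod (\<Sum>i\<in>F. a i * ?s i) * (8 * \<epsilon>) \<le> cmod (\<Sum>i\<in>F. a i * ?s i) * cmod (P - Q)"
      by (rule mult_left_mono[OF far]) simp
    also have "\<dots> = cmod (z y - w y - (\<Sum>i\<in>F. a i * e i))"
      unfolding norm_mult[symmetric] eq ..
    also have "\<dots> \<le> cmod (z y) + cmod (w y) + cmod (\<Sum>i\<in>F. a i * e i)"
      using norm_triangle_ineq4[of "z y - w y" "\<Sum>i\<in>F. a i * e i"] norm_triangle_ineq4[of "z y" "w y"] by linarith
    also have "\<dots> \<le> 2 * norm y + 2 * \<epsilon> * S"
      using err dual_ball_norm[OF z(1), of y] dual_ball_norm[OF w(1), of y] by linarith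
    finally show ?thesis by (simp add: mult.commute)
  qed
  show "\<epsilon> * S \<le> norm y"
  proof (cases "0 < \<epsilon>")
    case False
    then have "\<epsilon> * S \<le> 0" by (auto simp: S_def intro!: mult_nonpos_nonneg sum_nonneg)
    then show ?thesis using norm_ge_zero[of y] by linarith
  next
    case True
    \<comment> \<open>With these patterns the signed sums are the sums of \<open>\<bar>Re (a i)\<bar>\<close> and \<open>\<bar>Im (a i)\<bar>\<close>.\<close>
    let ?A = "{i \<in> F. 0 \<le> Re (a i)}" and ?B = "{i \<in> F. 0 \<le> Im (a i)}"
    have "(\<Sum>i\<in>F. \<bar>Re (a i)\<bar>) = Re (\<Sum>i\<in>F. a i * (if i \<in> ?A then 1 else - 1))"
      unfolding Re_sum by (rule sum.cong) auto
    also have "\<dots> \<le> cmod (\<Sum>i\<in>F. a i * (if i \<in> ?A then 1 else - 1))" by (rule complex_Re_le_cmod)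
    finally have "8 * \<epsilon> * (\<Sum>i\<in>F. \<bar>Re (a i)\<bar>) \<le> 8 * \<epsilon> * cmod (\<Sum>i\<in>F. a i * (if i \<in> ?A then 1 else - 1))"
      using True by (intro mult_left_mono) auto
    then have 1: "8 * \<epsilon> * (\<Sum>i\<in>F. \<bar>Re (a i)\<bar>) \<le> 2 * norm y + 2 * \<epsilon> * S"
      using key[of ?A] by simp
    have "(\<Sum>i\<in>F. \<bar>Im (a i)\<bar>) = Im (\<Sum>i\<in>F. a i * (if i \<in> ?B then 1 else - 1))"
      unfolding Im_sum by (rule sum.cong) auto
    also have "\<dots> \<le> cmod (\<Sum>i\<in>F. a i * (if i \<in> ?B then 1 else - 1))"
      using abs_Im_le_cmod abs_ge_self order_trans by blast
    finally have "8 * \<epsilon> * (\<Sum>i\<in>F. \<bar>Im (a i)\<bar>) \<le> 8 * \<epsilon> * cmod (\<Sum>i\<in>F. a i * (if i \<in> ?B then 1 else - 1))"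
      using True by (intro mult_left_mono) auto
    then have 2: "8 * \<epsilon> * (\<Sum>i\<in>F. \<bar>Im (a i)\<bar>) \<le> 2 * norm y + 2 * \<epsilon> * S"
      using key[of ?B] by simp
    have "S \<le> (\<Sum>i\<in>F. \<bar>Re (a i)\<bar>) + (\<Sum>i\<in>F. \<bar>Im (a i)\<bar>)"
      unfolding S_def sum.distrib[symmetric] by (intro sum_mono cmod_le)
    then have "8 * \<epsilon> * S \<le> 8 * \<epsilon> * ((\<Sum>i\<in>F. \<bar>Re (a i)\<bar>) + (\<Sum>i\<in>F. \<bar>Im (a i)\<bar>))"
      using True by (intro mult_left_mono) auto
    then show ?thesis using 1 2 by (simp add: distrib_left)
  qed
qed

text \<open>The condition through which all equivalences are proved.\<close>

definition many_ell1 :: "('a::complex_banach \<Rightarrow> 'a) \<Rightarrow> 'a \<Rightarrow> bool" where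
  "many_ell1 \<alpha> x \<longleftrightarrow> (\<exists>\<rho>>0. \<exists>d>0. \<exists>\<^sub>F n in sequentially. \<exists>I\<subseteq>{..<n}.
     d * real n \<le> real (card I) \<and> ell1_lower \<rho> I (\<lambda>i. (\<alpha> ^^ i) x))"

lemma pigeonhole_fibre:
  assumes "finite E" "finite Y" "g ` E \<subseteq> Y" "E \<noteq> {}"
  obtains y where "y \<in> Y" "card E \<le> card Y * card {e \<in> E. g e = y}"
proof -
  have "Y \<noteq> {}" using assms by auto
  have "\<exists>y\<in>Y. card E \<le> card Y * card {e \<in> E. g e = y}"
  proof (rule ccontr)
    assume "\<not> ?thesis"
    then have lt: "card Y * card {e \<in> E. g e = y} < card E" if "y \<in> Y" for y using that by auto
    have "card E = (\<Sum>y\<in>Y. card {e \<in> E. g e = y})"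
      using sum.group[OF assms(1-3), of "\<lambda>_. 1::nat"] by simp
    then have "card Y * card E = (\<Sum>y\<in>Y. card Y * card {e \<in> E. g e = y})"
      by (simp add: sum_distrib_left)
    also have "\<dots> < (\<Sum>y\<in>Y. card E)"
      using assms(2) \<open>Y \<noteq> {}\<close> lt by (rule sum_strict_mono)
    finally show False by simp
  qed
  then show ?thesis using that by blast
qed

lemma maximal_separated_set:
  assumes fin: "finite A" and sym: "\<And>s t. R s t \<Longrightarrow> R t s"
  obtains S where "S \<subseteq> A" "\<And>s t. s \<in> S \<Longrightarrow> t \<in> S \<Longrightarrow> s \<noteq> t \<Longrightarrow> R s t"
    "\<And>t. t \<in> A \<Longrightarrow> \<exists>s\<in>S. s = t \<or> \<not> R s t"
proof -
  let ?C = "{S. S \<subseteq> A \<and> (\<forall>s\<in>S. \<forall>t\<in>S. s \<noteq> t \<longrightarrow> R s t)}"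
  have "finite ?C" using fin by (auto intro: finite_subset[of _ "Pow A"])
  moreover have "{} \<in> ?C" by auto
  ultimately obtain S where S: "S \<in> ?C" "\<And>S'. S' \<in> ?C \<Longrightarrow> S \<subseteq> S' \<Longrightarrow> S = S'"
    using finite_has_maximal[of ?C] by (metis (no_types, lifting) empty_iff)
  show ?thesis
  proof (rule that[of S])
    fix t assume t: "t \<in> A"
    show "\<exists>s\<in>S. s = t \<or> \<not> R s t"
    proof (rule ccontr)
      assume no: "\<not> ?thesis"
      then have "insert t S \<in> ?C" using S(1) t sym by auto
      then have "S = insert t S" by (rule S(2)) auto
      then show False using no by auto
    qed
  qed (use S(1) in auto)
qed

context dual_system
begin

text \<open>Two far letters are chosen so that they occur in a fraction \<open>1 / (card P)\<^sup>2\<close> of the triples; they differ at some \<open>x \<in> F\<close>,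
  and on the positions of these triples the orbit realises all patterns of their two values at \<open>x\<close>.\<close>

lemma shattered_orbit_imp_ell1:
  assumes E: "shattered far S E" "finite E" "E \<subseteq> {..<n} \<times> P \<times> P" and P: "finite P"
    and ne: "E \<noteq> {}" and \<epsilon>: "0 < \<epsilon>"
    and far: "far = (\<lambda>p q. \<exists>x\<in>F. 8 * \<epsilon> \<le> cmod (p x - q x))"
    and S: "\<And>s. s \<in> S \<Longrightarrow> \<exists>z\<in>K. \<forall>i<n. \<forall>x\<in>F. cmod ((dual_map \<alpha> ^^ i) z x - s i x) < \<epsilon>"
  shows "\<exists>x\<in>F. \<exists>I\<subseteq>{..<n}. real (card E) \<le> (real (card P))\<^sup>2 * real (card I) \<and> ell1_lower \<epsilon> I (\<lambda>i. (\<alpha> ^^ i) x)"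
proof -
  have irrefl: "\<not> far p p" for p using \<epsilon> by (auto simp: far)
  obtain pq where pq: "pq \<in> P \<times> P" "card E \<le> card (P \<times> P) * card {e \<in> E. snd e = pq}"
    by (rule pigeonhole_fibre[of E "P \<times> P" snd]) (use E P ne in auto)
  obtain p q where [simp]: "pq = (p, q)" by (cases pq)
  define E' where "E' = {e \<in> E. snd e = pq}"
  define I where "I = fst ` E'"
  have E'E: "E' \<subseteq> E" by (auto simp: E'_def)
  have inj: "inj_on fst E" by (rule shattered_inj_on_fst[OF E(1) irrefl])
  have cardI: "card I = card E'"
    unfolding I_def by (rule card_image[OF inj_on_subset[OF inj E'E]])
  have bound: "real (card E) \<le> (real (card P))\<^sup>2 * real (card I)"
    using of_nat_mono[OF pq(2), where 'a = real] unfolding cardI E'_def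
    by (simp add: card_cartesian_product power2_eq_square)
  have "card E > 0" using E(2) ne by (simp add: card_gt_0_iff)
  have "E' \<noteq> {}"
  proof
    assume "E' = {}"
    then have "card E \<le> 0" using pq(2) unfolding E'_def by (simp only: card.empty mult_0_right)
    then show False using \<open>card E > 0\<close> by simp
  qed
  then obtain j where "(j, p, q) \<in> E" by (auto simp: E'_def)
  then have "far p q" using E(1) unfolding shattered_def by simp
  then obtain x where x: "x \<in> F" "8 * \<epsilon> \<le> cmod (p x - q x)" by (auto simp: far)
  have I: "(i, p, q) \<in> E" if "i \<in> I" for i using that by (auto simp: I_def E'_def)
  have "ell1_lower \<epsilon> I (\<lambda>i. (\<alpha> ^^ i) x)"
  proof (rule two_values_imp_ell1_lower[OF x(2)])
    fix A assume A: "A \<subseteq> I"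
    let ?A = "(\<lambda>i. (i, p, q)) ` A"
    have "?A \<subseteq> E" using A I by auto
    with E(1) have "\<exists>s\<in>S. \<forall>i p q. ((i, p, q) \<in> ?A \<longrightarrow> s i = p) \<and> ((i, p, q) \<in> E - ?A \<longrightarrow> s i = q)"
      unfolding shattered_def by simp
    then obtain s where "s \<in> S" and s0: "\<forall>i p q. ((i, p, q) \<in> ?A \<longrightarrow> s i = p) \<and> ((i, p, q) \<in> E - ?A \<longrightarrow> s i = q)" ..
    then have s: "s \<in> S" "\<And>i p q. (i, p, q) \<in> ?A \<Longrightarrow> s i = p"
      "\<And>i p q. (i, p, q) \<in> E \<Longrightarrow> (i, p, q) \<notin> ?A \<Longrightarrow> s i = q" by simp_all
    obtain z where z: "z \<in> K" "\<And>i. i < n \<Longrightarrow> cmod ((dual_map \<alpha> ^^ i) z x - s i x) < \<epsilon>"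
      using S[OF s(1)] x(1) by blast
    have In: "i < n" if "i \<in> I" for i using I[OF that] E(3) by auto
    have "cmod (z ((\<alpha> ^^ i) x) - p x) < \<epsilon>" if "i \<in> A" for i
      using z(2)[of i] s(2)[of i p q] that A In by (auto simp: dual_map_funpow)
    moreover have "cmod (z ((\<alpha> ^^ i) x) - q x) < \<epsilon>" if "i \<in> I - A" for i
      using z(2)[of i] s(3)[of i p q] that I In by (auto simp: dual_map_funpow)
    ultimately show "\<exists>z\<in>dual_ball. (\<forall>i\<in>A. cmod (z ((\<alpha> ^^ i) x) - p x) < \<epsilon>) \<and> (\<forall>i\<in>I - A. cmod (z ((\<alpha> ^^ i) x) - q x) < \<epsilon>)"
      using z(1) K_ball by (intro bexI[of _ z]) auto
  qed
  moreover have "I \<subseteq> {..<n}" using I E(3) by auto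
  ultimately show ?thesis using x(1) bound by blast
qed

text \<open>Choose a maximal separated set \<open>S\<close> of orbit words.  By maximality the word of any \<open>z\<close> is not far from some
  \<open>s \<in> S\<close> except at few positions.  So a name of \<open>z\<close> can be read off from \<open>s\<close> together with the set \<open>E\<close> of these positions and their
  letters, and there are at most \<open>C\<close> such sets \<open>E\<close>.\<close>

lemma separated_words_exist:
  fixes far :: "('a \<Rightarrow> complex) \<Rightarrow> ('a \<Rightarrow> complex) \<Rightarrow> bool"
  assumes P: "finite P" and col: "\<And>z. z \<in> K \<Longrightarrow> col z \<in> P"
    and U: "\<And>p. p \<in> P \<Longrightarrow> U p \<in> \<W>" "\<And>z p. z \<in> K \<Longrightarrow> p \<in> P \<Longrightarrow> \<not> far (col z) p \<Longrightarrow> z \<in> U p"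
    and irrefl: "\<And>p. \<not> far p p"
    and sym: "\<And>p q. far p q \<Longrightarrow> far q p"
    and small: "real (card {E. E \<subseteq> {..<n} \<times> P \<and> real (card E) \<le> \<theta> * real n}) \<le> C" and \<theta>: "0 < \<theta>"
  obtains S where "separated_words far \<theta> n P S"
    "\<forall>s\<in>S. \<exists>z\<in>K. \<forall>i<n. s i = col ((dual_map \<alpha> ^^ i) z)"
    "real (cover_number (top_of_set K) (dual_map \<alpha>) \<W> n) \<le> real (card S) * C"
proof -
  let ?T = "dual_map \<alpha>"
  define word where "word = (\<lambda>z. restrict (\<lambda>i. col ((?T ^^ i) z)) {..<n})"
  have word: "word z i = col ((?T ^^ i) z)" if "i < n" for z i using that by (simp add: word_def)
  have wordP: "word z i \<in> P" if "z \<in> K" "i < n" for z i using that col funpow_K by (simp add: word)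
  have "word ` K \<subseteq> PiE {..<n} (\<lambda>_. P)"
    using col funpow_K by (auto simp: word_def)
  then have finW: "finite (word ` K)"
    by (rule finite_subset) (use P in \<open>auto intro!: finite_PiE\<close>)
  have symd: "disagreements far n s t = disagreements far n t s" for s t
    unfolding disagreements_def using sym by blast
  obtain S where S: "S \<subseteq> word ` K" "\<And>s t. s \<in> S \<Longrightarrow> t \<in> S \<Longrightarrow> s \<noteq> t \<Longrightarrow> \<theta> * real n \<le> real (card (disagreements far n s t))"
    "\<And>t. t \<in> word ` K \<Longrightarrow> \<exists>s\<in>S. s = t \<or> \<not> \<theta> * real n \<le> real (card (disagreements far n s t))"
    by (rule maximal_separated_set[OF finW, of "\<lambda>s t. \<theta> * real n \<le> real (card (disagreements far n s t))"])
      (use symd in auto)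
  have finS: "finite S" using S(1) finW by (rule finite_subset)
  have SP: "s i \<in> P" if "s \<in> S" "i < n" for s i using S(1) that wordP by auto
  let ?B = "{E. E \<subseteq> {..<n} \<times> P \<and> real (card E) \<le> \<theta> * real n}"
  define modify :: "(nat \<Rightarrow> 'a \<Rightarrow> complex) \<times> (nat \<times> ('a \<Rightarrow> complex)) set \<Rightarrow> nat \<Rightarrow> 'a \<Rightarrow> complex"
    where "modify = (\<lambda>(s, E) i. if \<exists>p. (i, p) \<in> E then SOME p. (i, p) \<in> E else s i)"
  have finB: "finite ?B" by (rule finite_subset[of _ "Pow ({..<n} \<times> P)"]) (use P in auto)
  have modP: "modify (s, E) i \<in> P" if "s \<in> S" "E \<in> ?B" "i < n" for s E i
  proof (cases "\<exists>p. (i, p) \<in> E")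
    case True
    then have "(i, SOME p. (i, p) \<in> E) \<in> E" by (rule someI_ex)
    then show ?thesis using that(2) True by (auto simp: modify_def)
  next
    case False
    then show ?thesis using SP that by (simp add: modify_def)
  qed
  have "cover_number (top_of_set K) ?T \<W> n \<le> card (S \<times> ?B)"
  proof (rule cover_number_le[where s = "\<lambda>a i. U (modify a i)"])
    show "finite (S \<times> ?B)" using finS finB by simp
    show "U (modify a i) \<in> \<W>" if "a \<in> S \<times> ?B" "i < n" for a i
      using that modP U(1) by (cases a) auto
    fix z assume "z \<in> topspace (top_of_set K)"
    then have z: "z \<in> K" by simp
    obtain s where s: "s \<in> S" "s = word z \<or> \<not> \<theta> * real n \<le> real (card (disagreements far n s (word z)))"
      using S(3)[OF imageI[OF z]] by blast
    have "disagreements far n s (word z) = {}" if "s = word z"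
      using that irrefl by (auto simp: disagreements_def)
    then have dis: "real (card (disagreements far n s (word z))) \<le> \<theta> * real n" using s(2) \<theta> by auto
    define E where "E = (\<lambda>i. (i, word z i)) ` disagreements far n s (word z)"
    have "card E \<le> card (disagreements far n s (word z))"
      unfolding E_def by (rule card_image_le) (simp add: disagreements_def)
    moreover have "E \<subseteq> {..<n} \<times> P" using wordP[OF z] by (auto simp: E_def disagreements_def)
    ultimately have E: "E \<in> ?B" using dis by simp
    have "(?T ^^ i) z \<in> U (modify (s, E) i)" if i: "i < n" for i
    proof (rule U(2)[OF funpow_K[OF z] modP[OF s(1) E i]])
      show "\<not> far (col ((?T ^^ i) z)) (modify (s, E) i)"
      proof (cases "i \<in> disagreements far n s (word z)")
        case True
        then have "\<And>p. (i, p) \<in> E \<longleftrightarrow> p = word z i" by (auto simp: E_def)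
        then have "modify (s, E) i = word z i" by (simp add: modify_def)
        then show ?thesis using irrefl word[OF i] by simp
      next
        case False
        then have "modify (s, E) i = s i" "\<not> far (s i) (word z i)"
          using i by (auto simp: E_def modify_def disagreements_def)
        then show ?thesis using sym word[OF i] by metis
      qed
    qed
    then show "\<exists>a\<in>S \<times> ?B. \<forall>i<n. (?T ^^ i) z \<in> U (modify a i)"
      using s(1) E by (intro bexI[of _ "(s, E)"]) auto
  qed
  from of_nat_mono[OF this, where 'a = real]
  have "real (cover_number (top_of_set K) ?T \<W> n) \<le> real (card S) * real (card ?B)"
    by (simp add: card_cartesian_product)
  also have "\<dots> \<le> real (card S) * C" by (intro mult_left_mono small) simp
  finally have num: "real (cover_number (top_of_set K) ?T \<W> n) \<le> real (card S) * C" .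
  have orbit: "\<exists>z\<in>K. \<forall>i<n. s i = col ((?T ^^ i) z)" if s: "s \<in> S" for s
  proof -
    obtain z where "z \<in> K" "s = word z" using subsetD[OF S(1) s] by (rule imageE)
    then show ?thesis using word by (intro bexI[of _ z]) simp_all
  qed
  have "separated_words far \<theta> n P S"
    unfolding separated_words_def using finS SP S(2) by simp
  then show ?thesis by (rule that) (use orbit num in simp_all)
qed

text \<open>The constants are matched as follows: \<open>\<delta>\<close> is a Lebesgue number, letters are accurate up to \<open>\<epsilon> = \<delta> / 10\<close>, and letters
  are far if their values differ by \<open>8 \<epsilon>\<close>.  Then a functional lies within \<open>\<delta>\<close> of every letter that is not far from its own, and far
  letters differ enough for \<open>two_values_imp_ell1_lower\<close>.  The vector found depends on \<open>n\<close>, but it lies in a finite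
  set, so one of them serves for infinitely many \<open>n\<close>.\<close>

theorem positive_entropy_imp_many_ell1:
  assumes \<Delta>: "total_set \<Delta>" and pos: "0 < htop (top_of_set K) (dual_map \<alpha>)"
  shows "\<exists>x\<in>\<Delta>. many_ell1 \<alpha> x"
proof -
  let ?T = "dual_map \<alpha>"
  obtain \<W> b where \<W>: "finite_open_cover (top_of_set K) \<W>" and b: "0 < b"
    and large: "eventually (\<lambda>n. exp (b * real n) \<le> real (cover_number (top_of_set K) ?T \<W> n)) sequentially"
    by (rule htop_posD[OF pos K_inv_top])
  obtain F \<delta> where F: "finite F" "F \<subseteq> \<Delta>" "0 < \<delta>" "\<forall>z\<in>K. \<exists>U\<in>\<W>. nbhd K F \<delta> z \<subseteq> U"
    by (rule Lebesgue_number_total[OF \<Delta> K_ball K_compact \<W>])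
  define \<epsilon> where "\<epsilon> = \<delta> / 10"
  have \<epsilon>: "0 < \<epsilon>" using F(3) by (simp add: \<epsilon>_def)
  obtain P where P: "finite P" "P \<subseteq> K" "\<forall>z\<in>K. \<exists>p\<in>P. z \<in> nbhd K F \<epsilon> p"
    by (rule finite_nbhd_cover[OF K_compact F(1) \<epsilon>])
  have "\<forall>z\<in>K. \<exists>p. p \<in> P \<and> z \<in> nbhd K F \<epsilon> p" using P(3) by blast
  from bchoice[OF this] obtain col where col0: "\<forall>z\<in>K. col z \<in> P \<and> z \<in> nbhd K F \<epsilon> (col z)" ..
  have col: "col z \<in> P" "x \<in> F \<Longrightarrow> cmod (z x - col z x) < \<epsilon>" if "z \<in> K" for z x
    using bspec[OF col0 that] by (auto simp: nbhd_def)
  have "\<forall>p\<in>P. \<exists>U. U \<in> \<W> \<and> nbhd K F \<delta> p \<subseteq> U" using F(4) P(2) by blast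
  from bchoice[OF this] obtain U where U0: "\<forall>p\<in>P. U p \<in> \<W> \<and> nbhd K F \<delta> p \<subseteq> U p" ..
  define far where "far = (\<lambda>p q :: 'a \<Rightarrow> complex. \<exists>x\<in>F. 8 * \<epsilon> \<le> cmod (p x - q x))"
  have irrefl: "\<not> far p p" for p using \<epsilon> by (auto simp: far_def)
  have sym: "far p q \<Longrightarrow> far q p" for p q by (auto simp: far_def norm_minus_commute)
  have U: "U p \<in> \<W>" "z \<in> K \<Longrightarrow> \<not> far (col z) p \<Longrightarrow> z \<in> U p" if p: "p \<in> P" for p z
  proof -
    show "U p \<in> \<W>" using bspec[OF U0 p] by simp
    assume z: "z \<in> K" and nf: "\<not> far (col z) p"
    have "cmod (z x - p x) < \<delta>" if x: "x \<in> F" for x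
    proof -
      have "cmod (col z x - p x) < 8 * \<epsilon>" using nf x by (force simp: far_def)
      then show ?thesis
        using col(2)[OF z x] norm_triangle_ineq[of "z x - col z x" "col z x - p x"] \<epsilon> by (simp add: \<epsilon>_def)
    qed
    then have "z \<in> nbhd K F \<delta> p" using z by (simp add: nbhd_def)
    then show "z \<in> U p" using bspec[OF U0 p] by blast
  qed
  have b2: "0 < b / 2" using b by simp
  obtain \<theta> where \<theta>: "0 < \<theta>" "\<And>n (V :: (nat \<times> ('a \<Rightarrow> complex)) set). finite V \<Longrightarrow> card V \<le> card P * n \<Longrightarrow>
           real (card {E. E \<subseteq> V \<and> real (card E) \<le> \<theta> * real n}) \<le> exp (b / 2 * real n)"
    by (rule card_small_subsets[OF b2, where k = "card P"]) blast
  obtain c where c: "0 < c" "\<forall>n S. 0 < n \<longrightarrow> separated_words far \<theta> n P S \<longrightarrow> exp (b / 2 * real n) \<le> real (card S) \<longrightarrow>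
      (\<exists>E. E \<subseteq> {..<n} \<times> P \<times> P \<and> shattered far S E \<and> c * real n \<le> real (card E))"
    using separated_words_shatter[where far = far, OF P(1) irrefl b2 \<theta>(1)] by (elim exE conjE)
  \<comment> \<open>The summand 1 keeps the denominator positive for empty \<open>P\<close>.\<close>
  define d where "d = c / ((real (card P))\<^sup>2 + 1)"
  have pp: "0 < (real (card P))\<^sup>2 + 1" by (smt (verit) zero_le_power2)
  have d: "0 < d" using c(1) pp by (simp add: d_def)
  have "\<forall>\<^sub>F n in sequentially. \<exists>x\<in>F. \<exists>I\<subseteq>{..<n}. d * real n \<le> real (card I) \<and> ell1_lower \<epsilon> I (\<lambda>i. (\<alpha> ^^ i) x)"
    using large eventually_gt_at_top[of 0]
  proof eventually_elim
    case (elim n)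
    have small: "real (card {E. E \<subseteq> {..<n} \<times> P \<and> real (card E) \<le> \<theta> * real n}) \<le> exp (b / 2 * real n)"
      by (rule \<theta>(2)) (auto simp: P(1) card_cartesian_product)
    obtain S where S: "separated_words far \<theta> n P S"
      "\<forall>s\<in>S. \<exists>z\<in>K. \<forall>i<n. s i = col ((?T ^^ i) z)"
      "real (cover_number (top_of_set K) ?T \<W> n) \<le> real (card S) * exp (b / 2 * real n)"
      by (rule separated_words_exist[where \<W> = \<W> and far = far and col = col and U = U, OF P(1) _ _ _ irrefl sym small \<theta>(1)])
        (use col(1) U in auto)
    have "exp (b / 2 * real n) * exp (b / 2 * real n) = exp (b * real n)"
      by (simp add: exp_add[symmetric] algebra_simps)
    also have "\<dots> \<le> real (card S) * exp (b / 2 * real n)" using elim(1) S(3) by linarith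
    finally have "exp (b / 2 * real n) \<le> real (card S)" by simp
    then obtain E where E: "E \<subseteq> {..<n} \<times> P \<times> P" "shattered far S E" "c * real n \<le> real (card E)"
      using c(2) elim(2) S(1) by blast
    have finE: "finite E" using E(1) P(1) by (auto intro: finite_subset)
    have "0 < c * real n" using c(1) elim(2) by simp
    then have "E \<noteq> {}" using E(3) by auto
    have "\<exists>x\<in>F. \<exists>I\<subseteq>{..<n}. real (card E) \<le> (real (card P))\<^sup>2 * real (card I) \<and> ell1_lower \<epsilon> I (\<lambda>i. (\<alpha> ^^ i) x)"
    proof (rule shattered_orbit_imp_ell1[OF E(2) finE E(1) P(1) \<open>E \<noteq> {}\<close> \<epsilon> far_def])
      fix s assume "s \<in> S"
      obtain z where z: "z \<in> K" "\<forall>i<n. s i = col ((?T ^^ i) z)" using bspec[OF S(2) \<open>s \<in> S\<close>] by (rule bexE)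
      then show "\<exists>z\<in>K. \<forall>i<n. \<forall>x\<in>F. cmod ((?T ^^ i) z x - s i x) < \<epsilon>"
        using col(2)[OF funpow_K[OF z(1)]] by (intro bexI[of _ z]) auto
    qed
    then obtain x I where x: "x \<in> F" "I \<subseteq> {..<n}" "real (card E) \<le> (real (card P))\<^sup>2 * real (card I)"
       "ell1_lower \<epsilon> I (\<lambda>i. (\<alpha> ^^ i) x)" by blast
    have "c * real n \<le> ((real (card P))\<^sup>2 + 1) * real (card I)"
      using E(3) x(3) by (simp add: distrib_right)
    then have "d * real n \<le> real (card I)" using pp by (simp add: d_def divide_le_eq mult.commute)
    then show ?case using x by blast
  qed
  then have "\<exists>\<^sub>F n in sequentially. \<exists>x\<in>F. \<exists>I\<subseteq>{..<n}. d * real n \<le> real (card I) \<and> ell1_lower \<epsilon> I (\<lambda>i. (\<alpha> ^^ i) x)"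
    by (intro eventually_frequently) auto
  then have "\<exists>x\<in>F. \<exists>\<^sub>F n in sequentially. \<exists>I\<subseteq>{..<n}. d * real n \<le> real (card I) \<and> ell1_lower \<epsilon> I (\<lambda>i. (\<alpha> ^^ i) x)"
    by (rule frequently_bex_finite[OF F(1)])
  then show ?thesis unfolding many_ell1_def using F(2) \<epsilon> d by blast
qed

end

section \<open>Proportional copies of \<open>\<ell>\<^sub>1\<close> yield positive topological entropy\<close>

text \<open>For \<open>x = 0\<close> nothing is asked, so that the empty \<open>Z\<close>, possible for the zero space, needs no special treatment.\<close>

definition norming :: "real \<Rightarrow> ('a::complex_banach \<Rightarrow> complex) set \<Rightarrow> bool" where
  "norming \<kappa> K \<longleftrightarrow> 0 < \<kappa> \<and> (\<forall>x. x \<noteq> 0 \<longrightarrow> (\<exists>z\<in>K. \<kappa> * norm x \<le> cmod (z x)))"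

lemma isomorphism_imp_norming:
  fixes Z :: "('a::complex_banach \<Rightarrow> complex) set"
  assumes Z: "Z \<subseteq> dual_ball" and iso: "isomorphism_on UNIV norm W (sup_norm Z) (eval_on Z)"
  obtains \<kappa> where "norming \<kappa> Z"
proof -
  obtain C where C: "\<And>f. f \<in> W \<Longrightarrow> norm (inv_into UNIV (eval_on Z) f) \<le> C * sup_norm Z f"
    and bij: "bij_betw (eval_on Z) UNIV W"
    using iso unfolding isomorphism_on_def bounded_on_def by auto
  define D where "D = max C 1"
  have D: "0 < D" "C \<le> D" by (auto simp: D_def)
  have bound: "norm x \<le> D * sup_norm Z (eval_on Z x)" for x
  proof -
    have "eval_on Z x \<in> W" using bij by (auto simp: bij_betw_def)
    moreover have "inv_into UNIV (eval_on Z) (eval_on Z x) = x"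
      using bij by (intro inv_into_f_f) (auto simp: bij_betw_def)
    ultimately have "norm x \<le> C * sup_norm Z (eval_on Z x)" using C by force
    moreover have "0 \<le> sup_norm Z (eval_on Z x)"
      unfolding sup_norm_def
    proof (rule cSup_upper)
      show "bdd_above (insert 0 ((\<lambda>k. cmod (eval_on Z x k)) ` Z))"
        using Z by (intro bdd_aboveI[of _ "norm x"]) (auto simp: eval_on_def intro: dual_ball_norm)
    qed simp
    ultimately show ?thesis using mult_right_mono[OF D(2)] by force
  qed
  have "norming (1 / (2 * D)) Z"
    unfolding norming_def
  proof (intro conjI allI impI)
    fix x :: 'a assume "x \<noteq> 0"
    then have x: "0 < norm x" by simp
    have "norm x / D \<le> sup_norm Z (eval_on Z x)" using bound[of x] D(1) by (simp add: field_simps)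
    moreover have "1 / (2 * D) * norm x < norm x / D" using x D(1) by (simp add: field_simps)
    ultimately have "1 / (2 * D) * norm x < Sup (insert 0 ((\<lambda>k. cmod (eval_on Z x k)) ` Z))"
      unfolding sup_norm_def by linarith
    then obtain t where t: "t \<in> insert 0 ((\<lambda>k. cmod (eval_on Z x k)) ` Z)" "1 / (2 * D) * norm x < t"
      using less_cSupD[of "insert 0 ((\<lambda>k. cmod (eval_on Z x k)) ` Z)"] by blast
    have "0 < 1 / (2 * D) * norm x" using x D(1) by simp
    then have "t \<noteq> 0" using t(2) by linarith
    then obtain z where "z \<in> Z" "t = cmod (z x)" using t(1) by (auto simp: eval_on_def)
    then show "\<exists>z\<in>Z. 1 / (2 * D) * norm x \<le> cmod (z x)" using t(2) by (intro bexI[of _ z]) auto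
  qed (use D in simp)
  then show ?thesis by (rule that)
qed

lemma norming_signs:
  assumes nrm: "norming \<kappa> K" and \<rho>: "0 < \<rho>" and l: "ell1_lower \<rho> I v" and I: "finite I" "I \<noteq> {}"
    and s: "s \<in> PiE I (\<lambda>_. {-1, 1})" and K: "K \<subseteq> dual_ball"
  shows "\<exists>z\<in>K. \<kappa> * \<rho> * real (card I) \<le> cmod (\<Sum>i\<in>I. complex_of_real (s i) * z (v i))"
proof -
  define y where "y = (\<Sum>i\<in>I. complex_of_real (s i) *\<^sub>C v i)"
  have "\<rho> * (\<Sum>i\<in>I. cmod (complex_of_real (s i))) \<le> norm y"
    unfolding y_def by (rule ell1_lowerD[OF l subset_refl I(1)])
  moreover have "(\<Sum>i\<in>I. cmod (complex_of_real (s i))) = (\<Sum>i\<in>I. 1)"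
    using s by (intro sum.cong refl) (auto simp: PiE_iff)
  ultimately have y: "\<rho> * real (card I) \<le> norm y" by simp
  have "0 < \<rho> * real (card I)" using \<rho> I by (simp add: card_gt_0_iff)
  then have "y \<noteq> 0" using y by auto
  then obtain z where z: "z \<in> K" "\<kappa> * norm y \<le> cmod (z y)" using nrm by (auto simp: norming_def)
  have "\<kappa> * (\<rho> * real (card I)) \<le> \<kappa> * norm y" using y nrm by (intro mult_left_mono) (auto simp: norming_def)
  moreover have "z y = (\<Sum>i\<in>I. complex_of_real (s i) * z (v i))"
    unfolding y_def by (rule dual_ball_sum) (use z K in auto)
  ultimately show ?thesis using z by (intro bexI[of _ z]) (auto simp: mult.assoc)
qed

lemma many_ell1E:
  assumes "many_ell1 \<alpha> x"
  obtains \<rho> d where "0 < \<rho>" "0 < d" "\<exists>\<^sub>F n in sequentially. 0 < n \<and> (\<exists>I\<subseteq>{..<n}. I \<noteq> {} \<and>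
     d * real n \<le> real (card I) \<and> ell1_lower \<rho> I (\<lambda>i. (\<alpha> ^^ i) x))"
proof -
  obtain \<rho> d where 1: "0 < \<rho>" "0 < d" "\<exists>\<^sub>F n in sequentially. \<exists>I\<subseteq>{..<n}.
     d * real n \<le> real (card I) \<and> ell1_lower \<rho> I (\<lambda>i. (\<alpha> ^^ i) x)"
    using assms unfolding many_ell1_def by (elim exE conjE)
  have "\<exists>\<^sub>F n in sequentially. 0 < n \<and> (\<exists>I\<subseteq>{..<n}. I \<noteq> {} \<and>
     d * real n \<le> real (card I) \<and> ell1_lower \<rho> I (\<lambda>i. (\<alpha> ^^ i) x))"
    using frequently_eventually_conj[OF 1(3) eventually_gt_at_top[of 0]]
  proof (rule frequently_elim1)
    fix n assume h: "0 < n \<and> (\<exists>I\<subseteq>{..<n}. d * real n \<le> real (card I) \<and> ell1_lower \<rho> I (\<lambda>i. (\<alpha> ^^ i) x))"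
    then obtain I where I: "I \<subseteq> {..<n}" "d * real n \<le> real (card I)" "ell1_lower \<rho> I (\<lambda>i. (\<alpha> ^^ i) x)" by blast
    have "0 < d * real n" using h 1(2) by simp
    then have "I \<noteq> {}" using I(2) by auto
    then show "0 < n \<and> (\<exists>I\<subseteq>{..<n}. I \<noteq> {} \<and> d * real n \<le> real (card I) \<and> ell1_lower \<rho> I (\<lambda>i. (\<alpha> ^^ i) x))"
      using h I by (intro conjI exI[of _ I]) simp_all
  qed
  with 1(1,2) show ?thesis by (rule that)
qed

context dual_system
begin

text \<open>A name in a cover by sets of small oscillation determines the values at \<open>\<alpha>\<^sup>i x\<close> up to \<open>\<epsilon>\<close>.  As \<open>K\<close> is norming,
  every sign pattern has a large signed sum on one of the resulting vectors, of which there is one for each name.\<close>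

theorem many_ell1_imp_positive_entropy:
  assumes nrm: "norming \<kappa> K" and many: "many_ell1 \<alpha> x"
  shows "0 < htop (top_of_set K) (dual_map \<alpha>)"
proof -
  let ?T = "dual_map \<alpha>"
  obtain \<rho> d where \<rho>: "0 < \<rho>" and d: "0 < d" and freq: "\<exists>\<^sub>F n in sequentially. 0 < n \<and> (\<exists>I\<subseteq>{..<n}. I \<noteq> {} \<and>
     d * real n \<le> real (card I) \<and> ell1_lower \<rho> I (\<lambda>i. (\<alpha> ^^ i) x))"
    by (rule many_ell1E[OF many])
  have \<kappa>: "0 < \<kappa>" using nrm by (simp add: norming_def)
  define R where "R = norm x + 1"
  have R: "0 < R" by (simp add: R_def add_nonneg_pos)
  define \<epsilon> where "\<epsilon> = \<kappa> * \<rho> / 2"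
  have \<epsilon>: "0 < \<epsilon>" using \<kappa> \<rho> by (simp add: \<epsilon>_def)
  have fx: "finite {x}" by simp
  obtain P where P: "finite P" "P \<subseteq> K" "\<forall>z\<in>K. \<exists>p\<in>P. z \<in> nbhd K {x} \<epsilon> p" and \<W>: "finite_open_cover (top_of_set K) (nbhd K {x} \<epsilon> ` P)"
    by (rule finite_nbhd_cover[OF K_compact fx \<epsilon>])
  define c where "c = \<epsilon>\<^sup>2 / (16 * R\<^sup>2)"
  have c: "0 < c" using \<epsilon> R by (simp add: c_def)
  have "\<exists>\<^sub>F n in sequentially. exp (c * d * real n) \<le> 4 * real (cover_number (top_of_set K) ?T (nbhd K {x} \<epsilon> ` P) n)"
    using freq
  proof (rule frequently_elim1)
    fix n assume "0 < n \<and> (\<exists>I\<subseteq>{..<n}. I \<noteq> {} \<and> d * real n \<le> real (card I) \<and> ell1_lower \<rho> I (\<lambda>i. (\<alpha> ^^ i) x))"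
    then obtain I where I: "I \<subseteq> {..<n}" "I \<noteq> {}" "d * real n \<le> real (card I)" "ell1_lower \<rho> I (\<lambda>i. (\<alpha> ^^ i) x)" by blast
    have finI: "finite I" using I(1) by (rule finite_subset) simp
    obtain A where A: "finite A" "card A \<le> cover_number (top_of_set K) ?T (nbhd K {x} \<epsilon> ` P) n"
      "\<And>s i. s \<in> A \<Longrightarrow> i < n \<Longrightarrow> s i \<in> nbhd K {x} \<epsilon> ` P"
      "\<And>z. z \<in> topspace (top_of_set K) \<Longrightarrow> \<exists>s\<in>A. \<forall>i<n. (?T ^^ i) z \<in> s i"
      using cover_number_witness[OF \<W> K_inv_top, of n] by blast
    define y where "y = (\<lambda>(s :: nat \<Rightarrow> ('a \<Rightarrow> complex) set) i. (SOME p. p \<in> P \<and> s i = nbhd K {x} \<epsilon> p) x)"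
    have y: "\<exists>p\<in>P. s i = nbhd K {x} \<epsilon> p \<and> y s i = p x" if "s \<in> A" "i < n" for s i
    proof -
      have "\<exists>p. p \<in> P \<and> s i = nbhd K {x} \<epsilon> p" using A(3)[OF that] by blast
      from someI_ex[OF this] show ?thesis
        by (intro bexI[of _ "SOME p. p \<in> P \<and> s i = nbhd K {x} \<epsilon> p"]) (simp_all add: y_def)
    qed
    have "exp (\<epsilon>\<^sup>2 / (16 * R\<^sup>2) * real (card I)) \<le> 4 * real (card A)"
    proof (rule signs_need_many_functionals[OF finI A(1) R \<epsilon>, of y])
      fix s i assume si: "s \<in> A" "i \<in> I"
      then have "i < n" using I(1) by auto
      then obtain p where "p \<in> P" "y s i = p x" using y[OF si(1)] by blast
      then show "cmod (y s i) \<le> R" using P(2) K_ball dual_ball_norm[of p x] by (auto simp: R_def)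
    next
      fix t assume t: "t \<in> PiE I (\<lambda>_. {-1, 1::real})"
      obtain z where z: "z \<in> K" "\<kappa> * \<rho> * real (card I) \<le> cmod (\<Sum>i\<in>I. complex_of_real (t i) * z ((\<alpha> ^^ i) x))"
        using norming_signs[OF nrm \<rho> I(4) finI I(2) t K_ball] by blast
      obtain s where s: "s \<in> A" "\<forall>i<n. (?T ^^ i) z \<in> s i" using A(4)[of z] z(1) by auto
      have close: "cmod (z ((\<alpha> ^^ i) x) - y s i) \<le> \<epsilon>" if i: "i \<in> I" for i
      proof -
        have "i < n" using i I(1) by auto
        then obtain p where "s i = nbhd K {x} \<epsilon> p" "y s i = p x" using y[OF s(1)] by blast
        then show ?thesis using s(2) \<open>i < n\<close> by (auto simp: nbhd_def dual_map_funpow intro: less_imp_le)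
      qed
      let ?a = "\<lambda>i. complex_of_real (t i)"
      have t1: "cmod (?a i) = 1" if "i \<in> I" for i using t that by (auto simp: PiE_iff)
      have "cmod (\<Sum>i\<in>I. ?a i * (z ((\<alpha> ^^ i) x) - y s i)) \<le> (\<Sum>i\<in>I. \<epsilon>)"
      proof (rule sum_norm_le)
        fix i assume "i \<in> I"
        then show "cmod (?a i * (z ((\<alpha> ^^ i) x) - y s i)) \<le> \<epsilon>"
          using close t1 by (simp add: norm_mult)
      qed
      moreover have "(\<Sum>i\<in>I. ?a i * z ((\<alpha> ^^ i) x)) = (\<Sum>i\<in>I. ?a i * y s i) + (\<Sum>i\<in>I. ?a i * (z ((\<alpha> ^^ i) x) - y s i))"
        by (simp add: sum.distrib[symmetric] algebra_simps)
      ultimately have "\<kappa> * \<rho> * real (card I) \<le> cmod (\<Sum>i\<in>I. ?a i * y s i) + real (card I) * \<epsilon>"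
        using z(2) norm_triangle_ineq[of "\<Sum>i\<in>I. ?a i * y s i" "\<Sum>i\<in>I. ?a i * (z ((\<alpha> ^^ i) x) - y s i)"] by simp
      then have "\<epsilon> * real (card I) \<le> cmod (\<Sum>i\<in>I. ?a i * y s i)" by (simp add: \<epsilon>_def algebra_simps)
      then show "\<exists>s\<in>A. \<epsilon> * real (card I) \<le> cmod (\<Sum>i\<in>I. ?a i * y s i)" using s(1) by blast
    qed
    moreover have "c * d * real n \<le> \<epsilon>\<^sup>2 / (16 * R\<^sup>2) * real (card I)"
      using mult_left_mono[OF I(3), of c] c by (simp add: c_def mult.assoc)
    then have "exp (c * d * real n) \<le> exp (\<epsilon>\<^sup>2 / (16 * R\<^sup>2) * real (card I))" by simp
    moreover have "real (card A) \<le> real (cover_number (top_of_set K) ?T (nbhd K {x} \<epsilon> ` P) n)" using A(2) by simp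
    ultimately show "exp (c * d * real n) \<le> 4 * real (cover_number (top_of_set K) ?T (nbhd K {x} \<epsilon> ` P) n)"
      by linarith
  qed
  then have "ereal (c * d) \<le> htop (top_of_set K) ?T" by (rule htop_ge[OF \<W> K_inv_top]) simp
  moreover have "0 < ereal (c * d)" using c d by simp
  ultimately show ?thesis by (rule less_le_trans[rotated])
qed

end

section \<open>Interpolation and infinite entropy of the dual ball\<close>

lemma dual_ball_rotate:
  assumes "z \<in> dual_ball" "cmod u \<le> 1"
  shows "(\<lambda>x. u * z x) \<in> dual_ball"
proof -
  have "cmod (u * z x) \<le> norm x" for x
    using mult_mono[OF assms(2) dual_ball_norm[OF assms(1), of x]] by (simp add: norm_mult)
  then show ?thesis using assms(1)
    by (simp add: dual_ball_def clinear_on_def scaleC_complex_def algebra_simps)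
qed

lemma dual_ball_convex:
  assumes z: "z \<in> dual_ball" "w \<in> dual_ball" and t: "0 \<le> t" "t \<le> 1"
  shows "(\<lambda>x. z x + of_real t * (w x - z x)) \<in> dual_ball"
proof -
  have "cmod (z x + of_real t * (w x - z x)) \<le> norm x" for x
  proof -
    have "z x + of_real t * (w x - z x) = of_real (1 - t) * z x + of_real t * w x" by (simp add: algebra_simps)
    also have "cmod \<dots> \<le> cmod (of_real (1 - t) * z x) + cmod (of_real t * w x)" by (rule norm_triangle_ineq)
    also have "\<dots> = (1 - t) * cmod (z x) + t * cmod (w x)" using t by (simp only: norm_mult norm_of_real abs_of_nonneg diff_ge_0_iff_ge)
    also have "\<dots> \<le> (1 - t) * norm x + t * norm x"
      using t z by (intro add_mono mult_left_mono dual_ball_norm) auto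
    finally show ?thesis by (simp add: algebra_simps)
  qed
  then show ?thesis using z
    by (simp add: dual_ball_def clinear_on_def scaleC_complex_def algebra_simps)
qed

lemma quadratic_nonneg_imp_slope_nonneg:
  fixes B C :: real
  assumes "\<And>t. 0 < t \<Longrightarrow> t \<le> 1 \<Longrightarrow> 0 \<le> 2 * t * B + t\<^sup>2 * C"
  shows "0 \<le> B"
proof (rule ccontr)
  assume "\<not> 0 \<le> B"
  then have B: "B < 0" by simp
  define t where "t = min 1 (- B / (\<bar>C\<bar> + 1))"
  have C1: "0 < \<bar>C\<bar> + 1" by linarith
  then have t: "0 < t" "t \<le> 1" using B by (auto simp: t_def divide_neg_pos)
  have "t * (\<bar>C\<bar> + 1) \<le> - B / (\<bar>C\<bar> + 1) * (\<bar>C\<bar> + 1)" by (rule mult_right_mono) (auto simp: t_def)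
  then have "t * (\<bar>C\<bar> + 1) \<le> - B" using C1 by simp
  moreover have "t * C \<le> t * (\<bar>C\<bar> + 1)" using t by (intro mult_left_mono) auto
  ultimately have "2 * B + t * C < 0" using B by linarith
  then have "t * (2 * B + t * C) < 0" using t by (simp add: mult_pos_neg)
  moreover have "0 \<le> t * (2 * B + t * C)" using assms[OF t] by (simp add: algebra_simps power2_eq_square)
  ultimately show False by linarith
qed

text \<open>A functional minimising \<open>\<Sum>\<^sub>i \<bar>\<omega> (v\<^sub>i) - \<theta>\<^sub>i\<bar>\<^sup>2\<close> over the compact ball exists.  If \<open>r\<close> is its residual and
  \<open>y = \<Sum>\<^sub>i cnj r\<^sub>i v\<^sub>i\<close>, then minimality on the convex ball says that it minimises \<open>Re (\<omega> y)\<close>, which is therefore at most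
  \<open>- \<kappa> \<parallel>y\<parallel> \<le> - \<kappa> \<rho> \<Sum>\<^sub>i \<bar>r\<^sub>i\<bar>\<close>.  On the other hand it is at least \<open>\<Sum>\<^sub>i \<bar>r\<^sub>i\<bar>\<^sup>2 - \<kappa> \<rho> \<Sum>\<^sub>i \<bar>r\<^sub>i\<bar>\<close>, so \<open>r = 0\<close>.\<close>

lemma ell1_interpolation:
  fixes v :: "'i \<Rightarrow> 'a::complex_banach"
  assumes nrm: "norming \<kappa> (dual_ball :: ('a \<Rightarrow> complex) set)" and \<rho>: "0 < \<rho>" and l: "ell1_lower \<rho> I v" and I: "finite I"
    and \<theta>: "\<And>i. i \<in> I \<Longrightarrow> cmod (\<theta> i) \<le> \<kappa> * \<rho>"
  obtains \<omega> where "\<omega> \<in> dual_ball" "\<forall>i\<in>I. \<omega> (v i) = \<theta> i"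
proof -
  have \<kappa>: "0 < \<kappa>" using nrm by (simp add: norming_def)
  let ?f = "\<lambda>\<omega> :: 'a \<Rightarrow> complex. \<Sum>i\<in>I. (cmod (\<omega> (v i) - \<theta> i))\<^sup>2"
  have "\<exists>\<omega>0\<in>dual_ball. \<forall>\<omega>\<in>dual_ball. ?f \<omega>0 \<le> ?f \<omega>"
    by (rule continuous_attains_inf) (use zero_in_dual_ball in \<open>auto intro!: compact_dual_ball continuous_intros\<close>)
  then obtain \<omega>0 where \<omega>0: "\<omega>0 \<in> dual_ball" and min: "\<And>\<omega>. \<omega> \<in> dual_ball \<Longrightarrow> ?f \<omega>0 \<le> ?f \<omega>" by blast
  define r where "r = (\<lambda>i. \<omega>0 (v i) - \<theta> i)"
  define y where "y = (\<Sum>i\<in>I. cnj (r i) *\<^sub>C v i)"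
  define S where "S = (\<Sum>i\<in>I. cmod (r i))"
  have ev: "\<omega> y = (\<Sum>i\<in>I. cnj (r i) * \<omega> (v i))" if "\<omega> \<in> dual_ball" for \<omega>
    unfolding y_def by (rule dual_ball_sum[OF that])
  have opt: "Re (\<omega>0 y) \<le> Re (\<omega> y)" if \<omega>: "\<omega> \<in> dual_ball" for \<omega>
  proof -
    let ?u = "\<lambda>i. \<omega> (v i) - \<omega>0 (v i)"
    have "0 \<le> Re (\<Sum>i\<in>I. cnj (r i) * ?u i)"
    proof (rule quadratic_nonneg_imp_slope_nonneg)
      fix t :: real assume t: "0 < t" "t \<le> 1"
      have "?f \<omega>0 \<le> ?f (\<lambda>x. \<omega>0 x + of_real t * (\<omega> x - \<omega>0 x))"
        using t by (intro min dual_ball_convex \<omega>0 \<omega>) auto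
      also have "\<dots> = (\<Sum>i\<in>I. (cmod (r i))\<^sup>2 + (2 * t * Re (cnj (r i) * ?u i) + t\<^sup>2 * (cmod (?u i))\<^sup>2))"
      proof (rule sum.cong)
        fix i
        have "\<omega>0 (v i) + of_real t * ?u i - \<theta> i = r i + of_real t * ?u i" by (simp add: r_def)
        then show "(cmod (\<omega>0 (v i) + of_real t * ?u i - \<theta> i))\<^sup>2 = (cmod (r i))\<^sup>2 + (2 * t * Re (cnj (r i) * ?u i) + t\<^sup>2 * (cmod (?u i))\<^sup>2)"
          unfolding cmod_power2 by (simp only:) (simp add: power2_eq_square algebra_simps)
      qed simp
      also have "\<dots> = ?f \<omega>0 + (2 * t * Re (\<Sum>i\<in>I. cnj (r i) * ?u i) + t\<^sup>2 * (\<Sum>i\<in>I. (cmod (?u i))\<^sup>2))"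
        unfolding sum.distrib Re_sum sum_distrib_left r_def ..
      finally show "0 \<le> 2 * t * Re (\<Sum>i\<in>I. cnj (r i) * ?u i) + t\<^sup>2 * (\<Sum>i\<in>I. (cmod (?u i))\<^sup>2)" by linarith
    qed
    also have "(\<Sum>i\<in>I. cnj (r i) * ?u i) = \<omega> y - \<omega>0 y"
      unfolding ev[OF \<omega>] ev[OF \<omega>0] by (simp add: sum_subtractf[symmetric] algebra_simps)
    finally show ?thesis by simp
  qed
  have lower: "\<rho> * S \<le> norm y"
    using ell1_lowerD[OF l subset_refl I, of "\<lambda>i. cnj (r i)"] by (simp add: S_def y_def)
  have "Re (\<omega>0 y) \<le> - \<kappa> * norm y"
  proof (cases "y = 0")
    case True
    then show ?thesis using clinear_on_zero[OF dual_ball_clinear[OF \<omega>0]] by simp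
  next
    case False
    then obtain z where z: "z \<in> dual_ball" "\<kappa> * norm y \<le> cmod (z y)" using nrm by (auto simp: norming_def)
    \<comment> \<open>Rotating \<open>z\<close> makes its value at \<open>y\<close> equal to \<open>- \<bar>z y\<bar>\<close>.\<close>
    define u where "u = - cnj (sgn (z y))"
    have "cmod u \<le> 1" by (simp add: u_def norm_sgn)
    then have "Re (\<omega>0 y) \<le> Re (u * z y)" using opt[OF dual_ball_rotate[OF z(1)]] by simp
    also have "u * z y = - of_real (cmod (z y))"
    proof (cases "z y = 0")
      case False
      have "cnj (z y) * z y = of_real ((cmod (z y))\<^sup>2)" by (metis complex_norm_square mult.commute)
      then show ?thesis using False by (simp add: u_def sgn_eq power2_eq_square)
    qed (simp add: u_def)
    finally show ?thesis using z(2) by simp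
  qed
  also have "\<dots> \<le> - (\<kappa> * (\<rho> * S))" using mult_left_mono[OF lower, of \<kappa>] \<kappa> by simp
  finally have upper: "Re (\<omega>0 y) \<le> - (\<kappa> * (\<rho> * S))" .
  have "(\<Sum>i\<in>I. (cmod (r i))\<^sup>2) - \<kappa> * (\<rho> * S) = (\<Sum>i\<in>I. (cmod (r i))\<^sup>2 - cmod (r i) * (\<kappa> * \<rho>))"
    by (simp add: sum_subtractf S_def sum_distrib_right sum_distrib_left algebra_simps)
  also have "\<dots> \<le> (\<Sum>i\<in>I. Re (cnj (r i) * \<omega>0 (v i)))"
  proof (rule sum_mono)
    fix i assume i: "i \<in> I"
    have "cnj (r i) * r i = of_real ((cmod (r i))\<^sup>2)" by (metis complex_norm_square mult.commute)
    moreover have "cnj (r i) * \<omega>0 (v i) = cnj (r i) * r i + cnj (r i) * \<theta> i" by (simp add: r_def algebra_simps)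
    ultimately have "Re (cnj (r i) * \<omega>0 (v i)) = (cmod (r i))\<^sup>2 + Re (cnj (r i) * \<theta> i)" by simp
    moreover have "cmod (cnj (r i) * \<theta> i) \<le> cmod (r i) * (\<kappa> * \<rho>)"
      using mult_left_mono[OF \<theta>[OF i], of "cmod (r i)"] by (simp add: norm_mult)
    then have "- (cmod (r i) * (\<kappa> * \<rho>)) \<le> Re (cnj (r i) * \<theta> i)"
      using abs_Re_le_cmod[of "cnj (r i) * \<theta> i"] by linarith
    ultimately show "(cmod (r i))\<^sup>2 - cmod (r i) * (\<kappa> * \<rho>) \<le> Re (cnj (r i) * \<omega>0 (v i))" by linarith
  qed
  also have "\<dots> = Re (\<omega>0 y)" unfolding ev[OF \<omega>0] Re_sum ..
  finally have "(\<Sum>i\<in>I. (cmod (r i))\<^sup>2) \<le> 0" using upper by linarith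
  then have "(\<Sum>i\<in>I. (cmod (r i))\<^sup>2) = 0" by (intro antisym sum_nonneg) auto
  then have "\<forall>i\<in>I. \<omega>0 (v i) = \<theta> i" using I by (simp add: sum_nonneg_eq_0_iff r_def)
  with \<omega>0 show ?thesis by (rule that)
qed

text \<open>At each time in \<open>I\<close> one of \<open>m\<close> values, spaced by \<open>\<kappa> \<rho> / m = 2 \<eta>\<close>, can be prescribed.  Different prescriptions need
  different names in a cover by sets of oscillation below \<open>2 \<eta>\<close>, so there are at least \<open>m ^ card I\<close> names.\<close>

theorem many_ell1_imp_infinite_entropy:
  fixes \<alpha> :: "'a::complex_banach \<Rightarrow> 'a"
  assumes iso: "isometric_automorphism \<alpha>" and nrm: "norming \<kappa> (dual_ball :: ('a \<Rightarrow> complex) set)"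
    and many: "many_ell1 \<alpha> x"
  shows "htop (top_of_set dual_ball) (dual_map \<alpha>) = \<infinity>"
proof (rule ereal_top)
  fix B :: real
  let ?T = "dual_map \<alpha>" and ?D = "dual_ball :: ('a \<Rightarrow> complex) set"
  interpret dual_system \<alpha> ?D by (rule dual_system_dual_ball[OF iso])
  obtain \<rho> d where \<rho>: "0 < \<rho>" and d: "0 < d" and freq: "\<exists>\<^sub>F n in sequentially. 0 < n \<and> (\<exists>I\<subseteq>{..<n}. I \<noteq> {} \<and>
     d * real n \<le> real (card I) \<and> ell1_lower \<rho> I (\<lambda>i. (\<alpha> ^^ i) x))"
    by (rule many_ell1E[OF many])
  have \<kappa>: "0 < \<kappa>" using nrm by (simp add: norming_def)
  obtain m :: nat where m0: "exp (B / d) < real m" using reals_Archimedean2 by blast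
  have "0 < exp (B / d)" by simp
  then have m: "0 < real m" using m0 by linarith
  have "ln (exp (B / d)) < ln (real m)" using m m0 by (subst ln_less_cancel_iff) auto
  then have lnm: "B \<le> ln (real m) * d" using d by (simp add: field_simps)
  define \<eta> where "\<eta> = \<kappa> * \<rho> / (2 * real m)"
  have \<eta>: "0 < \<eta>" using \<kappa> \<rho> m by (simp add: \<eta>_def)
  have fx: "finite {x}" by simp
  obtain P where P: "finite P" "P \<subseteq> ?D" "\<forall>z\<in>?D. \<exists>p\<in>P. z \<in> nbhd ?D {x} \<eta> p" and \<W>: "finite_open_cover (top_of_set ?D) (nbhd ?D {x} \<eta> ` P)"
    by (rule finite_nbhd_cover[OF K_compact fx \<eta>])
  let ?N = "\<lambda>n. cover_number (top_of_set ?D) ?T (nbhd ?D {x} \<eta> ` P) n"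
  have "\<exists>\<^sub>F n in sequentially. exp (ln (real m) * d * real n) \<le> 1 * real (?N n)"
    using freq
  proof (rule frequently_elim1)
    fix n assume "0 < n \<and> (\<exists>I\<subseteq>{..<n}. I \<noteq> {} \<and> d * real n \<le> real (card I) \<and> ell1_lower \<rho> I (\<lambda>i. (\<alpha> ^^ i) x))"
    then obtain I where I: "I \<subseteq> {..<n}" "I \<noteq> {}" "d * real n \<le> real (card I)" "ell1_lower \<rho> I (\<lambda>i. (\<alpha> ^^ i) x)" by blast
    have finI: "finite I" using I(1) by (rule finite_subset) simp
    obtain A where A: "finite A" "card A \<le> ?N n"
      "\<And>s i. s \<in> A \<Longrightarrow> i < n \<Longrightarrow> s i \<in> nbhd ?D {x} \<eta> ` P"
      "\<And>z. z \<in> topspace (top_of_set ?D) \<Longrightarrow> \<exists>s\<in>A. \<forall>i<n. (?T ^^ i) z \<in> s i"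
      using cover_number_witness[OF \<W> K_inv_top, of n] by blast
    let ?G = "PiE I (\<lambda>_. {..<m})"
    let ?t = "\<lambda>j. complex_of_real (\<kappa> * \<rho> * (real j / real m))"
    have "\<exists>s. s \<in> A \<and> (\<exists>\<omega>. (\<forall>i\<in>I. \<omega> ((\<alpha> ^^ i) x) = ?t (g i)) \<and> (\<forall>i<n. (?T ^^ i) \<omega> \<in> s i))" if g: "g \<in> ?G" for g
    proof -
      have tb: "cmod (?t (g i)) \<le> \<kappa> * \<rho>" if "i \<in> I" for i
      proof -
        have "g i < m" using g that by (auto simp: PiE_iff)
        then have "real (g i) / real m \<le> 1" using m by simp
        then have "\<kappa> * \<rho> * (real (g i) / real m) \<le> \<kappa> * \<rho> * 1" using \<kappa> \<rho> by (intro mult_left_mono) auto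
        moreover have "0 \<le> \<kappa> * \<rho> * (real (g i) / real m)" using \<kappa> \<rho> by simp
        ultimately show ?thesis unfolding norm_of_real by simp
      qed
      obtain \<omega> where \<omega>: "\<omega> \<in> ?D" "\<forall>i\<in>I. \<omega> ((\<alpha> ^^ i) x) = ?t (g i)"
        using ell1_interpolation[where \<theta> = "\<lambda>i. ?t (g i)", OF nrm \<rho> I(4) finI tb] by blast
      obtain s where "s \<in> A" "\<forall>i<n. (?T ^^ i) \<omega> \<in> s i" using A(4)[of \<omega>] \<omega>(1) by auto
      then show ?thesis using \<omega>(2) by (intro exI[of _ s] conjI exI[of _ \<omega>])
    qed
    then have "\<forall>g\<in>?G. \<exists>s. s \<in> A \<and> (\<exists>\<omega>. (\<forall>i\<in>I. \<omega> ((\<alpha> ^^ i) x) = ?t (g i)) \<and> (\<forall>i<n. (?T ^^ i) \<omega> \<in> s i))" ..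
    from bchoice[OF this] obtain \<sigma> where \<sigma>: "\<forall>g\<in>?G. \<sigma> g \<in> A \<and> (\<exists>\<omega>. (\<forall>i\<in>I. \<omega> ((\<alpha> ^^ i) x) = ?t (g i)) \<and> (\<forall>i<n. (?T ^^ i) \<omega> \<in> \<sigma> g i))" ..
    have "inj_on \<sigma> ?G"
    proof (rule inj_onI)
      fix g h assume gh: "g \<in> ?G" "h \<in> ?G" "\<sigma> g = \<sigma> h"
      obtain \<omega> where \<omega>: "\<forall>i\<in>I. \<omega> ((\<alpha> ^^ i) x) = ?t (g i)" "\<forall>i<n. (?T ^^ i) \<omega> \<in> \<sigma> g i"
        using bspec[OF \<sigma> gh(1)] by (elim conjE exE)
      obtain \<omega>' where \<omega>': "\<forall>i\<in>I. \<omega>' ((\<alpha> ^^ i) x) = ?t (h i)" "\<forall>i<n. (?T ^^ i) \<omega>' \<in> \<sigma> h i"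
        using bspec[OF \<sigma> gh(2)] by (elim conjE exE)
      show "g = h"
      proof (rule PiE_ext[OF gh(1,2)])
        fix i assume i: "i \<in> I"
        then have "i < n" using I(1) by auto
        have "\<sigma> g \<in> A" using \<sigma> gh(1) by blast
        then obtain p where p: "\<sigma> g i = nbhd ?D {x} \<eta> p" using A(3)[of "\<sigma> g" i] \<open>i < n\<close> by blast
        have "(?T ^^ i) \<omega> \<in> nbhd ?D {x} \<eta> p" "(?T ^^ i) \<omega>' \<in> nbhd ?D {x} \<eta> p"
          using \<omega>(2) \<omega>'(2) \<open>i < n\<close> gh(3) p by auto
        then have "cmod (?t (g i) - p x) < \<eta>" "cmod (?t (h i) - p x) < \<eta>"
          using \<omega>(1) \<omega>'(1) i by (auto simp: nbhd_def dual_map_funpow)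
        then have "cmod (?t (g i) - ?t (h i)) < 2 * \<eta>"
          using norm_triangle_ineq4[of "?t (g i) - p x" "?t (h i) - p x"] by simp
        moreover have "?t (g i) - ?t (h i) = of_real (2 * \<eta> * (real (g i) - real (h i)))"
          using m unfolding of_real_diff[symmetric] of_real_eq_iff by (simp add: \<eta>_def field_simps)
        ultimately have "2 * \<eta> * \<bar>real (g i) - real (h i)\<bar> < 2 * \<eta> * 1"
          using \<eta> by (simp add: abs_mult del: of_real_mult)
        then have "\<bar>real (g i) - real (h i)\<bar> < 1" using \<eta> by (simp only: mult_less_cancel_left_pos)
        then show "g i = h i" by linarith
      qed
    qed
    moreover have "\<sigma> ` ?G \<subseteq> A" using \<sigma> by blast
    ultimately have "card ?G \<le> card A" using A(1) by (intro card_inj_on_le)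
    then have "real m ^ card I \<le> real (?N n)"
      using A(2) finI by (simp add: card_PiE of_nat_power[symmetric] del: of_nat_power)
    moreover have "exp (ln (real m) * d * real n) \<le> real m ^ card I"
    proof -
      have "1 \<le> real m" using m by simp
      then have "ln (real m) * (d * real n) \<le> ln (real m) * real (card I)" using I(3) by (intro mult_left_mono) auto
      then have "exp (ln (real m) * d * real n) \<le> exp (real (card I) * ln (real m))" by (simp add: mult_ac)
      also have "\<dots> = real m ^ card I" using m by (simp add: exp_of_nat_mult)
      finally show ?thesis .
    qed
    ultimately show "exp (ln (real m) * d * real n) \<le> 1 * real (?N n)" by linarith
  qed
  then have "ereal (ln (real m) * d) \<le> htop (top_of_set ?D) ?T" by (rule htop_ge[OF \<W> K_inv_top]) simp
  then show "ereal B \<le> htop (top_of_set ?D) ?T" using lnm by (meson ereal_less_eq(3) order_trans)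
qed

section \<open>CA entropy\<close>

lemma sup_norm_le:
  assumes "\<And>k. k \<in> K \<Longrightarrow> cmod (f k) \<le> c" "0 \<le> c"
  shows "sup_norm K f \<le> c"
  unfolding sup_norm_def by (rule cSup_least) (use assms in auto)

lemma sup_norm_upper:
  assumes "bdd_above ((\<lambda>k. cmod (f k)) ` K)" "k \<in> K"
  shows "cmod (f k) \<le> sup_norm K f"
  unfolding sup_norm_def by (rule cSup_upper) (use assms in \<open>auto simp: bdd_above_insert\<close>)

lemma sup_norm_upper_finite: "finite K \<Longrightarrow> k \<in> K \<Longrightarrow> cmod (f k) \<le> sup_norm K f"
  by (rule sup_norm_upper) auto

lemma sup_norm_upper_continuous:
  assumes "compact K" "continuous_on K f" "k \<in> K"
  shows "cmod (f k) \<le> sup_norm K f"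
proof (rule sup_norm_upper[OF _ assms(3)])
  have "compact ((\<lambda>k. cmod (f k)) ` K)"
    using assms(1,2) by (intro compact_continuous_image continuous_intros)
  then show "bdd_above ((\<lambda>k. cmod (f k)) ` K)"
    by (intro bounded_imp_bdd_above compact_imp_bounded)
qed

lemma continuous_on_eval_on: "continuous_on Z (eval_on Z x)"
  by (rule continuous_on_eq[OF continuous_on_coordinate[of Z x]]) (simp add: eval_on_def)

lemma sum_fun_apply: "(\<Sum>i\<in>I. f i) z = (\<Sum>i\<in>I. f i z)" for f :: "'i \<Rightarrow> 'b \<Rightarrow> 'c::comm_monoid_add"
  by (induction I rule: infinite_finite_induct) auto

abbreviation CA_dual :: "'a::complex_banach set \<Rightarrow> real \<Rightarrow> (('a \<Rightarrow> nat \<Rightarrow> complex) \<times>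
    ((nat \<Rightarrow> complex) \<Rightarrow> ('a \<Rightarrow> complex) \<Rightarrow> complex) \<times> nat) set" where
  "CA_dual \<equiv> CA (C_space dual_ball) (sup_norm dual_ball) (eval_on dual_ball)"

text \<open>Evaluation at the points \<open>w j\<close>, followed by averaging with the partition of unity \<open>h j / \<Sum>\<^sub>j h j\<close>, nearly
  reproduces the evaluation map.\<close>

lemma partition_imp_CA:
  fixes h :: "nat \<Rightarrow> ('a::complex_banach \<Rightarrow> complex) \<Rightarrow> real" and w :: "nat \<Rightarrow> 'a \<Rightarrow> complex"
  assumes D: "0 < D" and cont: "\<And>j. j < D \<Longrightarrow> continuous_on dual_ball (h j)"
    and nn: "\<And>j \<omega>. j < D \<Longrightarrow> 0 \<le> h j \<omega>" and w: "\<And>j. j < D \<Longrightarrow> w j \<in> dual_ball"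
    and pos: "\<And>\<omega>. \<omega> \<in> dual_ball \<Longrightarrow> 0 < (\<Sum>j<D. h j \<omega>)"
    and close: "\<And>x j \<omega>. x \<in> \<Xi> \<Longrightarrow> j < D \<Longrightarrow> \<omega> \<in> dual_ball \<Longrightarrow> 0 < h j \<omega> \<Longrightarrow> cmod (w j x - \<omega> x) \<le> \<eta>"
    and \<eta>: "0 \<le> \<eta>" "\<eta> < \<delta>"
  shows "\<exists>\<phi> \<psi>. (\<phi>, \<psi>, D) \<in> CA_dual \<Xi> \<delta>"
proof -
  define H where "H = (\<lambda>\<omega>. \<Sum>j<D. h j \<omega>)"
  define l where "l = (\<lambda>j \<omega>. h j \<omega> / H \<omega>)"
  define \<phi> :: "'a \<Rightarrow> nat \<Rightarrow> complex" where "\<phi> = (\<lambda>x j. if j < D then w j x else 0)"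
  define \<psi> :: "(nat \<Rightarrow> complex) \<Rightarrow> ('a \<Rightarrow> complex) \<Rightarrow> complex"
    where "\<psi> = (\<lambda>v \<omega>. if \<omega> \<in> dual_ball then \<Sum>j<D. of_real (l j \<omega>) * v j else 0)"
  have H: "0 < H \<omega>" if "\<omega> \<in> dual_ball" for \<omega> using pos[OF that] by (simp add: H_def)
  have l0: "0 \<le> l j \<omega>" if "\<omega> \<in> dual_ball" "j < D" for j \<omega>
    using nn[OF that(2), of \<omega>] H[OF that(1)] by (simp add: l_def)
  have l1: "(\<Sum>j<D. l j \<omega>) = 1" if "\<omega> \<in> dual_ball" for \<omega>
    using H[OF that] by (simp add: l_def sum_divide_distrib[symmetric] H_def)
  have average: "cmod (\<Sum>j<D. of_real (l j \<omega>) * u j) \<le> M"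
    if \<omega>: "\<omega> \<in> dual_ball" and u: "\<And>j. j < D \<Longrightarrow> 0 < l j \<omega> \<Longrightarrow> cmod (u j) \<le> M" for \<omega> u M
  proof -
    have "cmod (\<Sum>j<D. of_real (l j \<omega>) * u j) \<le> (\<Sum>j<D. l j \<omega> * M)"
    proof (rule sum_norm_le)
      fix j assume "j \<in> {..<D}"
      then have j: "j < D" by simp
      show "cmod (of_real (l j \<omega>) * u j) \<le> l j \<omega> * M"
      proof (cases "l j \<omega> = 0")
        case False
        then have "0 < l j \<omega>" using l0[OF \<omega> j] by simp
        then show ?thesis using u[OF j] by (simp add: norm_mult)
      qed simp
    qed
    also have "\<dots> = M" by (simp add: sum_distrib_right[symmetric] l1[OF \<omega>])
    finally show ?thesis .
  qed
  have "contraction_on UNIV norm (ell_inf D) (sup_norm {..<D}) \<phi>"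
    unfolding contraction_on_def
  proof (intro conjI ballI)
    show "clinear_on UNIV \<phi>"
      using dual_ball_clinear[OF w] unfolding clinear_on_def \<phi>_def by (auto simp: fun_eq_iff scaleC_fun_def scaleC_complex_def)
    show "\<phi> ` UNIV \<subseteq> ell_inf D" by (auto simp: \<phi>_def ell_inf_def)
    show "sup_norm {..<D} (\<phi> x) \<le> norm x" for x
      by (rule sup_norm_le) (use dual_ball_norm[OF w] in \<open>auto simp: \<phi>_def\<close>)
  qed
  moreover have "contraction_on (ell_inf D) (sup_norm {..<D}) (C_space dual_ball) (sup_norm dual_ball) \<psi>"
    unfolding contraction_on_def
  proof (intro conjI ballI)
    show "clinear_on (ell_inf D) \<psi>"
      unfolding clinear_on_def \<psi>_def
      by (auto simp: fun_eq_iff scaleC_fun_def scaleC_complex_def sum.distrib[symmetric] sum_distrib_left algebra_simps)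
    show "\<psi> ` ell_inf D \<subseteq> C_space dual_ball"
    proof (rule image_subsetI)
      fix v
      have cH: "continuous_on dual_ball H" unfolding H_def using cont by (intro continuous_on_sum) auto
      have "continuous_on dual_ball (\<lambda>\<omega>. \<Sum>j<D. complex_of_real (l j \<omega>) * v j)"
        unfolding l_def
      proof (intro continuous_intros)
        fix j assume "j \<in> {..<D}" then show "continuous_on dual_ball (h j)" using cont by simp
      next
        show "\<forall>\<omega>\<in>dual_ball. H \<omega> \<noteq> 0" using H by force
      qed (rule cH)
      then have "continuous_on dual_ball (\<psi> v)"
        by (rule continuous_on_eq) (simp add: \<psi>_def)
      then show "\<psi> v \<in> C_space dual_ball" by (simp add: C_space_def \<psi>_def)
    qed
    fix v :: "nat \<Rightarrow> complex"
    have "0 \<le> cmod (v 0)" by simp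
    also have "\<dots> \<le> sup_norm {..<D} v" by (rule sup_norm_upper_finite) (use D in auto)
    finally have s0: "0 \<le> sup_norm {..<D} v" .
    show "sup_norm dual_ball (\<psi> v) \<le> sup_norm {..<D} v"
    proof (rule sup_norm_le[OF _ s0])
      fix \<omega> :: "'a \<Rightarrow> complex" assume \<omega>: "\<omega> \<in> dual_ball"
      then show "cmod (\<psi> v \<omega>) \<le> sup_norm {..<D} v"
        unfolding \<psi>_def by (simp add: average sup_norm_upper_finite)
    qed
  qed
  moreover have "sup_norm dual_ball (\<psi> (\<phi> x) - eval_on dual_ball x) < \<delta>" if x: "x \<in> \<Xi>" for x
  proof -
    have "sup_norm dual_ball (\<psi> (\<phi> x) - eval_on dual_ball x) \<le> \<eta>"
    proof (rule sup_norm_le[OF _ \<eta>(1)])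
      fix \<omega> :: "'a \<Rightarrow> complex" assume \<omega>: "\<omega> \<in> dual_ball"
      have "(\<psi> (\<phi> x) - eval_on dual_ball x) \<omega> = (\<Sum>j<D. of_real (l j \<omega>) * w j x) - of_real (\<Sum>j<D. l j \<omega>) * \<omega> x"
        using \<omega> l1[OF \<omega>] by (simp add: \<psi>_def \<phi>_def eval_on_def)
      also have "\<dots> = (\<Sum>j<D. of_real (l j \<omega>) * (w j x - \<omega> x))"
        by (simp only: of_real_sum sum_distrib_right sum_subtractf[symmetric] right_diff_distrib)
      also have "cmod \<dots> \<le> \<eta>"
      proof (rule average[OF \<omega>])
        fix j assume j: "j < D" "0 < l j \<omega>"
        then have "0 < h j \<omega>" using H[OF \<omega>] by (simp add: l_def zero_less_divide_iff)
        then show "cmod (w j x - \<omega> x) \<le> \<eta>" by (rule close[OF x j(1) \<omega>])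
      qed
      finally show "cmod ((\<psi> (\<phi> x) - eval_on dual_ball x) \<omega>) \<le> \<eta>" .
    qed
    then show ?thesis using \<eta>(2) by simp
  qed
  ultimately have "(\<phi>, \<psi>, D) \<in> CA_dual \<Xi> \<delta>" using D by (simp add: CA_def)
  then show ?thesis by blast
qed

text \<open>The members of a name are neighbourhoods \<open>{\<omega>. \<bar>\<omega> y - p y\<bar> < \<epsilon>}\<close>, so products of the functions
  \<open>max 0 (\<epsilon> - \<bar>\<omega> (\<alpha>\<^sup>i y) - p y\<bar>)\<close> are positive exactly on the open sets of the subcover.  This partition of unity has as many
  members as the subcover.\<close>

lemma CA_from_cover:
  fixes \<alpha> :: "'a::complex_banach \<Rightarrow> 'a"
  assumes iso: "isometric_automorphism \<alpha>" and \<Omega>: "finite \<Omega>" and \<delta>: "0 < \<delta>"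
  shows "\<exists>\<W>. finite_open_cover (top_of_set dual_ball) \<W> \<and> (\<forall>n. \<exists>D \<phi> \<psi>.
     (\<phi>, \<psi>, D) \<in> CA_dual (\<Union>i<n. (\<alpha> ^^ i) ` \<Omega>) \<delta> \<and>
     D \<le> cover_number (top_of_set dual_ball) (dual_map \<alpha>) \<W> n)"
proof -
  let ?T = "dual_map \<alpha>" and ?D = "dual_ball :: ('a \<Rightarrow> complex) set"
  interpret dual_system \<alpha> ?D by (rule dual_system_dual_ball[OF iso])
  define \<epsilon> where "\<epsilon> = \<delta> / 4"
  have \<epsilon>: "0 < \<epsilon>" using \<delta> by (simp add: \<epsilon>_def)
  obtain P where P: "finite P" "P \<subseteq> ?D" "\<forall>z\<in>?D. \<exists>p\<in>P. z \<in> nbhd ?D \<Omega> \<epsilon> p"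
    and \<W>: "finite_open_cover (top_of_set ?D) (nbhd ?D \<Omega> \<epsilon> ` P)"
    by (rule finite_nbhd_cover[OF K_compact \<Omega> \<epsilon>])
  have "\<exists>D \<phi> \<psi>. (\<phi>, \<psi>, D) \<in> CA_dual (\<Union>i<n. (\<alpha> ^^ i) ` \<Omega>) \<delta> \<and>
     D \<le> cover_number (top_of_set ?D) ?T (nbhd ?D \<Omega> \<epsilon> ` P) n" for n
  proof -
    obtain A where A: "finite A" "card A \<le> cover_number (top_of_set ?D) ?T (nbhd ?D \<Omega> \<epsilon> ` P) n"
      "\<And>s i. s \<in> A \<Longrightarrow> i < n \<Longrightarrow> s i \<in> nbhd ?D \<Omega> \<epsilon> ` P"
      "\<And>z. z \<in> topspace (top_of_set ?D) \<Longrightarrow> \<exists>s\<in>A. \<forall>i<n. (?T ^^ i) z \<in> s i"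
      using cover_number_witness[OF \<W> K_inv_top, of n] by blast
    have "A \<noteq> {}" using A(4)[of "\<lambda>_. 0"] zero_in_dual_ball by auto
    then have cardA: "0 < card A" using A(1) by (simp add: card_gt_0_iff)
    obtain e where e: "bij_betw e {..<card A} A"
      using ex_bij_betw_nat_finite[OF A(1)] by (auto simp: atLeast0LessThan)
    have "\<forall>U\<in>nbhd ?D \<Omega> \<epsilon> ` P. \<exists>p. U = nbhd ?D \<Omega> \<epsilon> p" by blast
    from bchoice[OF this] obtain c where c: "\<forall>U\<in>nbhd ?D \<Omega> \<epsilon> ` P. U = nbhd ?D \<Omega> \<epsilon> (c U)" ..
    define p where "p = (\<lambda>j i. c (e j i))"
    have ejA: "e j \<in> A" if "j < card A" for j using e that by (auto simp: bij_betw_def)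
    have ep: "e j i = nbhd ?D \<Omega> \<epsilon> (p j i)" if "j < card A" "i < n" for j i
      unfolding p_def by (rule bspec[OF c A(3)[OF ejA[OF that(1)] that(2)]])
    define h where "h = (\<lambda>j \<omega>. \<Prod>i<n. \<Prod>y\<in>\<Omega>. max 0 (\<epsilon> - cmod (\<omega> ((\<alpha> ^^ i) y) - p j i y)))"
    have h_nn: "0 \<le> h j \<omega>" for j \<omega> unfolding h_def by (intro prod_nonneg) auto
    have h_pos: "0 < h j \<omega>" if "\<And>i y. i < n \<Longrightarrow> y \<in> \<Omega> \<Longrightarrow> cmod (\<omega> ((\<alpha> ^^ i) y) - p j i y) < \<epsilon>" for j \<omega>
      unfolding h_def using that by (intro prod_pos ballI) auto
    have h_posD: "cmod (\<omega> ((\<alpha> ^^ i) y) - p j i y) < \<epsilon>" if "0 < h j \<omega>" "i < n" "y \<in> \<Omega>" for j \<omega> i y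
    proof (rule ccontr)
      assume "\<not> ?thesis"
      then have "max 0 (\<epsilon> - cmod (\<omega> ((\<alpha> ^^ i) y) - p j i y)) = 0" by simp
      then have "(\<Prod>y\<in>\<Omega>. max 0 (\<epsilon> - cmod (\<omega> ((\<alpha> ^^ i) y) - p j i y))) = 0"
        using \<Omega> that(3) by (intro prod_zero) auto
      then have "h j \<omega> = 0" unfolding h_def using that(2) by (intro prod_zero) auto
      then show False using that(1) by simp
    qed
    \<comment> \<open>The zero functional is a placeholder in case \<open>h j\<close> vanishes on the ball.\<close>
    define w where "w = (\<lambda>j. if \<exists>\<omega>\<in>?D. 0 < h j \<omega> then SOME \<omega>. \<omega> \<in> ?D \<and> 0 < h j \<omega> else (\<lambda>_. 0))"
    have w: "w j \<in> ?D \<and> ((\<exists>\<omega>\<in>?D. 0 < h j \<omega>) \<longrightarrow> 0 < h j (w j))" for j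
    proof (cases "\<exists>\<omega>\<in>?D. 0 < h j \<omega>")
      case True
      then have "\<exists>\<omega>. \<omega> \<in> ?D \<and> 0 < h j \<omega>" by blast
      from someI_ex[OF this] show ?thesis using True by (simp add: w_def)
    next
      case False
      then have "w j = (\<lambda>_. 0)" unfolding w_def by (rule if_not_P)
      then show ?thesis using False zero_in_dual_ball by simp
    qed
    have "\<exists>\<phi> \<psi>. (\<phi>, \<psi>, card A) \<in> CA_dual (\<Union>i<n. (\<alpha> ^^ i) ` \<Omega>) \<delta>"
    proof (rule partition_imp_CA[OF cardA, where h = h and w = w and \<eta> = "2 * \<epsilon>"])
      show "continuous_on ?D (h j)" for j unfolding h_def by (intro continuous_intros)
      show "0 < (\<Sum>j<card A. h j \<omega>)" if \<omega>: "\<omega> \<in> ?D" for \<omega>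
      proof -
        obtain s where s: "s \<in> A" "\<forall>i<n. (?T ^^ i) \<omega> \<in> s i" using A(4)[of \<omega>] \<omega> by auto
        have "s \<in> e ` {..<card A}" using e s(1) by (simp add: bij_betw_def)
        then obtain j where j: "j < card A" "e j = s" by auto
        have "0 < h j \<omega>"
        proof (rule h_pos)
          fix i y assume "i < n" "y \<in> \<Omega>"
          then show "cmod (\<omega> ((\<alpha> ^^ i) y) - p j i y) < \<epsilon>"
            using s(2) ep[OF j(1)] j(2) by (auto simp: nbhd_def dual_map_funpow)
        qed
        also have "h j \<omega> \<le> (\<Sum>j<card A. h j \<omega>)" using j h_nn by (intro member_le_sum) auto
        finally show ?thesis .
      qed
      show "cmod (w j x - \<omega> x) \<le> 2 * \<epsilon>" if x: "x \<in> (\<Union>i<n. (\<alpha> ^^ i) ` \<Omega>)" and \<omega>: "\<omega> \<in> ?D" "0 < h j \<omega>" for x j \<omega>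
      proof -
        obtain i y where iy: "i < n" "y \<in> \<Omega>" "x = (\<alpha> ^^ i) y" using x by auto
        have "0 < h j (w j)" using w[of j] \<omega> by blast
        then have "cmod (w j x - p j i y) < \<epsilon>" unfolding iy(3) by (rule h_posD[OF _ iy(1,2)])
        moreover have "cmod (\<omega> x - p j i y) < \<epsilon>" unfolding iy(3) by (rule h_posD[OF \<omega>(2) iy(1,2)])
        ultimately show ?thesis using norm_triangle_ineq4[of "w j x - p j i y" "\<omega> x - p j i y"] by simp
      qed
    qed (use h_nn w \<epsilon> \<delta> in \<open>auto simp: \<epsilon>_def\<close>)
    then show ?thesis using A(2) by blast
  qed
  then show ?thesis using \<W> by blast
qed

lemma rc_attained:
  assumes "(\<phi>, \<psi>, D) \<in> CA_dual \<Xi> \<delta>"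
  shows "\<exists>\<phi> \<psi>. (\<phi>, \<psi>, rc \<Xi> \<delta>) \<in> CA_dual \<Xi> \<delta>" "rc \<Xi> \<delta> \<le> D" "0 < rc \<Xi> \<delta>"
proof -
  let ?S = "{d. \<exists>\<phi> \<psi>. (\<phi>, \<psi>, d) \<in> CA_dual \<Xi> \<delta>}"
  have D: "D \<in> ?S" using assms by blast
  have "?S \<noteq> {}" using D by blast
  then have "Inf ?S \<in> ?S" by (rule Inf_nat_def1)
  then show *: "\<exists>\<phi> \<psi>. (\<phi>, \<psi>, rc \<Xi> \<delta>) \<in> CA_dual \<Xi> \<delta>" unfolding rc_def by simp
  show "rc \<Xi> \<delta> \<le> D" unfolding rc_def by (rule cInf_lower[OF D]) simp
  show "0 < rc \<Xi> \<delta>" using * by (auto simp: CA_def)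
qed

theorem hc_pos_imp_htop_pos:
  fixes \<alpha> :: "'a::complex_banach \<Rightarrow> 'a"
  assumes iso: "isometric_automorphism \<alpha>" and pos: "0 < hc \<alpha>"
  shows "0 < htop (top_of_set dual_ball) (dual_map \<alpha>)"
proof -
  let ?D = "dual_ball :: ('a \<Rightarrow> complex) set"
  interpret dual_system \<alpha> ?D by (rule dual_system_dual_ball[OF iso])
  obtain \<Omega> \<delta> where \<Omega>: "finite \<Omega>" and \<delta>: "0 < \<delta>" and hc: "0 < hc_at \<alpha> \<Omega> \<delta>"
    using pos unfolding hc_def hc_set_def less_SUP_iff by auto
  obtain \<W> where \<W>: "finite_open_cover (top_of_set ?D) \<W>"
    and CA: "\<forall>n. \<exists>D \<phi> \<psi>. (\<phi>, \<psi>, D) \<in> CA_dual (\<Union>i<n. (\<alpha> ^^ i) ` \<Omega>) \<delta> \<and>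
      D \<le> cover_number (top_of_set ?D) (dual_map \<alpha>) \<W> n"
    using CA_from_cover[OF iso \<Omega> \<delta>] by (elim exE conjE)
  let ?N = "\<lambda>n. cover_number (top_of_set ?D) (dual_map \<alpha>) \<W> n"
  have "hc_at \<alpha> \<Omega> \<delta> \<le> limsup (\<lambda>n. ereal (1 / real n * ln (real (?N n))))"
    unfolding hc_at_def
  proof (rule Limsup_mono, rule always_eventually, rule allI)
    fix n
    obtain D \<phi> \<psi> where D: "(\<phi>, \<psi>, D) \<in> CA_dual (\<Union>i<n. (\<alpha> ^^ i) ` \<Omega>) \<delta>" "D \<le> ?N n"
      using spec[OF CA, of n] by (elim exE conjE)
    have "rc (\<Union>i<n. (\<alpha> ^^ i) ` \<Omega>) \<delta> \<le> ?N n" using rc_attained(2)[OF D(1)] D(2) by (rule order_trans)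
    then have "ln (real (rc (\<Union>i<n. (\<alpha> ^^ i) ` \<Omega>) \<delta>)) \<le> ln (real (?N n))"
      using rc_attained(3)[OF D(1)] by (subst ln_le_cancel_iff) auto
    then show "ereal (1 / real n * ln (real (rc (\<Union>i<n. (\<alpha> ^^ i) ` \<Omega>) \<delta>))) \<le> ereal (1 / real n * ln (real (?N n)))"
      unfolding ereal_less_eq(3) by (rule mult_left_mono) simp
  qed
  also have "\<dots> = ereal (cover_entropy (top_of_set ?D) (dual_map \<alpha>) \<W>)"
    using cover_entropy_limit[OF \<W> K_inv_top] by (intro lim_imp_Limsup) auto
  also have "\<dots> \<le> htop (top_of_set ?D) (dual_map \<alpha>)"
    unfolding htop_def by (rule SUP_upper) (use \<W> in simp)
  finally show ?thesis using hc by (rule less_le_trans[rotated])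
qed

lemma csubspace_ell_inf: "csubspace (ell_inf d)"
  by (auto simp: cvs.subspace_def ell_inf_def scaleC_fun_def scaleC_complex_def)

text \<open>A contractive factorisation through \<open>\<ell>\<^sub>\<infinity>\<^sup>D\<close> with error \<open>\<kappa> \<rho> / 2\<close> keeps signed sums of the \<open>v i\<close> large in \<open>\<ell>\<^sub>\<infinity>\<^sup>D\<close>.  So the
  \<open>D\<close> coordinates serve all sign patterns.\<close>

lemma CA_dual_lower:
  fixes v :: "'i \<Rightarrow> 'a::complex_banach"
  assumes CA: "(\<phi>, \<psi>, D) \<in> CA_dual \<Xi> \<delta>" and nrm: "norming \<kappa> (dual_ball :: ('a \<Rightarrow> complex) set)"
    and \<rho>: "0 < \<rho>" and \<delta>: "\<delta> = \<kappa> * \<rho> / 2"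
    and l: "ell1_lower \<rho> I v" and I: "finite I" "I \<noteq> {}" and v: "\<And>i. i \<in> I \<Longrightarrow> v i \<in> \<Xi>"
    and R: "0 < R" "\<And>i. i \<in> I \<Longrightarrow> norm (v i) \<le> R"
  shows "exp (\<delta>\<^sup>2 / (16 * R\<^sup>2) * real (card I)) \<le> 4 * real D"
proof -
  let ?D = "dual_ball :: ('a \<Rightarrow> complex) set"
  have lin\<phi>: "clinear_on UNIV \<phi>" and \<phi>: "\<And>x. \<phi> x \<in> ell_inf D" "\<And>x. sup_norm {..<D} (\<phi> x) \<le> norm x"
    and lin\<psi>: "clinear_on (ell_inf D) \<psi>"
    and \<psi>: "\<And>u. u \<in> ell_inf D \<Longrightarrow> \<psi> u \<in> C_space ?D" "\<And>u. u \<in> ell_inf D \<Longrightarrow> sup_norm ?D (\<psi> u) \<le> sup_norm {..<D} u"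
    and approx: "\<And>x. x \<in> \<Xi> \<Longrightarrow> sup_norm ?D (\<psi> (\<phi> x) - eval_on ?D x) < \<delta>"
    using CA unfolding CA_def contraction_on_def by auto
  have \<kappa>: "0 < \<kappa>" using nrm by (simp add: norming_def)
  have \<delta>0: "0 < \<delta>" using \<kappa> \<rho> by (simp add: \<delta>)
  have m: "0 < real (card I)" using I by (simp add: card_gt_0_iff)
  have "exp (\<delta>\<^sup>2 / (16 * R\<^sup>2) * real (card I)) \<le> 4 * real (card {..<D})"
  proof (rule signs_need_many_functionals[where y = "\<lambda>j i. \<phi> (v i) j"])
    fix j i assume ji: "j \<in> {..<D}" "i \<in> I"
    have "cmod (\<phi> (v i) j) \<le> sup_norm {..<D} (\<phi> (v i))" using ji(1) by (intro sup_norm_upper_finite) auto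
    then show "cmod (\<phi> (v i) j) \<le> R" using \<phi>(2)[of "v i"] R(2)[OF ji(2)] by linarith
  next
    fix s assume s: "s \<in> PiE I (\<lambda>_. {-1, 1::real})"
    let ?a = "\<lambda>i. complex_of_real (s i)"
    have a1: "cmod (?a i) = 1" if "i \<in> I" for i using s that by (auto simp: PiE_iff)
    obtain z where z: "z \<in> ?D" "\<kappa> * \<rho> * real (card I) \<le> cmod (\<Sum>i\<in>I. ?a i * z (v i))"
      using norming_signs[OF nrm \<rho> l I s] by blast
    define u where "u = (\<Sum>i\<in>I. ?a i *\<^sub>C \<phi> (v i))"
    have u: "u \<in> ell_inf D" "\<psi> u = (\<Sum>i\<in>I. ?a i *\<^sub>C \<psi> (\<phi> (v i)))"
      using clinear_on_subspace_sum[OF csubspace_ell_inf lin\<psi> I(1), of "\<lambda>i. \<phi> (v i)" ?a] \<phi>(1) by (auto simp: u_def)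
    have close: "cmod (z (v i) - \<psi> (\<phi> (v i)) z) \<le> \<delta>" if i: "i \<in> I" for i
    proof -
      have "continuous_on ?D (\<psi> (\<phi> (v i)))" using \<psi>(1)[OF \<phi>(1)] by (simp add: C_space_def)
      then have "continuous_on ?D (\<lambda>\<omega>. \<psi> (\<phi> (v i)) \<omega> - eval_on ?D (v i) \<omega>)"
        by (intro continuous_intros continuous_on_eval_on)
      then have "continuous_on ?D (\<psi> (\<phi> (v i)) - eval_on ?D (v i))" by (simp add: fun_diff_def)
      then have "cmod ((\<psi> (\<phi> (v i)) - eval_on ?D (v i)) z) \<le> sup_norm ?D (\<psi> (\<phi> (v i)) - eval_on ?D (v i))"
        by (rule sup_norm_upper_continuous[OF compact_dual_ball _ z(1)])
      then have "cmod (\<psi> (\<phi> (v i)) z - z (v i)) \<le> \<delta>"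
        using approx[OF v[OF i]] z(1) by (simp add: eval_on_def)
      then show ?thesis by (simp add: norm_minus_commute)
    qed
    have "cmod (\<Sum>i\<in>I. ?a i * (z (v i) - \<psi> (\<phi> (v i)) z)) \<le> (\<Sum>i\<in>I. \<delta>)"
    proof (rule sum_norm_le)
      fix i assume "i \<in> I"
      then show "cmod (?a i * (z (v i) - \<psi> (\<phi> (v i)) z)) \<le> \<delta>" using close a1 by (simp add: norm_mult)
    qed
    moreover have "\<psi> u z = (\<Sum>i\<in>I. ?a i * \<psi> (\<phi> (v i)) z)"
      unfolding u(2) by (simp add: sum_fun_apply scaleC_fun_def scaleC_complex_def)
    then have "(\<Sum>i\<in>I. ?a i * z (v i)) = \<psi> u z + (\<Sum>i\<in>I. ?a i * (z (v i) - \<psi> (\<phi> (v i)) z))"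
      by (simp add: sum.distrib[symmetric] algebra_simps)
    ultimately have "\<kappa> * \<rho> * real (card I) \<le> cmod (\<psi> u z) + real (card I) * \<delta>"
      using z(2) norm_triangle_ineq[of "\<psi> u z" "\<Sum>i\<in>I. ?a i * (z (v i) - \<psi> (\<phi> (v i)) z)"] by simp
    then have big: "\<delta> * real (card I) \<le> cmod (\<psi> u z)" by (simp add: \<delta> algebra_simps)
    have "continuous_on ?D (\<psi> u)" using \<psi>(1)[OF u(1)] by (simp add: C_space_def)
    then have "cmod (\<psi> u z) \<le> sup_norm ?D (\<psi> u)" by (rule sup_norm_upper_continuous[OF compact_dual_ball _ z(1)])
    then have su: "\<delta> * real (card I) \<le> sup_norm {..<D} u" using big \<psi>(2)[OF u(1)] by linarith
    let ?M = "insert 0 ((\<lambda>k. cmod (u k)) ` {..<D})"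
    have "Sup ?M = Max ?M" by (rule cSup_eq_Max) auto
    moreover have "Max ?M \<in> ?M" by (rule Max_in) auto
    ultimately have "sup_norm {..<D} u \<in> ?M" by (simp only: sup_norm_def)
    moreover have "0 < \<delta> * real (card I)" using \<delta>0 m by simp
    then have "sup_norm {..<D} u \<noteq> 0" using su by linarith
    ultimately obtain j where j: "j < D" "sup_norm {..<D} u = cmod (u j)" by auto
    have "u j = (\<Sum>i\<in>I. ?a i * \<phi> (v i) j)"
      unfolding u_def by (simp add: sum_fun_apply scaleC_fun_def scaleC_complex_def)
    then show "\<exists>j\<in>{..<D}. \<delta> * real (card I) \<le> cmod (\<Sum>i\<in>I. ?a i * \<phi> (v i) j)"
      using su j by (intro bexI[of _ j]) simp_all
  qed (use I R \<delta>0 in auto)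
  then show ?thesis by simp
qed

theorem many_ell1_imp_hc_pos:
  fixes \<alpha> :: "'a::complex_banach \<Rightarrow> 'a"
  assumes iso: "isometric_automorphism \<alpha>" and nrm: "norming \<kappa> (dual_ball :: ('a \<Rightarrow> complex) set)"
    and many: "many_ell1 \<alpha> x"
  shows "0 < hc \<alpha>"
proof -
  let ?D = "dual_ball :: ('a \<Rightarrow> complex) set"
  interpret dual_system \<alpha> ?D by (rule dual_system_dual_ball[OF iso])
  obtain \<rho> d where \<rho>: "0 < \<rho>" and d: "0 < d" and freq: "\<exists>\<^sub>F n in sequentially. 0 < n \<and> (\<exists>I\<subseteq>{..<n}. I \<noteq> {} \<and>
     d * real n \<le> real (card I) \<and> ell1_lower \<rho> I (\<lambda>i. (\<alpha> ^^ i) x))"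
    by (rule many_ell1E[OF many])
  have \<kappa>: "0 < \<kappa>" using nrm by (simp add: norming_def)
  define R where "R = norm x + 1"
  have R: "0 < R" by (simp add: R_def add_nonneg_pos)
  define \<delta> where "\<delta> = \<kappa> * \<rho> / 2"
  have \<delta>: "0 < \<delta>" using \<kappa> \<rho> by (simp add: \<delta>_def)
  define c where "c = \<delta>\<^sup>2 / (16 * R\<^sup>2) * d"
  have c: "0 < c" using \<delta> R d by (simp add: c_def)
  let ?rc = "\<lambda>n. rc (\<Union>i<n. (\<alpha> ^^ i) ` {x}) \<delta>"
  have fx: "finite {x}" by simp
  have growth: "\<exists>\<^sub>F n in sequentially. 0 < n \<and> c * real n - ln 4 \<le> ln (real (?rc n))"
    using freq
  proof (rule frequently_elim1)
    fix n assume h: "0 < n \<and> (\<exists>I\<subseteq>{..<n}. I \<noteq> {} \<and> d * real n \<le> real (card I) \<and> ell1_lower \<rho> I (\<lambda>i. (\<alpha> ^^ i) x))"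
    then obtain I where I: "I \<subseteq> {..<n}" "I \<noteq> {}" "d * real n \<le> real (card I)" "ell1_lower \<rho> I (\<lambda>i. (\<alpha> ^^ i) x)" by blast
    have finI: "finite I" using I(1) by (rule finite_subset) simp
    obtain \<W> where CA: "\<forall>n. \<exists>D \<phi> \<psi>. (\<phi>, \<psi>, D) \<in> CA_dual (\<Union>i<n. (\<alpha> ^^ i) ` {x}) \<delta> \<and>
      D \<le> cover_number (top_of_set ?D) (dual_map \<alpha>) \<W> n"
      using CA_from_cover[OF iso fx \<delta>] by (elim exE conjE)
    obtain D \<phi>' \<psi>' where D: "(\<phi>', \<psi>', D) \<in> CA_dual (\<Union>i<n. (\<alpha> ^^ i) ` {x}) \<delta>"
      using spec[OF CA, of n] by (elim exE conjE)
    obtain \<phi> \<psi> where rcCA: "(\<phi>, \<psi>, ?rc n) \<in> CA_dual (\<Union>i<n. (\<alpha> ^^ i) ` {x}) \<delta>"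
      using rc_attained(1)[OF D] by (elim exE)
    have "exp (\<delta>\<^sup>2 / (16 * R\<^sup>2) * real (card I)) \<le> 4 * real (?rc n)"
    proof (rule CA_dual_lower[OF rcCA nrm \<rho> \<delta>_def I(4) finI I(2) _ R])
      show "(\<alpha> ^^ i) x \<in> (\<Union>i<n. (\<alpha> ^^ i) ` {x})" if "i \<in> I" for i using that I(1) by auto
      show "norm ((\<alpha> ^^ i) x) \<le> R" for i by (simp add: funpow_isometry(2) R_def)
    qed
    moreover have "c * real n \<le> \<delta>\<^sup>2 / (16 * R\<^sup>2) * real (card I)"
      using mult_left_mono[OF I(3), of "\<delta>\<^sup>2 / (16 * R\<^sup>2)"] by (simp add: c_def mult.assoc)
    then have "exp (c * real n) \<le> exp (\<delta>\<^sup>2 / (16 * R\<^sup>2) * real (card I))" by simp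
    ultimately have le: "exp (c * real n) \<le> 4 * real (?rc n)" by linarith
    have rc0: "0 < real (?rc n)" using rc_attained(3)[OF D] by simp
    have "c * real n = ln (exp (c * real n))" by simp
    also have "\<dots> \<le> ln (4 * real (?rc n))" using le rc0 by (subst ln_le_cancel_iff) auto
    also have "\<dots> = ln 4 + ln (real (?rc n))" using rc0 by (simp add: ln_mult)
    finally show "0 < n \<and> c * real n - ln 4 \<le> ln (real (?rc n))" using h by simp
  qed
  obtain M :: nat where M: "2 * ln 4 / c < real M" using reals_Archimedean2 by blast
  have "\<exists>\<^sub>F n in sequentially. c / 2 \<le> 1 / real n * ln (real (?rc n))"
    using frequently_eventually_conj[OF growth eventually_ge_at_top[of M]]
  proof (rule frequently_elim1)
    fix n assume h: "M \<le> n \<and> 0 < n \<and> c * real n - ln 4 \<le> ln (real (?rc n))"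
    then have "2 * ln 4 / c < real n" using M by linarith
    then have "2 * ln 4 < c * real n" using c by (simp add: field_simps)
    then have "c / 2 * real n \<le> ln (real (?rc n))" using h by linarith
    then show "c / 2 \<le> 1 / real n * ln (real (?rc n))" using h by (simp add: field_simps)
  qed
  then have freq2: "\<exists>\<^sub>F n in sequentially. ereal (c / 2) \<le> ereal (1 / real n * ln (real (?rc n)))" by simp
  have "ereal (c / 2) \<le> hc_at \<alpha> {x} \<delta>"
  proof (rule ccontr)
    assume "\<not> ?thesis"
    then have "hc_at \<alpha> {x} \<delta> < ereal (c / 2)" by simp
    then have "\<forall>\<^sub>F n in sequentially. ereal (1 / real n * ln (real (?rc n))) < ereal (c / 2)"
      unfolding hc_at_def by (rule Limsup_lessD)
    then have "\<not> (\<exists>\<^sub>F n in sequentially. ereal (c / 2) \<le> ereal (1 / real n * ln (real (?rc n))))"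
      unfolding frequently_def by (simp add: not_le)
    then show False using freq2 by blast
  qed
  also have "\<dots> \<le> hc_set \<alpha> {x}" unfolding hc_set_def by (rule SUP_upper) (use \<delta> in simp)
  also have "\<dots> \<le> hc \<alpha>" unfolding hc_def by (rule SUP_upper) simp
  finally have "ereal (c / 2) \<le> hc \<alpha>" .
  moreover have "0 < ereal (c / 2)" using c by simp
  ultimately show ?thesis by (rule less_le_trans[rotated])
qed

section \<open>Equivalence with the standard basis of \<open>\<ell>\<^sub>1\<close>\<close>

lemma bounded_linear_scaleC: "bounded_linear (\<lambda>y :: 'a::complex_banach. c *\<^sub>C y)"
proof (rule bounded_linear_intro)
  show "c *\<^sub>C (x + y) = c *\<^sub>C x + c *\<^sub>C y" for x y :: 'a by (rule scaleC_add_right)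
  show "c *\<^sub>C (r *\<^sub>R x) = r *\<^sub>R (c *\<^sub>C x)" for r and x :: 'a
    by (simp add: scaleR_scaleC scaleC_scaleC mult.commute)
  show "norm (c *\<^sub>C x) \<le> norm x * cmod c" for x :: 'a
    by (simp add: norm_scaleC mult.commute)
qed

definition basis_vector :: "'i \<Rightarrow> 'i \<Rightarrow> complex" where
  "basis_vector i = (\<lambda>j. if j = i then 1 else 0)"

lemma ell1I:
  assumes "\<And>F. finite F \<Longrightarrow> F \<subseteq> I \<Longrightarrow> (\<Sum>i\<in>F. cmod (a i)) \<le> M" "\<And>i. i \<notin> I \<Longrightarrow> a i = 0"
  shows "a \<in> ell1 I" "ell1_norm I a \<le> M"
proof -
  have s: "(\<lambda>i. cmod (a i)) summable_on I"
    by (rule nonneg_bdd_above_summable_on) (auto intro!: bdd_aboveI2[of _ _ M] assms(1))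
  then show "a \<in> ell1 I" using assms(2) by (simp add: ell1_def)
  show "ell1_norm I a \<le> M" unfolding ell1_norm_def by (rule infsum_le_finite_sums[OF s assms(1)])
qed

lemma ell1_partial_sum_le:
  assumes "a \<in> ell1 I" "finite F" "F \<subseteq> I"
  shows "(\<Sum>i\<in>F. cmod (a i)) \<le> ell1_norm I a"
  unfolding ell1_norm_def by (rule finite_sum_le_infsum) (use assms in \<open>auto simp: ell1_def\<close>)

lemma ell1_norm_nonneg: "0 \<le> ell1_norm I a"
  unfolding ell1_norm_def by (rule infsum_nonneg) simp

lemma ell1_outside: "a \<in> ell1 I \<Longrightarrow> i \<notin> I \<Longrightarrow> a i = 0"
  by (simp add: ell1_def)

lemma ell1_coordinate_le: "a \<in> ell1 I \<Longrightarrow> cmod (a i) \<le> ell1_norm I a"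
  using ell1_partial_sum_le[of a I "{i}"] ell1_outside[of a I i] ell1_norm_nonneg[of I a] by (cases "i \<in> I") auto

lemma ell1_add:
  assumes "a \<in> ell1 I" "b \<in> ell1 I"
  shows "a + b \<in> ell1 I" "ell1_norm I (a + b) \<le> ell1_norm I a + ell1_norm I b"
proof -
  have "(\<Sum>i\<in>F. cmod ((a + b) i)) \<le> ell1_norm I a + ell1_norm I b" if F: "finite F" "F \<subseteq> I" for F
  proof -
    have "(\<Sum>i\<in>F. cmod ((a + b) i)) \<le> (\<Sum>i\<in>F. cmod (a i)) + (\<Sum>i\<in>F. cmod (b i))"
      unfolding sum.distrib[symmetric] by (intro sum_mono) (simp add: norm_triangle_ineq)
    then show ?thesis using ell1_partial_sum_le[OF assms(1) F] ell1_partial_sum_le[OF assms(2) F] by linarith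
  qed
  then show "a + b \<in> ell1 I" "ell1_norm I (a + b) \<le> ell1_norm I a + ell1_norm I b"
    using ell1I[of I "a + b"] assms by (auto simp: ell1_outside)
qed

lemma ell1_scaleC:
  assumes "a \<in> ell1 I"
  shows "c *\<^sub>C a \<in> ell1 I"
proof (rule ell1I(1))
  fix F assume F: "finite F" "F \<subseteq> I"
  have "(\<Sum>i\<in>F. cmod ((c *\<^sub>C a) i)) = cmod c * (\<Sum>i\<in>F. cmod (a i))"
    by (simp add: scaleC_fun_def scaleC_complex_def norm_mult sum_distrib_left)
  also have "\<dots> \<le> cmod c * ell1_norm I a" by (intro mult_left_mono ell1_partial_sum_le[OF assms F]) simp
  finally show "(\<Sum>i\<in>F. cmod ((c *\<^sub>C a) i)) \<le> cmod c * ell1_norm I a" .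
qed (use assms in \<open>simp add: scaleC_fun_def scaleC_complex_def ell1_outside\<close>)

lemma csubspace_ell1: "csubspace (ell1 I)"
proof -
  have "0 \<in> ell1 I" by (simp add: ell1_def)
  then show ?thesis unfolding cvs.subspace_def using ell1_add(1) ell1_scaleC by blast
qed

lemma ell1_diff:
  assumes "a \<in> ell1 I" "b \<in> ell1 I"
  shows "a - b \<in> ell1 I"
  by (rule cvs.subspace_diff[OF csubspace_ell1 assms])

lemma finite_support_ell1:
  assumes "finite F" "F \<subseteq> I"
  shows "(\<lambda>i. if i \<in> F then a i else 0) \<in> ell1 I"
    "ell1_norm I (\<lambda>i. if i \<in> F then a i else 0) = (\<Sum>i\<in>F. cmod (a i))"
proof -
  let ?a = "\<lambda>i. if i \<in> F then a i else 0"
  have le: "(\<Sum>i\<in>G. cmod (?a i)) \<le> (\<Sum>i\<in>F. cmod (a i))" if "finite G" for G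
  proof -
    have "(\<Sum>i\<in>G. cmod (?a i)) = (\<Sum>i\<in>G \<inter> F. cmod (a i))"
      using that by (simp add: sum.inter_restrict if_distrib cong: if_cong)
    also have "\<dots> \<le> (\<Sum>i\<in>F. cmod (a i))" using assms(1) by (intro sum_mono2) auto
    finally show ?thesis .
  qed
  have m: "?a \<in> ell1 I \<and> ell1_norm I ?a \<le> (\<Sum>i\<in>F. cmod (a i))"
  proof -
    have "?a i = 0" if "i \<notin> I" for i using that assms(2) by auto
    then show ?thesis using ell1I[of I ?a "\<Sum>i\<in>F. cmod (a i)"] le by blast
  qed
  then show "?a \<in> ell1 I" by simp
  moreover have "(\<Sum>i\<in>F. cmod (a i)) \<le> ell1_norm I ?a"
    using ell1_partial_sum_le[of ?a I F] m assms by simp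
  ultimately show "ell1_norm I ?a = (\<Sum>i\<in>F. cmod (a i))" using m by simp
qed

lemma finite_support_eq_sum:
  assumes "finite F"
  shows "(\<lambda>i. if i \<in> F then a i else 0) = (\<Sum>i\<in>F. a i *\<^sub>C basis_vector i)"
proof
  fix j
  have "(\<Sum>i\<in>F. a i *\<^sub>C basis_vector i) j = (\<Sum>i\<in>F. if j = i then a i else 0)"
    unfolding sum_fun_apply by (rule sum.cong) (auto simp: scaleC_fun_def scaleC_complex_def basis_vector_def)
  then show "(if j \<in> F then a j else 0) = (\<Sum>i\<in>F. a i *\<^sub>C basis_vector i) j"
    using assms by simp
qed

lemma basis_vector_ell1: "i \<in> I \<Longrightarrow> basis_vector i \<in> ell1 I" "i \<in> I \<Longrightarrow> ell1_norm I (basis_vector i) = 1"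
  using finite_support_ell1[of "{i}" I "\<lambda>_. 1"] by (auto simp: basis_vector_def)

lemma ell1_complete:
  assumes b: "\<And>n. b n \<in> ell1 I"
    and cauchy: "\<And>e. 0 < e \<Longrightarrow> \<exists>N. \<forall>m\<ge>N. \<forall>n\<ge>N. ell1_norm I (b m - b n) \<le> e"
  obtains a where "a \<in> ell1 I" "(\<lambda>n. ell1_norm I (b n - a)) \<longlonglongrightarrow> 0"
proof -
  have "convergent (\<lambda>n. b n i)" for i
  proof (rule Cauchy_convergent, rule CauchyI)
    fix e :: real assume e: "0 < e"
    obtain N where N: "\<forall>m\<ge>N. \<forall>n\<ge>N. ell1_norm I (b m - b n) \<le> e / 2" using cauchy[of "e / 2"] e by auto
    have "norm (b m i - b n i) < e" if "m \<ge> N" "n \<ge> N" for m n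
      using ell1_coordinate_le[OF ell1_diff[OF b b], of m n i] N that e by force
    then show "\<exists>N. \<forall>m\<ge>N. \<forall>n\<ge>N. norm (b m i - b n i) < e" by blast
  qed
  then obtain a where a: "\<And>i. (\<lambda>n. b n i) \<longlonglongrightarrow> a i" unfolding convergent_def by metis
  have tail: "b n - a \<in> ell1 I \<and> ell1_norm I (b n - a) \<le> e"
    if N: "\<forall>m\<ge>N. \<forall>n\<ge>N. ell1_norm I (b m - b n) \<le> e" and n: "n \<ge> N" for N n e
  proof -
    have "(\<Sum>i\<in>F. cmod ((b n - a) i)) \<le> e" if F: "finite F" "F \<subseteq> I" for F
    proof (rule LIMSEQ_le_const2)
      show "(\<lambda>m. \<Sum>i\<in>F. cmod ((b n - b m) i)) \<longlonglongrightarrow> (\<Sum>i\<in>F. cmod ((b n - a) i))"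
        by (auto intro!: tendsto_intros a)
      show "\<exists>N. \<forall>m\<ge>N. (\<Sum>i\<in>F. cmod ((b n - b m) i)) \<le> e"
        using N n ell1_partial_sum_le[OF ell1_diff[OF b b] F] by (meson order_trans)
    qed
    moreover have "(b n - a) i = 0" if "i \<notin> I" for i
    proof -
      have "(\<lambda>n. b n i) = (\<lambda>n. 0)" using ell1_outside[OF b that] by simp
      then have "a i = 0" using a[of i] by (simp add: LIMSEQ_const_iff)
      then show ?thesis using ell1_outside[OF b that] by simp
    qed
    ultimately show ?thesis using ell1I[of I "b n - a" e] by blast
  qed
  obtain N1 where N1: "\<forall>m\<ge>N1. \<forall>n\<ge>N1. ell1_norm I (b m - b n) \<le> 1" using cauchy[of 1] by auto
  have "b N1 - a \<in> ell1 I" using tail[OF N1] by simp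
  then have "b N1 - (b N1 - a) \<in> ell1 I" by (rule ell1_diff[OF b])
  then have aI: "a \<in> ell1 I" by simp
  have "(\<lambda>n. ell1_norm I (b n - a)) \<longlonglongrightarrow> 0"
  proof (rule LIMSEQ_I)
    fix e :: real assume e: "0 < e"
    obtain N where N: "\<forall>m\<ge>N. \<forall>n\<ge>N. ell1_norm I (b m - b n) \<le> e / 2" using cauchy[of "e / 2"] e by auto
    have "norm (ell1_norm I (b n - a) - 0) < e" if "n \<ge> N" for n
      using tail[OF N that] ell1_norm_nonneg[of I "b n - a"] e by simp
    then show "\<exists>N. \<forall>n\<ge>N. norm (ell1_norm I (b n - a) - 0) < e" by blast
  qed
  with aI show ?thesis by (rule that)
qed

text \<open>The extension of \<open>basis_vector i \<mapsto> v i\<close> to \<open>\<ell>\<^sub>1\<close>.\<close>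

definition synthesis :: "'i set \<Rightarrow> ('i \<Rightarrow> 'a::complex_banach) \<Rightarrow> ('i \<Rightarrow> complex) \<Rightarrow> 'a" where
  "synthesis I v a = (\<Sum>\<^sub>\<infinity>i\<in>I. a i *\<^sub>C v i)"

context
  fixes I :: "'i set" and v :: "'i \<Rightarrow> 'a::complex_banach" and R :: real
  assumes R: "0 \<le> R" and v: "\<And>i. i \<in> I \<Longrightarrow> norm (v i) \<le> R"
begin

lemma partial_sum_norm_le:
  assumes "F \<subseteq> I"
  shows "norm (\<Sum>i\<in>F. a i *\<^sub>C v i) \<le> R * (\<Sum>i\<in>F. cmod (a i))"
proof -
  have "norm (\<Sum>i\<in>F. a i *\<^sub>C v i) \<le> (\<Sum>i\<in>F. R * cmod (a i))"
  proof (rule sum_norm_le)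
    fix i assume "i \<in> F"
    then have "norm (v i) \<le> R" using v assms by auto
    then have "cmod (a i) * norm (v i) \<le> cmod (a i) * R" by (rule mult_left_mono) simp
    then show "norm (a i *\<^sub>C v i) \<le> R * cmod (a i)" by (simp add: norm_scaleC mult.commute)
  qed
  then show ?thesis by (simp add: sum_distrib_left)
qed

lemma synthesis_tendsto:
  assumes a: "a \<in> ell1 I"
  shows "((\<lambda>F. \<Sum>i\<in>F. a i *\<^sub>C v i) \<longlongrightarrow> synthesis I v a) (finite_subsets_at_top I)"
proof -
  have "(\<lambda>i. a i *\<^sub>C v i) abs_summable_on I"
  proof (rule nonneg_bdd_above_summable_on)
    show "bdd_above (sum (\<lambda>i. norm (a i *\<^sub>C v i)) ` {F. F \<subseteq> I \<and> finite F})"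
    proof (rule bdd_aboveI2)
      fix F assume "F \<in> {F. F \<subseteq> I \<and> finite F}"
      then have F: "F \<subseteq> I" "finite F" by auto
      have "(\<Sum>i\<in>F. norm (a i *\<^sub>C v i)) \<le> (\<Sum>i\<in>F. R * cmod (a i))"
        using v F(1) by (intro sum_mono) (auto simp: norm_scaleC mult.commute[of R] intro!: mult_left_mono)
      also have "\<dots> = R * (\<Sum>i\<in>F. cmod (a i))" by (simp add: sum_distrib_left)
      also have "\<dots> \<le> R * ell1_norm I a" by (intro mult_left_mono R ell1_partial_sum_le a F)
      finally show "(\<Sum>i\<in>F. norm (a i *\<^sub>C v i)) \<le> R * ell1_norm I a" .
    qed
  qed simp
  then have "(\<lambda>i. a i *\<^sub>C v i) summable_on I" by (rule abs_summable_summable)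
  then show ?thesis unfolding synthesis_def by (rule infsum_tendsto)
qed

lemma synthesis_clinear: "clinear_on (ell1 I) (synthesis I v)"
  unfolding clinear_on_def
proof (intro conjI ballI allI)
  fix a b assume ab: "a \<in> ell1 I" "b \<in> ell1 I"
  have "((\<lambda>F. (\<Sum>i\<in>F. a i *\<^sub>C v i) + (\<Sum>i\<in>F. b i *\<^sub>C v i)) \<longlongrightarrow> synthesis I v a + synthesis I v b) (finite_subsets_at_top I)"
    by (intro tendsto_add synthesis_tendsto ab)
  then have "((\<lambda>F. \<Sum>i\<in>F. (a + b) i *\<^sub>C v i) \<longlongrightarrow> synthesis I v a + synthesis I v b) (finite_subsets_at_top I)"
    by (simp add: sum.distrib[symmetric] scaleC_add_left)
  then show "synthesis I v (a + b) = synthesis I v a + synthesis I v b"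
    by (rule tendsto_unique[OF finite_subsets_at_top_neq_bot synthesis_tendsto[OF ell1_add(1)[OF ab]]])
next
  fix c a assume a: "a \<in> ell1 I"
  have "((\<lambda>F. c *\<^sub>C (\<Sum>i\<in>F. a i *\<^sub>C v i)) \<longlongrightarrow> c *\<^sub>C synthesis I v a) (finite_subsets_at_top I)"
    by (intro bounded_linear.tendsto[OF bounded_linear_scaleC] synthesis_tendsto a)
  then have "((\<lambda>F. \<Sum>i\<in>F. (c *\<^sub>C a) i *\<^sub>C v i) \<longlongrightarrow> c *\<^sub>C synthesis I v a) (finite_subsets_at_top I)"
    by (simp add: cvs.scale_sum_right scaleC_fun_def scaleC_complex_def scaleC_scaleC)
  then show "synthesis I v (c *\<^sub>C a) = c *\<^sub>C synthesis I v a"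
    by (rule tendsto_unique[OF finite_subsets_at_top_neq_bot synthesis_tendsto[OF ell1_scaleC[OF a]]])
qed

lemma synthesis_upper:
  assumes a: "a \<in> ell1 I"
  shows "norm (synthesis I v a) \<le> R * ell1_norm I a"
proof (rule tendsto_upperbound[OF tendsto_norm[OF synthesis_tendsto[OF a]]])
  show "\<forall>\<^sub>F F in finite_subsets_at_top I. norm (\<Sum>i\<in>F. a i *\<^sub>C v i) \<le> R * ell1_norm I a"
  proof (rule eventually_finite_subsets_at_top_weakI)
    fix F assume F: "finite F" "F \<subseteq> I"
    have "R * (\<Sum>i\<in>F. cmod (a i)) \<le> R * ell1_norm I a" by (intro mult_left_mono R ell1_partial_sum_le a F)
    then show "norm (\<Sum>i\<in>F. a i *\<^sub>C v i) \<le> R * ell1_norm I a" using partial_sum_norm_le[OF F(2), of a] by linarith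
  qed
qed simp

lemma synthesis_basis_vector: "i \<in> I \<Longrightarrow> synthesis I v (basis_vector i) = v i"
proof -
  assume i: "i \<in> I"
  have "synthesis I v (basis_vector i) = (\<Sum>\<^sub>\<infinity>j\<in>{i}. basis_vector i j *\<^sub>C v j)"
    unfolding synthesis_def by (rule infsum_cong_neutral) (use i in \<open>auto simp: basis_vector_def\<close>)
  then show "synthesis I v (basis_vector i) = v i" by (simp add: basis_vector_def scaleC_one)
qed

lemma synthesis_diff:
  assumes "a \<in> ell1 I" "b \<in> ell1 I"
  shows "synthesis I v (a - b) = synthesis I v a - synthesis I v b"
proof -
  have "synthesis I v ((a - b) + b) = synthesis I v (a - b) + synthesis I v b"
    using synthesis_clinear ell1_diff[OF assms] assms(2) unfolding clinear_on_def by blast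
  then show ?thesis by simp
qed

lemma synthesis_in_closure:
  assumes a: "a \<in> ell1 I"
  shows "synthesis I v a \<in> closure (cspan (v ` I))"
proof (rule Lim_in_closed_set[OF closed_closure _ finite_subsets_at_top_neq_bot synthesis_tendsto[OF a]])
  show "\<forall>\<^sub>F F in finite_subsets_at_top I. (\<Sum>i\<in>F. a i *\<^sub>C v i) \<in> closure (cspan (v ` I))"
  proof (rule eventually_finite_subsets_at_top_weakI)
    fix F assume F: "finite F" "F \<subseteq> I"
    have "(\<Sum>i\<in>F. a i *\<^sub>C v i) \<in> cspan (v ` I)"
      using F(2) by (intro cvs.span_sum cvs.span_scale cvs.span_base) auto
    then show "(\<Sum>i\<in>F. a i *\<^sub>C v i) \<in> closure (cspan (v ` I))" using closure_subset by blast
  qed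
qed

lemma csubspace_range_synthesis: "csubspace (synthesis I v ` ell1 I)"
  unfolding cvs.subspace_def
proof (intro conjI ballI allI)
  have 0: "0 \<in> ell1 I" by (rule cvs.subspace_0[OF csubspace_ell1])
  have "synthesis I v (0 - 0) = 0" using synthesis_diff[OF 0 0] by simp
  then have "0 = synthesis I v 0" by (simp only: diff_zero)
  then show "0 \<in> synthesis I v ` ell1 I" using 0 by (rule image_eqI)
next
  fix x y assume "x \<in> synthesis I v ` ell1 I" "y \<in> synthesis I v ` ell1 I"
  then obtain a b where ab: "a \<in> ell1 I" "b \<in> ell1 I" "x = synthesis I v a" "y = synthesis I v b" by blast
  then have "x + y = synthesis I v (a + b)" using synthesis_clinear unfolding clinear_on_def by simp
  then show "x + y \<in> synthesis I v ` ell1 I" using ell1_add(1)[OF ab(1,2)] by (rule image_eqI)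
next
  fix c x assume "x \<in> synthesis I v ` ell1 I"
  then obtain a where a: "a \<in> ell1 I" "x = synthesis I v a" by blast
  then have "c *\<^sub>C x = synthesis I v (c *\<^sub>C a)" using synthesis_clinear unfolding clinear_on_def by simp
  then show "c *\<^sub>C x \<in> synthesis I v ` ell1 I" using ell1_scaleC[OF a(1)] by (rule image_eqI)
qed

context
  fixes \<rho> :: real
  assumes \<rho>: "0 < \<rho>" and lower: "ell1_lower \<rho> I v"
begin

lemma synthesis_lower:
  assumes a: "a \<in> ell1 I"
  shows "\<rho> * ell1_norm I a \<le> norm (synthesis I v a)"
proof (rule tendsto_le[OF finite_subsets_at_top_neq_bot tendsto_norm[OF synthesis_tendsto[OF a]]])
  show "((\<lambda>F. \<rho> * (\<Sum>i\<in>F. cmod (a i))) \<longlongrightarrow> \<rho> * ell1_norm I a) (finite_subsets_at_top I)"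
    unfolding ell1_norm_def using a by (intro tendsto_mult_left infsum_tendsto) (simp add: ell1_def)
  show "\<forall>\<^sub>F F in finite_subsets_at_top I. \<rho> * (\<Sum>i\<in>F. cmod (a i)) \<le> norm (\<Sum>i\<in>F. a i *\<^sub>C v i)"
    by (rule eventually_finite_subsets_at_top_weakI) (rule ell1_lowerD[OF lower])
qed

lemma synthesis_inj: "inj_on (synthesis I v) (ell1 I)"
proof (rule inj_onI)
  fix a b assume ab: "a \<in> ell1 I" "b \<in> ell1 I" "synthesis I v a = synthesis I v b"
  have "\<rho> * ell1_norm I (a - b) \<le> 0"
    using synthesis_lower[OF ell1_diff[OF ab(1,2)]] synthesis_diff[OF ab(1,2)] ab(3) by simp
  then have "ell1_norm I (a - b) \<le> 0" using \<rho> by (simp add: mult_le_0_iff)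
  then have "cmod ((a - b) i) \<le> 0" for i using ell1_coordinate_le[OF ell1_diff[OF ab(1,2)], of i] by linarith
  then show "a = b" by (intro ext) simp
qed

text \<open>The range contains the linear span, and it is closed because the map is bounded below and \<open>\<ell>\<^sub>1\<close> is complete.\<close>

lemma synthesis_image: "synthesis I v ` ell1 I = closure (cspan (v ` I))"
proof (intro equalityI subsetI)
  fix y assume "y \<in> closure (cspan (v ` I))"
  then obtain f where f: "\<And>n. f n \<in> cspan (v ` I)" "f \<longlonglongrightarrow> y" unfolding closure_sequential by auto
  have "cspan (v ` I) \<subseteq> synthesis I v ` ell1 I"
  proof (rule cvs.span_minimal[OF _ csubspace_range_synthesis], rule image_subsetI)
    fix i assume "i \<in> I"
    then show "v i \<in> synthesis I v ` ell1 I"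
      using synthesis_basis_vector basis_vector_ell1(1) by (intro image_eqI[of _ _ "basis_vector i"]) auto
  qed
  from subsetD[OF this f(1)] have "\<forall>n. \<exists>b. b \<in> ell1 I \<and> synthesis I v b = f n"
    unfolding image_iff by (metis (full_types))
  from choice[OF this] obtain b where b0: "\<forall>n. b n \<in> ell1 I \<and> synthesis I v (b n) = f n" ..
  then have b: "\<And>n. b n \<in> ell1 I" "\<And>n. synthesis I v (b n) = f n" by auto
  have cau: "\<exists>N. \<forall>m\<ge>N. \<forall>n\<ge>N. ell1_norm I (b m - b n) \<le> e" if e: "0 < e" for e
  proof -
    have "Cauchy f" using f(2) by (rule LIMSEQ_imp_Cauchy)
    then obtain N where N: "\<forall>m\<ge>N. \<forall>n\<ge>N. norm (f m - f n) < \<rho> * e"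
      using CauchyD[of f "\<rho> * e"] e \<rho> by auto
    have "ell1_norm I (b m - b n) \<le> e" if "m \<ge> N" "n \<ge> N" for m n
    proof -
      have "\<rho> * ell1_norm I (b m - b n) \<le> norm (f m - f n)"
        using synthesis_lower[OF ell1_diff[OF b(1) b(1)], of m n] synthesis_diff[OF b(1) b(1)] b(2) by simp
      also have "\<dots> \<le> \<rho> * e" using N that by (simp add: less_imp_le)
      finally show ?thesis using \<rho> by simp
    qed
    then show ?thesis by blast
  qed
  obtain a where a: "a \<in> ell1 I" "(\<lambda>n. ell1_norm I (b n - a)) \<longlonglongrightarrow> 0"
    by (rule ell1_complete[of b I, OF b(1) cau])
  have "f \<longlonglongrightarrow> synthesis I v a"
  proof (rule LIM_zero_cancel, rule Lim_null_comparison)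
    show "(\<lambda>n. R * ell1_norm I (b n - a)) \<longlonglongrightarrow> 0" using tendsto_mult_left[OF a(2), of R] by simp
    show "\<forall>\<^sub>F n in sequentially. norm (f n - synthesis I v a) \<le> R * ell1_norm I (b n - a)"
    proof (rule always_eventually, rule allI)
      fix n
      show "norm (f n - synthesis I v a) \<le> R * ell1_norm I (b n - a)"
        using synthesis_upper[OF ell1_diff[OF b(1) a(1)], of n] synthesis_diff[OF b(1) a(1), of n] b(2) by simp
    qed
  qed
  then have "y = synthesis I v a" using f(2) by (rule LIMSEQ_unique[rotated])
  then show "y \<in> synthesis I v ` ell1 I" using a(1) by blast
qed (use synthesis_in_closure in auto)

lemma synthesis_inverse_bound:
  assumes "y \<in> closure (cspan (v ` I))"
  shows "ell1_norm I (inv_into (ell1 I) (synthesis I v) y) \<le> 1 / \<rho> * norm y"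
proof -
  obtain a where a: "a \<in> ell1 I" "y = synthesis I v a" using assms synthesis_image by blast
  then have "inv_into (ell1 I) (synthesis I v) y = a" by (simp add: inv_into_f_f[OF synthesis_inj])
  then show ?thesis using synthesis_lower[OF a(1)] a(2) \<rho> by (simp add: field_simps)
qed

lemma synthesis_isomorphism: "ell1_basis_isomorphism I v (synthesis I v)"
  unfolding ell1_basis_isomorphism_def isomorphism_on_def bounded_on_def bij_betw_def
  using synthesis_basis_vector synthesis_clinear synthesis_inj synthesis_image synthesis_upper synthesis_inverse_bound
  unfolding basis_vector_def by blast

lemma synthesis_opnorms:
  "opnorm_on (ell1 I) (ell1_norm I) norm (synthesis I v) *
   opnorm_on (closure (cspan (v ` I))) norm (ell1_norm I) (inv_into (ell1 I) (synthesis I v)) \<le> R / \<rho>"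
proof -
  have 1: "opnorm_on (ell1 I) (ell1_norm I) norm (synthesis I v) \<le> R"
    unfolding opnorm_on_def using R synthesis_upper by (intro cInf_lower) (auto intro!: bdd_belowI[of _ 0])
  have 2: "opnorm_on (closure (cspan (v ` I))) norm (ell1_norm I) (inv_into (ell1 I) (synthesis I v)) \<le> 1 / \<rho>"
    unfolding opnorm_on_def using \<rho> synthesis_inverse_bound by (intro cInf_lower) (auto intro!: bdd_belowI[of _ 0])
  have 3: "0 \<le> opnorm_on (closure (cspan (v ` I))) norm (ell1_norm I) (inv_into (ell1 I) (synthesis I v))"
    unfolding opnorm_on_def using \<rho> synthesis_inverse_bound by (intro cInf_greatest) (auto intro!: exI[of _ "1 / \<rho>"])
  show ?thesis using mult_mono[OF 1 2 R 3] by simp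
qed

end

end

theorem ell1_lower_imp_equivalent:
  assumes "0 < \<rho>" "ell1_lower \<rho> I v" "0 \<le> R" "\<And>i. i \<in> I \<Longrightarrow> norm (v i) \<le> R"
  shows "equivalent_ell1_basis I v" "K_equivalent_ell1_basis (R / \<rho>) I v"
  unfolding equivalent_ell1_basis_def K_equivalent_ell1_basis_def
  using synthesis_isomorphism[OF assms(3,4,1,2)] synthesis_opnorms[OF assms(3,4,1,2)] by blast+

lemma isomorphism_bound_imp_ell1_lower:
  fixes v :: "'i \<Rightarrow> 'a::complex_banach"
  assumes iso: "ell1_basis_isomorphism I v \<gamma>"
    and C: "0 < C" "\<And>y. y \<in> closure (cspan (v ` I)) \<Longrightarrow> ell1_norm I (inv_into (ell1 I) \<gamma> y) \<le> C * norm y"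
  shows "ell1_lower (1 / C) I v"
  unfolding ell1_lower_def
proof (intro allI impI)
  fix F and a :: "'i \<Rightarrow> complex" assume F: "F \<subseteq> I" "finite F"
  let ?a = "\<lambda>i. if i \<in> F then a i else 0"
  have lin: "clinear_on (ell1 I) \<gamma>" and bij: "bij_betw \<gamma> (ell1 I) (closure (cspan (v ` I)))"
    and bas: "\<And>i. i \<in> I \<Longrightarrow> \<gamma> (basis_vector i) = v i"
    using iso unfolding ell1_basis_isomorphism_def isomorphism_on_def basis_vector_def by auto
  have a: "?a \<in> ell1 I" "ell1_norm I ?a = (\<Sum>i\<in>F. cmod (a i))" using finite_support_ell1[OF F(2,1)] by auto
  have "\<gamma> ?a = (\<Sum>i\<in>F. a i *\<^sub>C \<gamma> (basis_vector i))"
    unfolding finite_support_eq_sum[OF F(2)]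
    using F by (intro clinear_on_subspace_sum(2)[OF csubspace_ell1 lin] basis_vector_ell1(1)) auto
  also have "\<dots> = (\<Sum>i\<in>F. a i *\<^sub>C v i)" using F bas by (intro sum.cong) auto
  finally have \<gamma>a: "\<gamma> ?a = (\<Sum>i\<in>F. a i *\<^sub>C v i)" .
  have "\<gamma> ?a \<in> closure (cspan (v ` I))" using bij a(1) by (auto simp: bij_betw_def)
  moreover have "inv_into (ell1 I) \<gamma> (\<gamma> ?a) = ?a" using bij a(1) by (intro inv_into_f_f) (auto simp: bij_betw_def)
  ultimately have "ell1_norm I ?a \<le> C * norm (\<gamma> ?a)" using C(2)[of "\<gamma> ?a"] by simp
  then show "1 / C * (\<Sum>i\<in>F. cmod (a i)) \<le> norm (\<Sum>i\<in>F. a i *\<^sub>C v i)"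
    unfolding a(2) \<gamma>a using C(1) by (simp add: field_simps)
qed

theorem equivalent_imp_ell1_lower:
  assumes "equivalent_ell1_basis I v"
  obtains \<rho> where "0 < \<rho>" "ell1_lower \<rho> I v"
proof -
  obtain \<gamma> where \<gamma>: "ell1_basis_isomorphism I v \<gamma>" using assms unfolding equivalent_ell1_basis_def by blast
  then obtain C where C: "\<And>y. y \<in> closure (cspan (v ` I)) \<Longrightarrow> ell1_norm I (inv_into (ell1 I) \<gamma> y) \<le> C * norm y"
    unfolding ell1_basis_isomorphism_def isomorphism_on_def bounded_on_def by blast
  have "ell1_lower (1 / max C 1) I v"
  proof (rule isomorphism_bound_imp_ell1_lower[OF \<gamma>])
    fix y assume "y \<in> closure (cspan (v ` I))"
    then have "ell1_norm I (inv_into (ell1 I) \<gamma> y) \<le> C * norm y" by (rule C)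
    also have "\<dots> \<le> max C 1 * norm y" by (rule mult_right_mono) auto
    finally show "ell1_norm I (inv_into (ell1 I) \<gamma> y) \<le> max C 1 * norm y" .
  qed simp
  then show ?thesis by (rule that[rotated]) simp
qed

text \<open>Only the product of the two norms is bounded by \<open>K\<close>.  Since \<open>\<gamma>\<close> maps a unit vector to a vector of norm \<open>r\<close>, its
  norm is at least \<open>r\<close>, and the inverse has norm at most \<open>K / r\<close>, uniformly in \<open>I\<close>.\<close>

theorem K_equivalent_imp_ell1_lower:
  assumes "K_equivalent_ell1_basis K I v" and K: "0 < K" and I: "i \<in> I" and r: "norm (v i) = r"
  shows "0 < r" "ell1_lower (1 / (K / r)) I v"
proof -
  obtain \<gamma> where \<gamma>: "ell1_basis_isomorphism I v \<gamma>"
    and Kb: "opnorm_on (ell1 I) (ell1_norm I) norm \<gamma> *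
        opnorm_on (closure (cspan (v ` I))) norm (ell1_norm I) (inv_into (ell1 I) \<gamma>) \<le> K" (is "?A * ?B \<le> K")
    using assms(1) unfolding K_equivalent_ell1_basis_def by blast
  obtain \<rho> where \<rho>: "0 < \<rho>" "ell1_lower \<rho> I v"
    using equivalent_imp_ell1_lower \<gamma> unfolding equivalent_ell1_basis_def by blast
  have "\<rho> * (\<Sum>j\<in>{i}. cmod 1) \<le> norm (\<Sum>j\<in>{i}. 1 *\<^sub>C v j)"
    using I by (intro ell1_lowerD[OF \<rho>(2)]) auto
  then show r0: "0 < r" using \<rho>(1) r by (simp add: scaleC_one)
  let ?V = "closure (cspan (v ` I))" and ?g = "inv_into (ell1 I) \<gamma>"
  obtain C1 C2 where C1: "\<And>a. a \<in> ell1 I \<Longrightarrow> norm (\<gamma> a) \<le> C1 * ell1_norm I a"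
    and C2: "\<And>y. y \<in> ?V \<Longrightarrow> ell1_norm I (?g y) \<le> C2 * norm y"
    using \<gamma> unfolding ell1_basis_isomorphism_def isomorphism_on_def bounded_on_def by blast
  have "r \<le> ?A"
    unfolding opnorm_on_def
  proof (rule cInf_greatest)
    have "max C1 0 \<in> {C. 0 \<le> C \<and> (\<forall>x\<in>ell1 I. norm (\<gamma> x) \<le> C * ell1_norm I x)}"
    proof (intro CollectI conjI ballI)
      fix a assume "a \<in> ell1 I"
      then have "norm (\<gamma> a) \<le> C1 * ell1_norm I a" by (rule C1)
      also have "\<dots> \<le> max C1 0 * ell1_norm I a" by (rule mult_right_mono) (auto simp: ell1_norm_nonneg)
      finally show "norm (\<gamma> a) \<le> max C1 0 * ell1_norm I a" .
    qed simp
    then show "{C. 0 \<le> C \<and> (\<forall>x\<in>ell1 I. norm (\<gamma> x) \<le> C * ell1_norm I x)} \<noteq> {}" by blast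
    fix C assume "C \<in> {C. 0 \<le> C \<and> (\<forall>x\<in>ell1 I. norm (\<gamma> x) \<le> C * ell1_norm I x)}"
    then have "norm (\<gamma> (basis_vector i)) \<le> C * ell1_norm I (basis_vector i)"
      using basis_vector_ell1(1)[OF I] by blast
    moreover have "\<gamma> (basis_vector i) = v i"
      using \<gamma> I unfolding ell1_basis_isomorphism_def basis_vector_def by auto
    ultimately show "r \<le> C" using basis_vector_ell1(2)[OF I] r by simp
  qed
  have B: "ell1_norm I (?g y) \<le> ?B * norm y" if y: "y \<in> ?V" for y
  proof (cases "y = 0")
    case True
    then show ?thesis using C2[OF y] by simp
  next
    case False
    have "ell1_norm I (?g y) / norm y \<le> ?B"
      unfolding opnorm_on_def
    proof (rule cInf_greatest)
      have "max C2 0 \<in> {C. 0 \<le> C \<and> (\<forall>x\<in>?V. ell1_norm I (?g x) \<le> C * norm x)}"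
      proof (intro CollectI conjI ballI)
        fix x assume "x \<in> ?V"
        then have "ell1_norm I (?g x) \<le> C2 * norm x" by (rule C2)
        also have "\<dots> \<le> max C2 0 * norm x" by (rule mult_right_mono) auto
        finally show "ell1_norm I (?g x) \<le> max C2 0 * norm x" .
      qed simp
      then show "{C. 0 \<le> C \<and> (\<forall>x\<in>?V. ell1_norm I (?g x) \<le> C * norm x)} \<noteq> {}" by blast
      fix C assume "C \<in> {C. 0 \<le> C \<and> (\<forall>x\<in>?V. ell1_norm I (?g x) \<le> C * norm x)}"
      then have "ell1_norm I (?g y) \<le> C * norm y" using y by blast
      then show "ell1_norm I (?g y) / norm y \<le> C" using False by (simp add: divide_le_eq)
    qed
    then show ?thesis using False by (simp add: divide_le_eq)
  qed
  have "v i \<in> ?V" by (rule subsetD[OF closure_subset cvs.span_base[OF imageI[OF I]]])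
  then have "0 \<le> ?B * norm (v i)" using B[of "v i"] ell1_norm_nonneg[of I "?g (v i)"] by linarith
  then have B0: "0 \<le> ?B" using r0 r by (simp add: zero_le_mult_iff)
  have "r * ?B \<le> ?A * ?B" using \<open>r \<le> ?A\<close> B0 by (rule mult_right_mono)
  then have "?B \<le> K / r" using Kb r0 by (simp add: field_simps)
  show "ell1_lower (1 / (K / r)) I v"
  proof (rule isomorphism_bound_imp_ell1_lower[OF \<gamma>])
    show "0 < K / r" using K r0 by simp
    fix y assume "y \<in> ?V"
    then have "ell1_norm I (?g y) \<le> ?B * norm y" by (rule B)
    also have "\<dots> \<le> K / r * norm y" using \<open>?B \<le> K / r\<close> by (rule mult_right_mono) simp
    finally show "ell1_norm I (?g y) \<le> K / r * norm y" .
  qed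
qed

section \<open>Members of maximal density in hereditary families\<close>

text \<open>The combinatorial properties of the sets of times \<open>I\<close> for which \<open>\<alpha>\<^sup>i x\<close>, \<open>i \<in> I\<close>, satisfies a fixed lower \<open>\<ell>\<^sub>1\<close>
  estimate.\<close>

locale hereditary_family =
  fixes Fam :: "nat set \<Rightarrow> bool"
  assumes empty: "Fam {}"
    and subset: "Fam I \<Longrightarrow> J \<subseteq> I \<Longrightarrow> Fam J"
    and shift: "Fam ((+) m ` J) \<Longrightarrow> Fam J"
    and finite_character: "(\<And>F. F \<subseteq> I \<Longrightarrow> finite F \<Longrightarrow> Fam F) \<Longrightarrow> Fam I"
begin

definition max_size :: "nat \<Rightarrow> nat" where
  "max_size n = Max (card ` {I. I \<subseteq> {..<n} \<and> Fam I})"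

definition max_density :: real where
  "max_density = (INF n\<in>{1..}. real (max_size n) / real n)"

lemma finite_members: "finite {I. I \<subseteq> {..<n} \<and> Fam I}"
  by (rule finite_subset[of _ "Pow {..<n}"]) auto

lemma card_le_max_size: "I \<subseteq> {..<n} \<Longrightarrow> Fam I \<Longrightarrow> card I \<le> max_size n"
  unfolding max_size_def by (intro Max_ge finite_imageI finite_members) auto

lemma max_size_attained:
  obtains I where "I \<subseteq> {..<n}" "Fam I" "card I = max_size n"
proof -
  have "max_size n \<in> card ` {I. I \<subseteq> {..<n} \<and> Fam I}"
    unfolding max_size_def using empty by (intro Max_in finite_imageI finite_members) auto
  then show ?thesis using that by auto
qed

lemma unshift:
  assumes "Fam I"
  shows "Fam {i. i < n \<and> m + i \<in> I}"
proof (rule shift[of m])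
  show "Fam ((+) m ` {i. i < n \<and> m + i \<in> I})" by (rule subset[OF assms]) auto
qed

lemma card_unshift:
  fixes I :: "nat set"
  shows "card {i. i < n \<and> m + i \<in> I} = card (I \<inter> {m..<m + n})"
proof -
  have "(+) m ` {i. i < n \<and> m + i \<in> I} = I \<inter> {m..<m + n}"
  proof (intro equalityI subsetI)
    fix j assume "j \<in> I \<inter> {m..<m + n}"
    then show "j \<in> (+) m ` {i. i < n \<and> m + i \<in> I}" by (intro image_eqI[of _ _ "j - m"]) auto
  qed auto
  then show ?thesis using card_image[of "(+) m" "{i. i < n \<and> m + i \<in> I}"] by simp
qed

lemma max_size_subadditive: "max_size (m + n) \<le> max_size m + max_size n"
proof -
  obtain I where I: "I \<subseteq> {..<m + n}" "Fam I" "card I = max_size (m + n)" by (rule max_size_attained)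
  have "I = (I \<inter> {..<m}) \<union> (I \<inter> {m..<m + n})" using I(1) by auto
  then have "card I \<le> card (I \<inter> {..<m}) + card (I \<inter> {m..<m + n})" by (metis card_Un_le)
  moreover have "card (I \<inter> {..<m}) \<le> max_size m" by (intro card_le_max_size subset[OF I(2)]) auto
  moreover have "card {i. i < n \<and> m + i \<in> I} \<le> max_size n" by (intro card_le_max_size unshift I(2)) auto
  ultimately show ?thesis using I(3) by (simp add: card_unshift)
qed

lemma max_density_limit: "(\<lambda>n. real (max_size n) / real n) \<longlonglongrightarrow> max_density"
  unfolding max_density_def
proof (rule fekete_limit)
  show "real (max_size (m + n)) \<le> real (max_size m) + real (max_size n)" for m n
    using max_size_subadditive[of m n] by linarith
qed simp

lemma max_density_le: "max_density * real n \<le> real (max_size n)"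
proof (cases "n = 0")
  case False
  then have "max_density \<le> real (max_size n) / real n"
    unfolding max_density_def by (intro fekete_lower) auto
  then show ?thesis using False by (simp add: field_simps)
qed simp

lemma max_density_pos:
  assumes "0 < d" and freq: "\<exists>\<^sub>F n in sequentially. \<exists>I\<subseteq>{..<n}. Fam I \<and> d * real n \<le> real (card I)"
  shows "0 < max_density"
proof (rule ccontr)
  assume "\<not> ?thesis"
  then have "max_density < d" using assms(1) by simp
  then have "\<forall>\<^sub>F n in sequentially. real (max_size n) / real n < d"
    by (rule order_tendstoD(2)[OF max_density_limit])
  then have ev: "\<forall>\<^sub>F n in sequentially. real (max_size n) / real n < d \<and> 0 < n"
    using eventually_gt_at_top[of 0] by (rule eventually_conj)
  have "\<exists>\<^sub>F n in sequentially. False"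
    using frequently_eventually_conj[OF freq ev]
  proof (rule frequently_elim1)
    fix n assume h: "(real (max_size n) / real n < d \<and> 0 < n) \<and> (\<exists>I\<subseteq>{..<n}. Fam I \<and> d * real n \<le> real (card I))"
    then obtain I where I: "I \<subseteq> {..<n}" "Fam I" "d * real n \<le> real (card I)" by blast
    have "real (card I) \<le> real (max_size n)" using card_le_max_size[OF I(1,2)] by simp
    moreover have "0 < real n" "real (max_size n) / real n < d" using h by auto
    then have "real (max_size n) < d * real n" by (simp add: pos_divide_less_eq)
    ultimately show False using I(3) by linarith
  qed
  then show False by simp
qed

text \<open>Starting at \<open>m\<close>, cover the interval greedily by windows of length at most \<open>L\<close> and density below \<open>c\<close>; only the last
  window may stick out.\<close>

lemma bad_windows_imp_sparse:
  assumes c: "0 \<le> c" and bad: "\<And>m. \<exists>j\<le>L. real (card (I \<inter> {m..<m + j})) < c * real j"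
  shows "real (card (I \<inter> {m..<n})) \<le> c * real (n - m) + c * real L"
proof (induction "n - m" arbitrary: m rule: less_induct)
  case less
  show ?case
  proof (cases "m < n")
    case False
    then show ?thesis using c by simp
  next
    case True
    obtain j where j: "j \<le> L" "real (card (I \<inter> {m..<m + j})) < c * real j" using bad by blast
    have j0: "0 < j" using j(2) by (cases j) auto
    show ?thesis
    proof (cases "m + j \<le> n")
      case True
      have "I \<inter> {m..<n} = (I \<inter> {m..<m + j}) \<union> (I \<inter> {m + j..<n})" using True by auto
      then have "card (I \<inter> {m..<n}) \<le> card (I \<inter> {m..<m + j}) + card (I \<inter> {m + j..<n})" by (metis card_Un_le)
      moreover have "real (card (I \<inter> {m + j..<n})) \<le> c * real (n - (m + j)) + c * real L"
        using less.hyps[of "m + j"] \<open>m < n\<close> j0 by simp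
      moreover have "c * real j + c * real (n - (m + j)) = c * real (n - m)"
        using True by (simp add: distrib_left[symmetric] of_nat_diff)
      ultimately show ?thesis using j(2) by linarith
    next
      case False
      have "card (I \<inter> {m..<n}) \<le> card (I \<inter> {m..<m + j})" using False by (intro card_mono) auto
      moreover have "c * real j \<le> c * real L" using j(1) c by (intro mult_left_mono) auto
      moreover have "0 \<le> c * real (n - m)" using c by simp
      ultimately show ?thesis using j(2) by linarith
    qed
  qed
qed

text \<open>The finite approximations to the infinite member of \<open>positive_density_member\<close>.\<close>

definition good :: "nat \<Rightarrow> nat set \<Rightarrow> bool" where
  "good L J \<longleftrightarrow> J \<subseteq> {..<L} \<and> Fam J \<and> (\<forall>j\<le>L. max_density * real j \<le> real (card (J \<inter> {..<j})))"

lemma good_below_max_density: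
  assumes c: "0 \<le> c" "c < max_density"
  shows "\<exists>J\<subseteq>{..<L}. Fam J \<and> (\<forall>j\<le>L. c * real j \<le> real (card (J \<inter> {..<j})))"
proof -
  obtain n :: nat where n: "c * real L / (max_density - c) < real n" using reals_Archimedean2 by blast
  obtain I where I: "I \<subseteq> {..<n}" "Fam I" "card I = max_size n" by (rule max_size_attained)
  have "\<exists>m. \<forall>j\<le>L. c * real j \<le> real (card (I \<inter> {m..<m + j}))"
  proof (rule ccontr)
    assume "\<not> ?thesis"
    then have bad: "\<exists>j\<le>L. real (card (I \<inter> {m..<m + j})) < c * real j" for m by (auto simp: not_le)
    have "I \<inter> {0..<n} = I" using I(1) by auto
    then have "real (card I) \<le> c * real n + c * real L"
      using bad_windows_imp_sparse[OF c(1) bad, of 0 n] by simp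
    then have "(max_density - c) * real n \<le> c * real L"
      using max_density_le[of n] I(3) by (simp add: algebra_simps)
    moreover have "c * real L < (max_density - c) * real n" using n c(2) by (simp add: field_simps)
    ultimately show False by linarith
  qed
  then obtain m where m: "\<forall>j\<le>L. c * real j \<le> real (card (I \<inter> {m..<m + j}))" ..
  define J where "J = {i. i < L \<and> m + i \<in> I}"
  have "J \<inter> {..<j} = {i. i < j \<and> m + i \<in> I}" if "j \<le> L" for j using that by (auto simp: J_def)
  then have "\<forall>j\<le>L. c * real j \<le> real (card (J \<inter> {..<j}))" using m by (simp add: card_unshift)
  moreover have "J \<subseteq> {..<L}" by (auto simp: J_def)
  moreover have "Fam J" unfolding J_def by (rule unshift[OF I(2)])
  ultimately show ?thesis by (intro exI[of _ J]) simp
qed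

text \<open>There are finitely many subsets of \<open>{..<L}\<close>, so if all of them failed, they would still fail with a slightly smaller
  constant \<open>c\<close> in place of the maximal density.\<close>

lemma good_exists:
  assumes pos: "0 < max_density"
  shows "\<exists>J. good L J"
proof (rule ccontr)
  assume no: "\<nexists>J. good L J"
  let ?C = "{J. J \<subseteq> {..<L} \<and> Fam J}"
  have "\<forall>J\<in>?C. \<exists>j. j \<le> L \<and> real (card (J \<inter> {..<j})) < max_density * real j"
    using no by (auto simp: good_def not_le)
  from bchoice[OF this] obtain j where j: "\<forall>J\<in>?C. j J \<le> L \<and> real (card (J \<inter> {..<j J})) < max_density * real (j J)" ..
  define e where "e = (\<lambda>J. max_density - real (card (J \<inter> {..<j J})) / real (j J))"
  have jpos: "0 < real (j J)" if "J \<in> ?C" for J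
  proof -
    have "real (card (J \<inter> {..<j J})) < max_density * real (j J)" using bspec[OF j that] by simp
    then show ?thesis by (cases "j J = 0") auto
  qed
  obtain \<epsilon> where \<epsilon>: "0 < \<epsilon>" "\<And>J. J \<in> ?C \<Longrightarrow> \<epsilon> \<le> e J"
  proof (rule finite_positive_lower_bound[of ?C e])
    show "finite ?C" by (rule finite_members)
    show "0 < e J" if J: "J \<in> ?C" for J using bspec[OF j J] jpos[OF J] by (simp add: e_def field_simps)
  qed auto
  \<comment> \<open>The minimum keeps \<open>c\<close> non-negative.\<close>
  define c where "c = max_density - min \<epsilon> max_density / 2"
  have c: "0 \<le> c" "c < max_density" using \<epsilon>(1) pos by (auto simp: c_def)
  obtain J where J: "J \<in> ?C" "\<forall>j\<le>L. c * real j \<le> real (card (J \<inter> {..<j}))"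
    using good_below_max_density[OF c, of L] by auto
  have "c * real (j J) \<le> real (card (J \<inter> {..<j J}))" using J(2) bspec[OF j J(1)] by blast
  then have "c \<le> real (card (J \<inter> {..<j J})) / real (j J)" using jpos[OF J(1)] by (simp add: field_simps)
  then have "c \<le> max_density - \<epsilon>" using \<epsilon>(2)[OF J(1)] by (simp add: e_def)
  then show False using \<epsilon>(1) pos by (simp add: c_def min_def split: if_splits)
qed

lemma good_restrict:
  assumes "good N J" "L \<le> N"
  shows "good L (J \<inter> {..<L})"
proof -
  have "J \<inter> {..<L} \<inter> {..<j} = J \<inter> {..<j}" if "j \<le> L" for j using that by auto
  then show ?thesis using assms subset[of J "J \<inter> {..<L}"] by (auto simp: good_def)
qed

text \<open>The nodes of infinite height in the tree of good sets, as in the proof of Koenig's lemma.\<close>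

definition extendible :: "nat \<Rightarrow> nat set \<Rightarrow> bool" where
  "extendible L J \<longleftrightarrow> (\<forall>N\<ge>L. \<exists>J'. good N J' \<and> J' \<inter> {..<L} = J)"

lemma extendible_imp_good: "extendible L J \<Longrightarrow> good L J"
  unfolding extendible_def good_def by (metis Int_absorb2 order_refl)

lemma extendible_Suc:
  assumes ext: "extendible L J"
  shows "\<exists>J'. extendible (Suc L) J' \<and> J' \<inter> {..<L} = J"
proof (rule ccontr)
  assume no: "\<not> ?thesis"
  have JL: "J \<subseteq> {..<L}" using extendible_imp_good[OF ext] by (simp add: good_def)
  have "\<not> extendible (Suc L) J" using no JL by blast
  then obtain N1 where N1: "Suc L \<le> N1" "\<not> (\<exists>J'. good N1 J' \<and> J' \<inter> {..<Suc L} = J)"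
    unfolding extendible_def by blast
  have "insert L J \<inter> {..<L} = J" using JL by auto
  then have "\<not> extendible (Suc L) (insert L J)" using no by blast
  then obtain N2 where N2: "Suc L \<le> N2" "\<not> (\<exists>J'. good N2 J' \<and> J' \<inter> {..<Suc L} = insert L J)"
    unfolding extendible_def by blast
  obtain J' where J': "good (max N1 N2) J'" "J' \<inter> {..<L} = J"
    using ext N1(1) unfolding extendible_def by (meson Suc_leD le_max_iff_disj)
  have split: "J' \<inter> {..<Suc L} = J \<or> J' \<inter> {..<Suc L} = insert L J"
    using J'(2) by (cases "L \<in> J'") (auto simp: lessThan_Suc)
  have "good N1 (J' \<inter> {..<N1})" "good N2 (J' \<inter> {..<N2})" using good_restrict[OF J'(1)] by auto
  moreover have "J' \<inter> {..<N1} \<inter> {..<Suc L} = J' \<inter> {..<Suc L}" "J' \<inter> {..<N2} \<inter> {..<Suc L} = J' \<inter> {..<Suc L}"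
    using N1(1) N2(1) by auto
  ultimately show False using split N1(2) N2(2) by metis
qed

text \<open>An infinite branch \<open>J\<close> of the tree of good sets has at least \<open>max_density\<close> in every initial segment.  Its density cannot
  be larger in the limit, as \<open>max_size n / n\<close> tends to \<open>max_density\<close>.  A mere lower bound on the densities would not suffice:
  thinning a set cannot remove long gaps, so the limit has to be forced by maximality.\<close>

theorem positive_density_member:
  assumes pos: "0 < max_density"
  obtains J where "Fam J" "(\<lambda>n. real (card (J \<inter> {..<n})) / real n) \<longlonglongrightarrow> max_density"
proof -
  have "\<exists>f. \<forall>L. extendible L (f L) \<and> f (Suc L) \<inter> {..<L} = f L"
  proof (rule dependent_nat_choice)
    have "extendible 0 {}" unfolding extendible_def using good_exists[OF pos] by auto
    then show "\<exists>J. extendible 0 J" ..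
    fix J L assume "extendible L J"
    then show "\<exists>J'. extendible (Suc L) J' \<and> J' \<inter> {..<L} = J" by (rule extendible_Suc)
  qed
  then obtain f where f: "\<forall>L. extendible L (f L) \<and> f (Suc L) \<inter> {..<L} = f L" ..
  then have good: "good L (f L)" and step: "f (Suc L) \<inter> {..<L} = f L" for L
    using extendible_imp_good by auto
  have fL: "f L \<subseteq> {..<L}" for L using good[of L] by (simp add: good_def)
  have coherent: "f N \<inter> {..<L} = f L" if "L \<le> N" for L N
    using that
  proof (induction N rule: dec_induct)
    case base
    then show ?case using fL[of L] by auto
  next
    case (step N)
    have "f (Suc N) \<inter> {..<L} = f (Suc N) \<inter> {..<N} \<inter> {..<L}" using step(1) by auto
    also have "f (Suc N) \<inter> {..<N} = f N" using f by simp
    finally show ?case using step(3) by simp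
  qed
  define J where "J = (\<Union>L. f L)"
  have J: "J \<inter> {..<L} = f L" for L
  proof
    show "f L \<subseteq> J \<inter> {..<L}" using fL by (auto simp: J_def)
    show "J \<inter> {..<L} \<subseteq> f L"
    proof
      fix i assume "i \<in> J \<inter> {..<L}"
      then obtain N where N: "i \<in> f N" "i < L" by (auto simp: J_def)
      show "i \<in> f L"
      proof (cases "L \<le> N")
        case True
        then show ?thesis using coherent[OF True] N by auto
      next
        case False
        then show ?thesis using coherent[of N L] N by auto
      qed
    qed
  qed
  have "Fam J"
  proof (rule finite_character)
    fix F assume F: "F \<subseteq> J" "finite F"
    obtain L where "F \<subseteq> {..<L}" using finite_nat_bounded[OF F(2)] by auto
    then have "F \<subseteq> f L" using F(1) J[of L] by blast
    moreover have "Fam (f L)" using good[of L] by (simp add: good_def)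
    ultimately show "Fam F" using subset by blast
  qed
  moreover have "(\<lambda>n. real (card (J \<inter> {..<n})) / real n) \<longlonglongrightarrow> max_density"
  proof (rule tendsto_sandwich[OF _ _ tendsto_const max_density_limit])
    show "\<forall>\<^sub>F n in sequentially. max_density \<le> real (card (J \<inter> {..<n})) / real n"
      using eventually_gt_at_top[of 0]
    proof eventually_elim
      case (elim n)
      have "max_density * real n \<le> real (card (f n \<inter> {..<n}))" using good[of n] unfolding good_def by blast
      moreover have "f n \<inter> {..<n} = J \<inter> {..<n}" using J[of n] by auto
      ultimately show ?case using elim by (simp add: field_simps)
    qed
    show "\<forall>\<^sub>F n in sequentially. real (card (J \<inter> {..<n})) / real n \<le> real (max_size n) / real n"
    proof (rule always_eventually, rule allI)
      fix n
      have "card (J \<inter> {..<n}) \<le> max_size n" by (intro card_le_max_size subset[OF \<open>Fam J\<close>]) auto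
      then show "real (card (J \<inter> {..<n})) / real n \<le> real (max_size n) / real n"
        by (simp add: divide_right_mono)
    qed
  qed
  ultimately show ?thesis by (rule that)
qed

end

section \<open>Orbits, densities and the equivalences\<close>

lemma ell1_lower_image:
  fixes f :: "'i \<Rightarrow> 'j"
  assumes inj: "inj_on f I"
  shows "ell1_lower \<rho> (f ` I) v \<longleftrightarrow> ell1_lower \<rho> I (\<lambda>i. v (f i))"
proof
  assume l: "ell1_lower \<rho> (f ` I) v"
  show "ell1_lower \<rho> I (\<lambda>i. v (f i))"
    unfolding ell1_lower_def
  proof (intro allI impI)
    fix F and a :: "'i \<Rightarrow> complex" assume F: "F \<subseteq> I" "finite F"
    have injF: "inj_on f F" by (rule inj_on_subset[OF inj F(1)])
    let ?b = "\<lambda>j. a (inv_into F f j)"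
    have b: "?b (f i) = a i" if "i \<in> F" for i using that by (simp add: inv_into_f_f[OF injF])
    have "\<rho> * (\<Sum>j\<in>f ` F. cmod (?b j)) \<le> norm (\<Sum>j\<in>f ` F. ?b j *\<^sub>C v j)"
      using F by (intro ell1_lowerD[OF l]) auto
    moreover have "(\<Sum>j\<in>f ` F. cmod (?b j)) = (\<Sum>i\<in>F. cmod (a i))"
      unfolding sum.reindex[OF injF] using b by (intro sum.cong) auto
    moreover have "(\<Sum>j\<in>f ` F. ?b j *\<^sub>C v j) = (\<Sum>i\<in>F. a i *\<^sub>C v (f i))"
      unfolding sum.reindex[OF injF] using b by (intro sum.cong) auto
    ultimately show "\<rho> * (\<Sum>i\<in>F. cmod (a i)) \<le> norm (\<Sum>i\<in>F. a i *\<^sub>C v (f i))" by simp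
  qed
next
  assume l: "ell1_lower \<rho> I (\<lambda>i. v (f i))"
  show "ell1_lower \<rho> (f ` I) v"
    unfolding ell1_lower_def
  proof (intro allI impI)
    fix G and a :: "'j \<Rightarrow> complex" assume G: "G \<subseteq> f ` I" "finite G"
    obtain F where F: "F \<subseteq> I" "G = f ` F" using G(1) by (rule subset_imageE)
    have injF: "inj_on f F" by (rule inj_on_subset[OF inj F(1)])
    have "finite F" using G(2) F(2) finite_image_iff[OF injF] by simp
    then have "\<rho> * (\<Sum>i\<in>F. cmod (a (f i))) \<le> norm (\<Sum>i\<in>F. a (f i) *\<^sub>C v (f i))"
      by (rule ell1_lowerD[OF l F(1)])
    then show "\<rho> * (\<Sum>i\<in>G. cmod (a i)) \<le> norm (\<Sum>i\<in>G. a i *\<^sub>C v i)"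
      unfolding F(2) sum.reindex[OF injF] by simp
  qed
qed

lemma ell1_lower_isometry:
  assumes "clinear_on UNIV g" "\<And>y. norm (g y) = norm y"
  shows "ell1_lower \<rho> I (\<lambda>i. g (v i)) \<longleftrightarrow> ell1_lower \<rho> I v"
  unfolding ell1_lower_def clinear_on_sum[OF assms(1), symmetric] assms(2) ..

text \<open>The set lives on one half of the integers, which halves the density.\<close>

lemma density_int_image:
  assumes "(\<lambda>n. real (card (J \<inter> {..<n})) / real n) \<longlonglongrightarrow> D"
  shows "(\<lambda>n. real (card (int ` J \<inter> {- int n..int n})) / (2 * real n + 1)) \<longlonglongrightarrow> D / 2"
proof -
  have "(\<lambda>n. real (card (J \<inter> {..<Suc n})) / real (Suc n) * (1 / (2 - inverse (real (Suc n))))) \<longlonglongrightarrow> D * (1 / (2 - 0))"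
    by (intro tendsto_intros LIMSEQ_inverse_real_of_nat filterlim_compose[OF assms filterlim_Suc]) auto
  moreover have "real (card (J \<inter> {..<Suc n})) / real (Suc n) * (1 / (2 - inverse (real (Suc n))))
      = real (card (int ` J \<inter> {- int n..int n})) / (2 * real n + 1)" for n
  proof -
    have "int ` J \<inter> {- int n..int n} = int ` (J \<inter> {..<Suc n})" by auto
    then have "card (int ` J \<inter> {- int n..int n}) = card (J \<inter> {..<Suc n})" by (simp add: card_image)
    moreover have "real (Suc n) * (2 - inverse (real (Suc n))) = 2 * real n + 1"
      by (simp add: right_diff_distrib)
    ultimately show ?thesis by (metis (no_types) divide_divide_eq_left times_divide_eq_right mult.right_neutral)
  qed
  ultimately show ?thesis by simp
qed

context isometric_system
begin

lemma int_iterate_of_nat: "int_iterate \<alpha> (int n) = \<alpha> ^^ n"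
  by (simp add: int_iterate_def)

lemma int_iterate_Suc: "int_iterate \<alpha> (i + 1) x = \<alpha> (int_iterate \<alpha> i x)"
proof (cases "0 \<le> i")
  case True
  then have "nat (i + 1) = Suc (nat i)" by simp
  then show ?thesis using True by (simp add: int_iterate_def)
next
  case False
  then obtain m where m: "nat (- i) = Suc m" by (cases "nat (- i)") auto
  then have i: "i = - int (Suc m)" using False by linarith
  have "\<alpha> (int_iterate \<alpha> i x) = (inv \<alpha> ^^ m) x"
    using False m bij by (simp add: int_iterate_def bij_is_surj surj_f_inv_f)
  moreover have "int_iterate \<alpha> (i + 1) x = (inv \<alpha> ^^ m) x"
  proof -
    have "i + 1 = - int m" using i by simp
    then show ?thesis by (cases "m = 0") (simp_all add: int_iterate_def)
  qed
  ultimately show ?thesis by simp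
qed

lemma int_iterate_add: "int_iterate \<alpha> (i + int n) x = (\<alpha> ^^ n) (int_iterate \<alpha> i x)"
proof (induction n)
  case (Suc n)
  have "int_iterate \<alpha> (i + int (Suc n)) x = int_iterate \<alpha> (i + int n + 1) x" by (simp add: ac_simps)
  then show ?case using Suc by (simp only: int_iterate_Suc funpow.simps o_apply)
qed simp

lemma ell1_lower_shift:
  "ell1_lower \<rho> ((\<lambda>i. i + int n) ` I) (\<lambda>i. int_iterate \<alpha> i x) \<longleftrightarrow> ell1_lower \<rho> I (\<lambda>i. int_iterate \<alpha> i x)"
proof -
  have "inj_on (\<lambda>i. i + int n) I" by (rule inj_onI) simp
  then have "ell1_lower \<rho> ((\<lambda>i. i + int n) ` I) (\<lambda>i. int_iterate \<alpha> i x)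
      \<longleftrightarrow> ell1_lower \<rho> I (\<lambda>i. (\<alpha> ^^ n) (int_iterate \<alpha> i x))"
    by (simp add: ell1_lower_image int_iterate_add)
  then show ?thesis by (simp add: ell1_lower_isometry[OF funpow_isometry])
qed

lemma ell1_lower_int_image:
  "ell1_lower \<rho> (int ` I) (\<lambda>i. int_iterate \<alpha> i x) \<longleftrightarrow> ell1_lower \<rho> I (\<lambda>i. (\<alpha> ^^ i) x)"
  by (simp add: ell1_lower_image int_iterate_of_nat)

lemma hereditary_orbit: "hereditary_family (\<lambda>I. ell1_lower \<rho> I (\<lambda>i. (\<alpha> ^^ i) x))"
proof
  show "ell1_lower \<rho> {} (\<lambda>i. (\<alpha> ^^ i) x)" by (simp add: ell1_lower_def)
  show "ell1_lower \<rho> J (\<lambda>i. (\<alpha> ^^ i) x)" if "ell1_lower \<rho> I (\<lambda>i. (\<alpha> ^^ i) x)" "J \<subseteq> I" for I J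
    using that by (rule ell1_lower_subset)
  show "ell1_lower \<rho> J (\<lambda>i. (\<alpha> ^^ i) x)" if "ell1_lower \<rho> ((+) m ` J) (\<lambda>i. (\<alpha> ^^ i) x)" for m J
  proof -
    have "ell1_lower \<rho> J (\<lambda>i. (\<alpha> ^^ m) ((\<alpha> ^^ i) x))"
      using that by (simp add: ell1_lower_image funpow_add)
    then show ?thesis by (simp add: ell1_lower_isometry[OF funpow_isometry])
  qed
  show "ell1_lower \<rho> I (\<lambda>i. (\<alpha> ^^ i) x)" if "\<And>F. F \<subseteq> I \<Longrightarrow> finite F \<Longrightarrow> ell1_lower \<rho> F (\<lambda>i. (\<alpha> ^^ i) x)" for I
    unfolding ell1_lower_def using ell1_lowerD[OF that subset_refl] by blast
qed

text \<open>For the converse, the part of the set in \<open>{-n..n}\<close> is shifted by \<open>n\<close>; shifts preserve lower estimates since \<open>\<alpha>\<close> is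
  isometric.\<close>

theorem many_ell1_iff_positive_density:
  "many_ell1 \<alpha> x \<longleftrightarrow> (\<exists>I. ell1_isomorphism_set \<alpha> x I \<and> positive_density I)"
proof
  assume "many_ell1 \<alpha> x"
  then obtain \<rho> d where \<rho>: "0 < \<rho>" and d: "0 < d" and freq: "\<exists>\<^sub>F n in sequentially. \<exists>I\<subseteq>{..<n}.
     d * real n \<le> real (card I) \<and> ell1_lower \<rho> I (\<lambda>i. (\<alpha> ^^ i) x)"
    unfolding many_ell1_def by (elim exE conjE)
  interpret fam: hereditary_family "\<lambda>I. ell1_lower \<rho> I (\<lambda>i. (\<alpha> ^^ i) x)" by (rule hereditary_orbit)
  have pos: "0 < fam.max_density"
  proof (rule fam.max_density_pos[OF d])
    show "\<exists>\<^sub>F n in sequentially. \<exists>I\<subseteq>{..<n}. ell1_lower \<rho> I (\<lambda>i. (\<alpha> ^^ i) x) \<and> d * real n \<le> real (card I)"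
      using freq by (rule frequently_elim1) blast
  qed
  obtain J where J: "ell1_lower \<rho> J (\<lambda>i. (\<alpha> ^^ i) x)" "(\<lambda>n. real (card (J \<inter> {..<n})) / real n) \<longlonglongrightarrow> fam.max_density"
    by (rule fam.positive_density_member[OF pos])
  have "ell1_lower \<rho> (int ` J) (\<lambda>i. int_iterate \<alpha> i x)" using J(1) by (simp only: ell1_lower_int_image)
  then have "ell1_isomorphism_set \<alpha> x (int ` J)"
    unfolding ell1_isomorphism_set_def
    by (rule ell1_lower_imp_equivalent(1)[OF \<rho>, where R = "norm x"]) (auto simp: int_iterate_of_nat funpow_isometry(2))
  moreover have "positive_density (int ` J)"
    unfolding positive_density_def using density_int_image[OF J(2)] pos by (intro exI[of _ "fam.max_density / 2"]) simp
  ultimately show "\<exists>I. ell1_isomorphism_set \<alpha> x I \<and> positive_density I" by blast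
next
  assume "\<exists>I. ell1_isomorphism_set \<alpha> x I \<and> positive_density I"
  then obtain I D where I: "equivalent_ell1_basis I (\<lambda>i. int_iterate \<alpha> i x)" and D: "0 < D"
    and lim: "(\<lambda>n. real (card (I \<inter> {- int n..int n})) / (2 * real n + 1)) \<longlonglongrightarrow> D"
    unfolding ell1_isomorphism_set_def positive_density_def by blast
  obtain \<rho> where \<rho>: "0 < \<rho>" "ell1_lower \<rho> I (\<lambda>i. int_iterate \<alpha> i x)" by (rule equivalent_imp_ell1_lower[OF I])
  have "\<forall>\<^sub>F n in sequentially. D / 2 < real (card (I \<inter> {- int n..int n})) / (2 * real n + 1)"
    using D by (intro order_tendstoD(1)[OF lim]) simp
  then obtain N where N: "\<And>n. n \<ge> N \<Longrightarrow> D / 2 < real (card (I \<inter> {- int n..int n})) / (2 * real n + 1)"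
    unfolding eventually_sequentially by blast
  have "\<exists>\<^sub>F n in sequentially. \<exists>J\<subseteq>{..<n}. D / 2 * real n \<le> real (card J) \<and> ell1_lower \<rho> J (\<lambda>i. (\<alpha> ^^ i) x)"
    unfolding frequently_sequentially
  proof
    fix M
    define n where "n = max M N"
    let ?W = "I \<inter> {- int n..int n}"
    let ?J = "(\<lambda>i. nat (i + int n)) ` ?W"
    have injJ: "inj_on (\<lambda>i. nat (i + int n)) ?W" by (rule inj_onI) auto
    have "D / 2 < real (card ?W) / (2 * real n + 1)" by (rule N) (simp add: n_def)
    then have "D / 2 * real (2 * n + 1) \<le> real (card ?J)"
      unfolding card_image[OF injJ] by (simp add: field_simps)
    moreover have "?J \<subseteq> {..<2 * n + 1}" by auto
    moreover have "ell1_lower \<rho> ?J (\<lambda>i. (\<alpha> ^^ i) x)"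
    proof -
      have "int ` ?J = (\<lambda>i. i + int n) ` ?W" unfolding image_image by (rule image_cong) auto
      moreover have "ell1_lower \<rho> ((\<lambda>i. i + int n) ` ?W) (\<lambda>i. int_iterate \<alpha> i x)"
        unfolding ell1_lower_shift by (rule ell1_lower_subset[OF \<rho>(2)]) auto
      ultimately show ?thesis by (simp only: ell1_lower_int_image[symmetric])
    qed
    ultimately show "\<exists>k\<ge>M. \<exists>J\<subseteq>{..<k}. D / 2 * real k \<le> real (card J) \<and> ell1_lower \<rho> J (\<lambda>i. (\<alpha> ^^ i) x)"
      by (intro exI[of _ "2 * n + 1"] conjI exI[of _ ?J]) (auto simp: n_def)
  qed
  then show "many_ell1 \<alpha> x" unfolding many_ell1_def using \<rho>(1) D half_gt_zero by blast
qed

theorem many_ell1_iff_K_equivalent: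
  "many_ell1 \<alpha> x \<longleftrightarrow> (\<exists>K\<ge>1. \<exists>d>0. \<exists>(n :: nat \<Rightarrow> nat) (I :: nat \<Rightarrow> int set).
     filterlim n at_top sequentially \<and>
     (\<forall>k. I k \<subseteq> {0..<int (n k)} \<and> real (card (I k)) \<ge> d * real (n k) \<and>
        K_equivalent_ell1_basis K (I k) (\<lambda>i. int_iterate \<alpha> i x)))"
proof
  assume "many_ell1 \<alpha> x"
  then obtain \<rho> d where \<rho>: "0 < \<rho>" and d: "0 < d" and freq: "\<exists>\<^sub>F n in sequentially. \<exists>I\<subseteq>{..<n}.
     d * real n \<le> real (card I) \<and> ell1_lower \<rho> I (\<lambda>i. (\<alpha> ^^ i) x)"
    unfolding many_ell1_def by (elim exE conjE)
  have "\<forall>k. \<exists>n. n \<ge> k \<and> (\<exists>I\<subseteq>{..<n}. d * real n \<le> real (card I) \<and> ell1_lower \<rho> I (\<lambda>i. (\<alpha> ^^ i) x))"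
    using freq unfolding frequently_sequentially by blast
  from choice[OF this] obtain n where n: "\<forall>k. n k \<ge> k \<and> (\<exists>I\<subseteq>{..<n k}. d * real (n k) \<le> real (card I)
      \<and> ell1_lower \<rho> I (\<lambda>i. (\<alpha> ^^ i) x))" ..
  then have "\<forall>k. \<exists>I. I \<subseteq> {..<n k} \<and> d * real (n k) \<le> real (card I) \<and> ell1_lower \<rho> I (\<lambda>i. (\<alpha> ^^ i) x)" by blast
  from choice[OF this] obtain I where I: "\<forall>k. I k \<subseteq> {..<n k} \<and> d * real (n k) \<le> real (card (I k))
      \<and> ell1_lower \<rho> (I k) (\<lambda>i. (\<alpha> ^^ i) x)" ..
  \<comment> \<open>The maximum makes the constant \<open>R / \<rho>\<close> at least 1.\<close>
  define R where "R = max (norm x) \<rho>"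
  have R: "norm x \<le> R" "\<rho> \<le> R" "0 \<le> R" by (auto simp: R_def le_max_iff_disj)
  have "filterlim n at_top sequentially"
    by (rule filterlim_at_top_mono[OF filterlim_ident]) (use n in simp)
  moreover have "int ` I k \<subseteq> {0..<int (n k)} \<and> real (card (int ` I k)) \<ge> d * real (n k) \<and>
        K_equivalent_ell1_basis (R / \<rho>) (int ` I k) (\<lambda>i. int_iterate \<alpha> i x)" for k
  proof -
    have Ik: "I k \<subseteq> {..<n k}" "d * real (n k) \<le> real (card (I k))" "ell1_lower \<rho> (I k) (\<lambda>i. (\<alpha> ^^ i) x)"
      using I by auto
    have "int ` I k \<subseteq> {0..<int (n k)}" using Ik(1) by auto
    moreover have "card (int ` I k) = card (I k)" by (simp add: card_image)
    moreover have "ell1_lower \<rho> (int ` I k) (\<lambda>i. int_iterate \<alpha> i x)"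
      using Ik(3) by (simp only: ell1_lower_int_image)
    then have "K_equivalent_ell1_basis (R / \<rho>) (int ` I k) (\<lambda>i. int_iterate \<alpha> i x)"
      by (rule ell1_lower_imp_equivalent(2)[OF \<rho>])
        (use R in \<open>auto simp: int_iterate_of_nat funpow_isometry(2)\<close>)
    ultimately show ?thesis using Ik(2) by simp
  qed
  moreover have "1 \<le> R / \<rho>" using R(2) \<rho> by simp
  ultimately show "\<exists>K\<ge>1. \<exists>d>0. \<exists>(n :: nat \<Rightarrow> nat) (I :: nat \<Rightarrow> int set).
     filterlim n at_top sequentially \<and>
     (\<forall>k. I k \<subseteq> {0..<int (n k)} \<and> real (card (I k)) \<ge> d * real (n k) \<and>
        K_equivalent_ell1_basis K (I k) (\<lambda>i. int_iterate \<alpha> i x))"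
    using d by (intro exI[of _ "R / \<rho>"] exI[of _ d] exI[of _ n] exI[of _ "\<lambda>k. int ` I k"] conjI allI) auto
next
  assume "\<exists>K\<ge>1. \<exists>d>0. \<exists>(n :: nat \<Rightarrow> nat) (I :: nat \<Rightarrow> int set).
     filterlim n at_top sequentially \<and>
     (\<forall>k. I k \<subseteq> {0..<int (n k)} \<and> real (card (I k)) \<ge> d * real (n k) \<and>
        K_equivalent_ell1_basis K (I k) (\<lambda>i. int_iterate \<alpha> i x))"
  then obtain K d and n :: "nat \<Rightarrow> nat" and I :: "nat \<Rightarrow> int set" where K: "1 \<le> K" and d: "0 < d"
    and n: "filterlim n at_top sequentially"
    and I: "\<forall>k. I k \<subseteq> {0..<int (n k)} \<and> real (card (I k)) \<ge> d * real (n k) \<and>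
        K_equivalent_ell1_basis K (I k) (\<lambda>i. int_iterate \<alpha> i x)"
    by (elim exE conjE)
  have lower: "0 < norm x \<and> ell1_lower (1 / (K / norm x)) (nat ` I k) (\<lambda>i. (\<alpha> ^^ i) x)" if nk: "0 < n k" for k
  proof -
    have Ik: "I k \<subseteq> {0..<int (n k)}" "real (card (I k)) \<ge> d * real (n k)"
      "K_equivalent_ell1_basis K (I k) (\<lambda>i. int_iterate \<alpha> i x)" using I by auto
    have "0 < d * real (n k)" using d nk by simp
    then have "I k \<noteq> {}" using Ik(2) by auto
    then obtain i where i: "i \<in> I k" by blast
    then have "i = int (nat i)" using Ik(1) by auto
    then have "int_iterate \<alpha> i x = (\<alpha> ^^ nat i) x" using int_iterate_of_nat[of "nat i"] by simp
    then have nx: "norm (int_iterate \<alpha> i x) = norm x" by (simp add: funpow_isometry(2))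
    have K0: "0 < K" using K by simp
    have x: "0 < norm x" "ell1_lower (1 / (K / norm x)) (I k) (\<lambda>i. int_iterate \<alpha> i x)"
      using K_equivalent_imp_ell1_lower[OF Ik(3) K0 i nx] by auto
    have "int ` nat ` I k = (\<lambda>i. i) ` I k" unfolding image_image using Ik(1) by (intro image_cong) auto
    then have "int ` nat ` I k = I k" by simp
    then have "ell1_lower (1 / (K / norm x)) (int ` nat ` I k) (\<lambda>i. int_iterate \<alpha> i x)" using x(2) by (simp only:)
    then show ?thesis using x(1) by (simp only: ell1_lower_int_image simp_thms)
  qed
  have "\<forall>\<^sub>F k in sequentially. 1 \<le> n k" using n unfolding filterlim_at_top by blast
  then obtain k0 where "1 \<le> n k0" unfolding eventually_sequentially by blast
  then have "0 < n k0" by simp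
  then have x: "0 < norm x" using lower by blast
  have "\<exists>\<^sub>F m in sequentially. \<exists>J\<subseteq>{..<m}. d * real m \<le> real (card J) \<and> ell1_lower (1 / (K / norm x)) J (\<lambda>i. (\<alpha> ^^ i) x)"
    unfolding frequently_sequentially
  proof
    fix M
    have "\<forall>\<^sub>F k in sequentially. max M 1 \<le> n k" using n unfolding filterlim_at_top by blast
    then obtain k where k: "max M 1 \<le> n k" unfolding eventually_sequentially by blast
    have Ik: "I k \<subseteq> {0..<int (n k)}" "real (card (I k)) \<ge> d * real (n k)" using I by auto
    have "inj_on nat (I k)" by (rule inj_on_inverseI[where g = int]) (use Ik(1) in auto)
    then have "card (nat ` I k) = card (I k)" by (rule card_image)
    moreover have "nat ` I k \<subseteq> {..<n k}" using Ik(1) by (auto simp: subset_iff nat_less_iff)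
    ultimately show "\<exists>m\<ge>M. \<exists>J\<subseteq>{..<m}. d * real m \<le> real (card J) \<and> ell1_lower (1 / (K / norm x)) J (\<lambda>i. (\<alpha> ^^ i) x)"
      using k lower[of k] Ik(2) by (intro exI[of _ "n k"] conjI exI[of _ "nat ` I k"]) auto
  qed
  moreover have "0 < 1 / (K / norm x)" using K x by simp
  ultimately show "many_ell1 \<alpha> x" unfolding many_ell1_def using d by blast
qed

end

theorem theorem3p5:
  fixes \<alpha> :: "'a::complex_banach \<Rightarrow> 'a"
    and Z :: "('a \<Rightarrow> complex) set"
  assumes "isometric_automorphism \<alpha>"
    and "closedin (top_of_set dual_ball) Z"
    and "dual_map \<alpha> ` Z = Z"
    and "\<exists>W. W \<subseteq> C_space Z \<and> csubspace W \<and> norm_closed_in (C_space Z) (sup_norm Z) W \<and>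
           isomorphism_on UNIV norm W (sup_norm Z) (eval_on Z)"
  shows
    "(hc \<alpha> > 0 \<longleftrightarrow> htop (top_of_set dual_ball) (dual_map \<alpha>) > 0) \<and>
     (hc \<alpha> > 0 \<longleftrightarrow> htop (top_of_set dual_ball) (dual_map \<alpha>) = \<infinity>) \<and>
     (hc \<alpha> > 0 \<longleftrightarrow>
        (\<exists>x. \<exists>K\<ge>1. \<exists>d>0. \<exists>(n :: nat \<Rightarrow> nat) (I :: nat \<Rightarrow> int set).
           filterlim n at_top sequentially \<and>
           (\<forall>k. I k \<subseteq> {0..<int (n k)} \<and> real (card (I k)) \<ge> d * real (n k) \<and>
                K_equivalent_ell1_basis K (I k) (\<lambda>i. int_iterate \<alpha> i x)))) \<and>
     (hc \<alpha> > 0 \<longleftrightarrow> (\<exists>x I. ell1_isomorphism_set \<alpha> x I \<and> positive_density I)) \<and>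
     (hc \<alpha> > 0 \<longleftrightarrow> htop (top_of_set Z) (dual_map \<alpha>) > 0) \<and>
     (\<forall>\<Delta>. total_set \<Delta> \<longrightarrow>
        (hc \<alpha> > 0 \<longleftrightarrow>
          (\<exists>x\<in>\<Delta>. \<exists>K\<ge>1. \<exists>d>0. \<exists>(n :: nat \<Rightarrow> nat) (I :: nat \<Rightarrow> int set).
             filterlim n at_top sequentially \<and>
             (\<forall>k. I k \<subseteq> {0..<int (n k)} \<and> real (card (I k)) \<ge> d * real (n k) \<and>
                  K_equivalent_ell1_basis K (I k) (\<lambda>i. int_iterate \<alpha> i x)))) \<and>
        (hc \<alpha> > 0 \<longleftrightarrow> (\<exists>x\<in>\<Delta>. \<exists>I. ell1_isomorphism_set \<alpha> x I \<and> positive_density I)))"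
proof -
  let ?D = "dual_ball :: ('a \<Rightarrow> complex) set"
  interpret sys: isometric_system \<alpha> by (rule isometric_system.intro) fact
  interpret ball: dual_system \<alpha> ?D by (rule dual_system_dual_ball) fact
  have Z: "Z \<subseteq> ?D" "compact Z"
    using assms(2) closedin_imp_subset closedin_compact[OF compact_dual_ball] by auto
  interpret Z: dual_system \<alpha> Z
    by unfold_locales (use assms(1,3) Z in auto)
  obtain W where W: "isomorphism_on UNIV norm W (sup_norm Z) (eval_on Z)" using assms(4) by blast
  obtain \<kappa> where nZ: "norming \<kappa> Z" by (rule isomorphism_imp_norming[OF Z(1) W])
  have nD: "norming \<kappa> ?D" using nZ Z(1) unfolding norming_def by blast
  have from_hc: "\<exists>x\<in>\<Delta>. many_ell1 \<alpha> x" if "total_set \<Delta>" "0 < hc \<alpha>" for \<Delta>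
    by (rule ball.positive_entropy_imp_many_ell1[OF that(1) hc_pos_imp_htop_pos[OF assms(1) that(2)]])
  have to_hc: "0 < hc \<alpha>" if "many_ell1 \<alpha> x" for x
    by (rule many_ell1_imp_hc_pos[OF assms(1) nD that])
  have tot: "total_set (UNIV :: 'a set)"
    unfolding total_set_def using cvs.span_superset[of UNIV] closure_subset by blast
  have main: "0 < hc \<alpha> \<longleftrightarrow> (\<exists>x\<in>\<Delta>. many_ell1 \<alpha> x)" if "total_set \<Delta>" for \<Delta>
    using from_hc[OF that] to_hc by blast
  have some: "0 < hc \<alpha> \<longleftrightarrow> (\<exists>x. many_ell1 \<alpha> x)" using main[OF tot] by simp
  have E2: "0 < hc \<alpha> \<longleftrightarrow> 0 < htop (top_of_set ?D) (dual_map \<alpha>)"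
    using hc_pos_imp_htop_pos[OF assms(1)] ball.positive_entropy_imp_many_ell1[OF tot] to_hc by blast
  have E3: "0 < hc \<alpha> \<longleftrightarrow> htop (top_of_set ?D) (dual_map \<alpha>) = \<infinity>"
  proof
    assume "0 < hc \<alpha>"
    then obtain x where "many_ell1 \<alpha> x" using some by blast
    then show "htop (top_of_set ?D) (dual_map \<alpha>) = \<infinity>" by (rule many_ell1_imp_infinite_entropy[OF assms(1) nD])
  qed (simp add: E2)
  have E6: "0 < hc \<alpha> \<longleftrightarrow> 0 < htop (top_of_set Z) (dual_map \<alpha>)"
    using Z.positive_entropy_imp_many_ell1[OF tot] Z.many_ell1_imp_positive_entropy[OF nZ] some to_hc by blast
  show ?thesis
    using E2 E3 E6 some main
    unfolding sys.many_ell1_iff_K_equivalent[symmetric] sys.many_ell1_iff_positive_density[symmetric]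
    by (simp add: sys.many_ell1_iff_positive_density[symmetric])
qed

end
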